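(* Let $\pi_\star\in\mathcal P([-M,M])$ and, for each $n$, let $\theta_i\sim\pi_\star$ marginally and $X_i\sim\mu_i$ marginally, $1\le i\le n$, where the $\theta_i$ and the $X_i$ are not necessarily independent across $i$. Suppose that: (A) (approximate independence) for any fixed sequence of functions $f_i:\mathbb R\to\mathbb R$, $1\le i\le n$, with $|f_i'(0)|\le1$ and $\max_{1\le i\le n}\|f_i''\|_\infty\le1$, $$\frac1n\sum_{i=1}^n\left(f_i(X_i)-\mathbb E f_i(X_i)\right)\overset{\mathbb P}{\to}0\qquad\text{and}\qquad \limsup_{T\to\infty}\limsup_{n\to\infty}\frac1n\sum_{i=1}^n\mathbb E\left[X_i^2\mathbf 1(|X_i|\ge T)\right]=0;$$ (B) (approximate optimality with estimated variances) $\hat\sigma_i\equiv\hat\sigma_i(X_1,\dots,X_n)$ satisfy $\min_i\{\hat\sigma_i,\sigma_i\}\ge c$ and $\max_i\{\hat\sigma_i,\sigma_i\}\le C$ almost surely for fixed constants $c,C>0$; $\hat\pi_n\in\mathcal P([-M,M])$ almost surely; there exists a deterministic sequence $r_n\to0$ such that $$\frac1n\sum_{i=1}^n\log\int\phi(X_i-\theta;\hat\sigma_i)\,d\hat\pi_n(\theta)\ \ge\ \frac1n\sum_{i=1}^n\log\int\phi(X_i-\theta;\hat\sigma_i)\,d\pi_\star(\theta)-r_n;$$ and $\frac1n\sum_{i=1}^n|\hat\sigma_i-\sigma_i|\overset{\mathbb P}{\to}0$. If $\mathcal V_n\to0$, then $\hat\pi_n$ converges weakly to $\pi_\star$ in probability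 and $$\frac1n\sum_{i=1}^n\mathrm{Hel}^2\left(f_{\hat\pi_n,\sigma_i},f_{\pi_\star,\sigma_i}\right)\overset{\mathbb P}{\to}0 .$$ In addition, assume that $(X_i,\theta_i)$ is coupled for each $1\le i\le n$ to the normal experiment generating $(Z_i,\theta_i)$, $Z_i=\theta_i+\varepsilon_i$ with $\varepsilon_i\sim N(0,\sigma_i^2)$, where $\varepsilon_1,\dots,\varepsilon_n$ are independent of each other and of $(\theta_1,\dots,\theta_n)$, and that $\mathcal W_n\to0$. Define the denoisers with the estimated variances $\hat\theta_i:=h_{\hat\pi_n}(X_i;\hat\sigma_i)$. Then $$\mathrm{Regret}_n\to0 .$$
   Context: $\mathcal P([-M,M])$ is the set of probability measures on $[-M,M]$, $M>0$ fixed; $\phi(\cdot;\sigma)$ is the density of $N(0,\sigma^2)$; $f_{\pi,\sigma}(x):=\int\phi(x-\theta;\sigma)\,d\pi(\theta)$; $\mathrm{Hel}^2(p,q):=\frac12\int(\sqrt{p(x)}-\sqrt{q(x)})^2dx$; $h_\pi(x;\sigma):=\int\theta\,\phi(x-\theta;\sigma)\,d\pi(\theta)/f_{\pi,\sigma}(x)$. $W_p$ is the Wasserstein-$p$ distance. $$\mathcal V_n:=\frac1n\sum_{i=1}^nW_1(\mu_i,f_{\pi_\star,\sigma_i}),\qquad \mathcal W_n^2:=\frac1n\sum_{i=1}^n\mathbb E_{\theta_i\sim\pi_\star}\left[W_2^2\left(\mathrm{Law}(X_i\mid\theta_i),N(\theta_i,\sigma_i^2)\right)\right],$$ $$\mathrm{Regret}_n:=\sqrt{\frac1n\sum_{i=1}^n\mathbb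 E|\theta_i-\hat\theta_i|^2}-\sqrt{\frac1n\sum_{i=1}^n\mathbb E\bigl|\theta_i-\mathbb E_{\pi_\star}[\theta_i\mid Z_i]\bigr|^2},$$ where $\mathbb E_{\pi_\star}[\theta_i\mid Z_i]=h_{\pi_\star}(Z_i;\sigma_i)$. All limits are as $n\to\infty$ (triangular arrays). *)

theory Defs
  imports "HOL-Probability.Probability"
begin

definition prob_measures_on :: "real set \<Rightarrow> real measure set" where
  "prob_measures_on A = {p. prob_space p \<and> sets p = sets borel \<and> emeasure p A = 1}"

definition normal_measure :: "real \<Rightarrow> real \<Rightarrow> real measure" where
  "normal_measure m s = density lborel (\<lambda>x. ennreal (normal_density m s x))"


subsection \<open>Gaussian mixtures, posterior means and Hellinger distance\<close>

definition mixture_density :: "real measure \<Rightarrow> real \<Rightarrow> real \<Rightarrow> real" where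
  "mixture_density p s x = (\<integral>t. normal_density 0 s (x - t) \<partial>p)"

definition mixture_measure :: "real measure \<Rightarrow> real \<Rightarrow> real measure" where
  "mixture_measure p s = density lborel (\<lambda>x. ennreal (mixture_density p s x))"

definition posterior_mean :: "real measure \<Rightarrow> real \<Rightarrow> real \<Rightarrow> real" where
  "posterior_mean p s x =
     (\<integral>t. t * normal_density 0 s (x - t) \<partial>p) / mixture_density p s x"

definition hellinger_sq :: "(real \<Rightarrow> real) \<Rightarrow> (real \<Rightarrow> real) \<Rightarrow> real" where
  "hellinger_sq p q = 1 / 2 * (\<integral>x. (sqrt (p x) - sqrt (q x))\<^sup>2 \<partial>lborel)"


subsection \<open>Wasserstein distances\<close>

text \<open>The distances take values in \<^typ>\<open>ennreal\<close>, so that they are infinite, rather than an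
  arbitrary real number, when a moment is missing.\<close>

definition ennreal_root :: "nat \<Rightarrow> ennreal \<Rightarrow> ennreal" where
  "ennreal_root p x = (if x = \<infinity> then \<infinity> else ennreal (root p (enn2real x)))"

definition couplings :: "real measure \<Rightarrow> real measure \<Rightarrow> (real \<times> real) measure set" where
  "couplings \<mu> \<nu> = {\<gamma>. sets \<gamma> = sets (borel \<Otimes>\<^sub>M borel) \<and>
     distr \<gamma> borel fst = \<mu> \<and> distr \<gamma> borel snd = \<nu>}"

definition wasserstein :: "nat \<Rightarrow> real measure \<Rightarrow> real measure \<Rightarrow> ennreal" where
  "wasserstein p \<mu> \<nu> =
     ennreal_root p (INF \<gamma>\<in>couplings \<mu> \<nu>. \<integral>\<^sup>+z. ennreal (\<bar>fst z - snd z\<bar> ^ p) \<partial>\<gamma>)"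


subsection \<open>Modes of convergence for triangular arrays\<close>

definition converges_in_prob ::
    "(nat \<Rightarrow> 'a measure) \<Rightarrow> (nat \<Rightarrow> 'a \<Rightarrow> real) \<Rightarrow> real \<Rightarrow> bool" where
  "converges_in_prob P Y l \<longleftrightarrow>
     (\<forall>e>0. (\<lambda>n. measure (P n) {\<omega> \<in> space (P n). \<bar>Y n \<omega> - l\<bar> > e}) \<longlonglongrightarrow> 0)"

definition converges_weakly_in_prob ::
    "(nat \<Rightarrow> 'a measure) \<Rightarrow> (nat \<Rightarrow> 'a \<Rightarrow> real measure) \<Rightarrow> real measure \<Rightarrow> bool" where
  "converges_weakly_in_prob P Q q \<longleftrightarrow>
     (\<forall>g::real \<Rightarrow> real. continuous_on UNIV g \<longrightarrow> bounded (range g) \<longrightarrow>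
        converges_in_prob P (\<lambda>n \<omega>. \<integral>t. g t \<partial>Q n \<omega>) (\<integral>t. g t \<partial>q))"


subsection \<open>Approximate independence\<close>

definition test_function :: "(real \<Rightarrow> real) \<Rightarrow> bool" where
  "test_function f \<longleftrightarrow>
     (\<forall>x. f differentiable at x) \<and> (\<forall>x. deriv f differentiable at x) \<and>
     \<bar>deriv f 0\<bar> \<le> 1 \<and> (\<forall>x. \<bar>deriv (deriv f) x\<bar> \<le> 1)"

text \<open>The test functions may depend on \<open>n\<close>, as everything else in the array does. For every fixed
  \<open>n\<close> an expectation \<open>E f\<^sub>i(X\<^sub>i)\<close> can be undefined (and is then 0 by convention), but
  the second condition forces finite second moments for all large \<open>n\<close>.\<close>

definition approx_independent ::
    "(nat \<Rightarrow> 'a measure) \<Rightarrow> (nat \<Rightarrow> nat \<Rightarrow> 'a \<Rightarrow> real) \<Rightarrow> bool" where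
  "approx_independent P X \<longleftrightarrow>
     (\<forall>f. (\<forall>n. \<forall>i\<in>{1..n}. test_function (f n i)) \<longrightarrow>
        converges_in_prob P
          (\<lambda>n \<omega>. 1 / real n *
             (\<Sum>i=1..n. f n i (X n i \<omega>) - (\<integral>\<omega>'. f n i (X n i \<omega>') \<partial>P n))) 0) \<and>
     Limsup at_top (\<lambda>T::real. limsup (\<lambda>n.
        ennreal (1 / real n) *
          (\<Sum>i=1..n. \<integral>\<^sup>+\<omega>. ennreal ((X n i \<omega>)\<^sup>2) * indicator {\<omega>. \<bar>X n i \<omega>\<bar> \<ge> T} \<omega> \<partial>P n))) = 0"


subsection \<open>Distances to the normal experiment, and regret\<close>

definition V_dist ::
    "(nat \<Rightarrow> nat \<Rightarrow> real measure) \<Rightarrow> real measure \<Rightarrow> (nat \<Rightarrow> nat \<Rightarrow> real) \<Rightarrow> nat \<Rightarrow> ennreal" where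
  "V_dist \<mu> p \<sigma> n =
     ennreal (1 / real n) * (\<Sum>i=1..n. wasserstein 1 (\<mu> n i) (mixture_measure p (\<sigma> n i)))"

definition is_cond_law ::
    "'a measure \<Rightarrow> ('a \<Rightarrow> real) \<Rightarrow> ('a \<Rightarrow> real) \<Rightarrow> (real \<Rightarrow> real measure) \<Rightarrow> bool" where
  "is_cond_law P Y \<theta> K \<longleftrightarrow>
     K \<in> borel \<rightarrow>\<^sub>M prob_algebra borel \<and>
     (\<forall>A\<in>sets borel. \<forall>B\<in>sets borel.
        emeasure P {\<omega> \<in> space P. \<theta> \<omega> \<in> A \<and> Y \<omega> \<in> B} =
        (\<integral>\<^sup>+t. emeasure (K t) B * indicator A t \<partial>distr P borel \<theta>))"

text \<open>\<open>K n i\<close> stands for the regular conditional law of \<open>X\<^sub>i\<close> given \<open>\<theta>\<^sub>i\<close>.\<close>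

definition W_dist ::
    "(nat \<Rightarrow> nat \<Rightarrow> real \<Rightarrow> real measure) \<Rightarrow> real measure \<Rightarrow> (nat \<Rightarrow> nat \<Rightarrow> real) \<Rightarrow> nat \<Rightarrow> ennreal" where
  "W_dist K p \<sigma> n =
     ennreal_root 2 (ennreal (1 / real n) *
       (\<Sum>i=1..n. \<integral>\<^sup>+t. (wasserstein 2 (K n i t) (normal_measure t (\<sigma> n i)))\<^sup>2 \<partial>p))"

definition regret ::
    "(nat \<Rightarrow> 'a measure) \<Rightarrow> (nat \<Rightarrow> nat \<Rightarrow> 'a \<Rightarrow> real) \<Rightarrow> (nat \<Rightarrow> nat \<Rightarrow> 'a \<Rightarrow> real) \<Rightarrow>
     (nat \<Rightarrow> nat \<Rightarrow> 'a \<Rightarrow> real) \<Rightarrow> real measure \<Rightarrow> (nat \<Rightarrow> nat \<Rightarrow> real) \<Rightarrow> nat \<Rightarrow> real" where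
  "regret P \<theta> \<theta>hat Z p \<sigma> n =
     sqrt (1 / real n * (\<Sum>i=1..n. \<integral>\<omega>. \<bar>\<theta> n i \<omega> - \<theta>hat n i \<omega>\<bar>\<^sup>2 \<partial>P n)) -
     sqrt (1 / real n *
       (\<Sum>i=1..n. \<integral>\<omega>. \<bar>\<theta> n i \<omega> - posterior_mean p (\<sigma> n i) (Z n i \<omega>)\<bar>\<^sup>2 \<partial>P n))"

end

theory Submission
  imports Defs
begin

text \<open>
  This is Wald's consistency argument for nonparametric maximum likelihood, carried out for
  triangular arrays of data that are neither independent nor exactly Gaussian mixtures.

  Let \<open>f\<^sub>p\<close> denote the Gaussian mixture with mixing measure \<open>p\<close>. By \<open>ln r \<le> 2 (sqrt r - 1)\<close>, the mean of
  \<open>ln f\<^sub>p\<close> under \<open>f\<^sub>q\<close> falls short of its maximum, attained at \<open>p = q\<close>, by at least twice the squared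
  Hellinger distance (\<open>hellinger_le_log_likelihood\<close>). An approximate maximizer of the empirical
  log-likelihood is therefore Hellinger close to the truth as soon as the empirical log-likelihood
  is close to its Gaussian mean uniformly over all mixing measures on \<open>[-M, M]\<close>
  (\<open>uniform_law_of_large_numbers\<close>).

  Uniformity comes from a finite net (\<open>log_mixture_net\<close>): the atoms of the mixing measure are moved to a
  grid and their weights are rounded up to positive multiples of \<open>1 / N\<close>. The logarithms of the
  finitely many resulting mixtures have bounded second derivatives, so approximate independence
  applies to each of them; the error of the net is uniformly small on \<open>[-T, T]\<close> and quadratic
  outside, where second moments are uniformly integrable. Expectations under the true laws are
  exchanged for Gaussian ones through the Wasserstein-1 distance, after truncation at \<open>T\<close>
  (\<open>quadratic_growth_wasserstein\<close>). Replacing the estimated scales by the true ones costs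
  \<open>O((1 + x\<^sup>2) \<bar>\<Delta>\<sigma>\<bar>)\<close> at an observation \<open>x\<close>, and truncation makes the average of this small too.

  Hellinger closeness of the mixtures implies closeness of their characteristic functions. Gaussian
  smoothing multiplies characteristic functions by a factor that is locally bounded away from zero,
  so Levy's continuity theorem gives weak convergence of the mixing measures, and with it locally
  uniform convergence of the posterior means (\<open>hellinger_determines_posterior_mean\<close>).

  For the regret, the plug-in denoiser is first compared with the posterior mean under the true
  prior at the same data point. What remains is the risk of a fixed Lipschitz function of \<open>X\<^sub>i\<close>
  against the risk of the same function of \<open>Z\<^sub>i\<close>. Both are integrals over \<open>\<theta>\<^sub>i\<close> of a mean under a
  conditional law, and the Wasserstein-2 distance of these laws bounds the difference
  (\<open>bayes_risk_diff\<close>).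
\<close>

section \<open>Gaussian kernels, mixtures and posterior means\<close>

locale gaussian_location_model =
  fixes M c C :: real
  assumes M_pos: "0 < M" and c_pos: "0 < c" and c_le_C: "c \<le> C"
begin

abbreviation priors :: "real measure set" where
  "priors \<equiv> prob_measures_on {-M..M}"

abbreviation \<phi> :: "real \<Rightarrow> real \<Rightarrow> real" where
  "\<phi> \<equiv> normal_density 0"

lemma priorD:
  assumes "p \<in> priors"
  shows "prob_space p" "sets p = sets borel" "space p = UNIV" "AE t in p. \<bar>t\<bar> \<le> M"
proof -
  from assms show 1: "prob_space p" and 2: "sets p = sets borel"
    by (auto simp: prob_measures_on_def)
  from 2 show "space p = UNIV" by (metis sets_eq_imp_space_eq space_borel)
  interpret prob_space p by fact
  have "emeasure p {-M..M} = 1" using assms by (auto simp: prob_measures_on_def)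
  then have "prob {-M..M} = 1" by (simp add: measure_def)
  then have "AE t in p. t \<in> {-M..M}" by (simp add: prob_eq_1 2)
  then show "AE t in p. \<bar>t\<bar> \<le> M" by eventually_elim (auto simp: abs_le_iff)
qed

lemma prior_real_distribution: "p \<in> priors \<Longrightarrow> real_distribution p"
  using priorD[of p] by (auto simp: real_distribution_def real_distribution_axioms_def)

lemma prior_integrable:
  fixes g :: "real \<Rightarrow> real"
  assumes p: "p \<in> priors" and [measurable]: "g \<in> borel_measurable borel"
    and "\<And>t. \<bar>t\<bar> \<le> M \<Longrightarrow> \<bar>g t\<bar> \<le> B"
  shows "integrable p g"
proof -
  interpret prob_space p using priorD(1)[OF p] .
  have [measurable_cong]: "sets p = sets borel" using priorD(2)[OF p] .
  show ?thesis
    by (rule integrable_const_bound[of _ B]) (use priorD(4)[OF p] assms(3) in auto)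
qed

lemma ln_kernel:
  "s > 0 \<Longrightarrow> ln (\<phi> s y) = - ln s - ln (sqrt (2 * pi)) - y\<^sup>2 / (2 * s\<^sup>2)"
  by (simp add: normal_density_def ln_mult ln_div real_sqrt_mult power2_eq_square)

lemma kernel_pos: "s > 0 \<Longrightarrow> \<phi> s y > 0"
  by (rule normal_density_pos)

text \<open>Comparisons of kernels by a factor \<open>exp B\<close> that does not depend on the location integrate against
  any prior. This is how all continuity estimates for mixtures below are obtained, with constants
  that are uniform over priors.\<close>

lemma kernel_le_exp:
  assumes "s > 0" "s' > 0" "ln (\<phi> s y) - ln (\<phi> s' y') \<le> B"
  shows "\<phi> s y \<le> exp B * \<phi> s' y'"
proof -
  have "\<phi> s y = exp (ln (\<phi> s y))"
    using kernel_pos[OF assms(1)] by simp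
  also have "\<dots> \<le> exp (B + ln (\<phi> s' y'))" using assms(3) by simp
  also have "\<dots> = exp B * \<phi> s' y'"
    using kernel_pos[OF assms(2)] by (simp add: exp_add)
  finally show ?thesis .
qed

lemma scale_sq_mono: "c \<le> s \<Longrightarrow> c\<^sup>2 \<le> s\<^sup>2"
  using c_pos by (intro power_mono) auto

lemma div_scale_sq_le:
  assumes "c \<le> s" "0 \<le> a" "a \<le> b" shows "a / (2 * s\<^sup>2) \<le> b / (2 * c\<^sup>2)"
  using assms scale_sq_mono[of s] c_pos by (intro frac_le) auto

lemma kernel_shift_location:
  assumes s: "c \<le> s" and t: "\<bar>t\<bar> \<le> M" "\<bar>t'\<bar> \<le> M"
  shows "\<phi> s (x - t)
    \<le> exp (\<bar>t - t'\<bar> * (\<bar>x\<bar> + M) / c\<^sup>2) * \<phi> s (x - t')"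
proof (rule kernel_le_exp)
  show "s > 0" "s > 0" using s c_pos by auto
  have "ln (\<phi> s (x - t)) - ln (\<phi> s (x - t'))
     = ((x - t')\<^sup>2 - (x - t)\<^sup>2) / (2 * s\<^sup>2)" using \<open>s > 0\<close> by (simp add: ln_kernel diff_divide_distrib)
  also have "(x - t')\<^sup>2 - (x - t)\<^sup>2 = (t - t') * (2 * x - t - t')"
    by (simp add: power2_eq_square algebra_simps)
  also have "\<dots> / (2 * s\<^sup>2) \<le> \<bar>(t - t') * (2 * x - t - t')\<bar> / (2 * s\<^sup>2)"
    using \<open>s > 0\<close> by (intro divide_right_mono) auto
  also have "\<dots> \<le> (\<bar>t - t'\<bar> * (2 * (\<bar>x\<bar> + M))) / (2 * c\<^sup>2)"
    using s t by (intro div_scale_sq_le) (auto simp: abs_mult intro!: mult_left_mono)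
  also have "\<dots> = \<bar>t - t'\<bar> * (\<bar>x\<bar> + M) / c\<^sup>2" using c_pos by (simp add: field_simps)
  finally show "ln (\<phi> s (x - t)) - ln (\<phi> s (x - t')) \<le> \<bar>t - t'\<bar> * (\<bar>x\<bar> + M) / c\<^sup>2" .
qed

lemma kernel_shift_argument:
  assumes s: "c \<le> s" and t: "\<bar>t\<bar> \<le> M"
  shows "\<phi> s (x - t)
    \<le> exp (\<bar>x - y\<bar> * (\<bar>x\<bar> + \<bar>y\<bar> + 2 * M) / (2 * c\<^sup>2)) * \<phi> s (y - t)"
proof (rule kernel_le_exp)
  show "s > 0" "s > 0" using s c_pos by auto
  have "ln (\<phi> s (x - t)) - ln (\<phi> s (y - t))
     = ((y - t)\<^sup>2 - (x - t)\<^sup>2) / (2 * s\<^sup>2)" using \<open>s > 0\<close> by (simp add: ln_kernel diff_divide_distrib)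
  also have "(y - t)\<^sup>2 - (x - t)\<^sup>2 = (y - x) * (x + y - 2 * t)"
    by (simp add: power2_eq_square algebra_simps)
  also have "\<dots> / (2 * s\<^sup>2) \<le> \<bar>(y - x) * (x + y - 2 * t)\<bar> / (2 * s\<^sup>2)"
    using \<open>s > 0\<close> by (intro divide_right_mono) auto
  also have "\<dots> \<le> (\<bar>x - y\<bar> * (\<bar>x\<bar> + \<bar>y\<bar> + 2 * M)) / (2 * c\<^sup>2)"
    using s t by (intro div_scale_sq_le) (auto simp: abs_mult abs_minus_commute intro!: mult_mono)
  finally show "ln (\<phi> s (x - t)) - ln (\<phi> s (y - t))
    \<le> \<bar>x - y\<bar> * (\<bar>x\<bar> + \<bar>y\<bar> + 2 * M) / (2 * c\<^sup>2)" .
qed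

text \<open>A Lipschitz constant of the log-kernel in the scale, relative to \<open>1 + x\<^sup>2\<close> and
  uniform over the locations in \<open>[-M, M]\<close>.\<close>

definition scale_const :: real where
  "scale_const = 1 / c + 2 * (1 + M\<^sup>2) / c ^ 3"

lemma scale_const_pos: "scale_const > 0"
  using c_pos by (auto simp: scale_const_def intro!: add_pos_nonneg)

lemma kernel_shift_scale:
  assumes s: "c \<le> s" "c \<le> s'" and t: "\<bar>t\<bar> \<le> M"
  shows "\<phi> s (x - t)
    \<le> exp (scale_const * (1 + x\<^sup>2) * \<bar>s - s'\<bar>) * \<phi> s' (x - t)"
proof (rule kernel_le_exp)
  show pos: "s > 0" "s' > 0" using s c_pos by auto
  have 1: "ln s' - ln s \<le> \<bar>s - s'\<bar> / c"
  proof -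
    have "ln s' - ln s \<le> (s' - s) / s"
      using ln_le_minus_one[of "s'/s"] pos by (simp add: ln_div diff_divide_distrib)
    also have "\<dots> \<le> \<bar>s - s'\<bar> / c" using pos s c_pos by (intro frac_le) auto
    finally show ?thesis .
  qed
  have 2: "(x - t)\<^sup>2 \<le> 2 * (1 + M\<^sup>2) * (1 + x\<^sup>2)"
  proof -
    have "(x - t)\<^sup>2 \<le> 2 * x\<^sup>2 + 2 * t\<^sup>2" using sum_squares_ge_zero[of "x + t" 0]
      by (simp add: power2_eq_square algebra_simps)
    moreover have "t\<^sup>2 \<le> M\<^sup>2" using t power_mono[of "\<bar>t\<bar>" M 2] by simp
    moreover have "2 * (1 + M\<^sup>2) * (1 + x\<^sup>2) = 2 + 2 * M\<^sup>2 + 2 * x\<^sup>2 + 2 * (M\<^sup>2 * x\<^sup>2)"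
      by (simp add: algebra_simps)
    moreover have "0 \<le> M\<^sup>2 * x\<^sup>2" by (intro mult_nonneg_nonneg) auto
    ultimately show ?thesis by linarith
  qed
  have 3: "1 / s'\<^sup>2 - 1 / s\<^sup>2 \<le> 2 * \<bar>s - s'\<bar> / c ^ 3"
  proof -
    have "1 / s'\<^sup>2 - 1 / s\<^sup>2 = (s - s') * (1 / (s * s'\<^sup>2) + 1 / (s\<^sup>2 * s'))"
      using pos by (simp add: field_simps power2_eq_square)
    also have "\<dots> \<le> \<bar>s - s'\<bar> * (1 / c ^ 3 + 1 / c ^ 3)"
    proof (rule mult_mono)
      have "c ^ 3 \<le> s * s'\<^sup>2"
        using mult_mono[OF s(1) scale_sq_mono[OF s(2)]] c_pos pos by (simp add: power3_eq_cube power2_eq_square)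
      moreover have "c ^ 3 \<le> s\<^sup>2 * s'"
        using mult_mono[OF scale_sq_mono[OF s(1)] s(2)] c_pos pos by (simp add: power3_eq_cube power2_eq_square)
      ultimately show "1 / (s * s'\<^sup>2) + 1 / (s\<^sup>2 * s') \<le> 1 / c ^ 3 + 1 / c ^ 3"
        using c_pos by (intro add_mono frac_le) auto
    qed (use pos in auto)
    also have "\<dots> = 2 * \<bar>s - s'\<bar> / c ^ 3" by (simp add: field_simps)
    finally show ?thesis .
  qed
  have "ln (\<phi> s (x - t)) - ln (\<phi> s' (x - t))
     = ln s' - ln s + (x - t)\<^sup>2 / 2 * (1 / s'\<^sup>2 - 1 / s\<^sup>2)" using pos by (simp add: ln_kernel field_simps)
  also have "\<dots> \<le> \<bar>s - s'\<bar> / c + (x - t)\<^sup>2 / 2 * (2 * \<bar>s - s'\<bar> / c ^ 3)"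
    by (intro add_mono 1 mult_left_mono 3) auto
  also have "\<dots> \<le> \<bar>s - s'\<bar> / c * (1 + x\<^sup>2) + (2 * (1 + M\<^sup>2) * (1 + x\<^sup>2)) / 2 * (2 * \<bar>s - s'\<bar> / c ^ 3)"
    using c_pos 2 by (intro add_mono mult_right_mono divide_right_mono) (auto simp: algebra_simps)
  also have "\<dots> = scale_const * (1 + x\<^sup>2) * \<bar>s - s'\<bar>"
    using c_pos by (simp add: scale_const_def field_simps)
  finally show "ln (\<phi> s (x - t)) - ln (\<phi> s' (x - t))
    \<le> scale_const * (1 + x\<^sup>2) * \<bar>s - s'\<bar>" .
qed

lemma kernel_le: assumes "c \<le> s" shows "\<phi> s y \<le> 1 / c"
proof -
  have s: "s > 0" using assms c_pos by simp
  have "\<phi> s y \<le> 1 / sqrt (2 * pi * s\<^sup>2) * 1"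
    unfolding normal_density_def by (intro mult_left_mono) auto
  also have "\<dots> \<le> 1 / s"
  proof -
    have "s = sqrt (1 * s\<^sup>2)" using s by simp
    also have "\<dots> \<le> sqrt (2 * pi * s\<^sup>2)" using pi_gt3 by (intro real_sqrt_le_mono mult_right_mono) auto
    finally show ?thesis using s by (simp add: frac_le)
  qed
  also have "\<dots> \<le> 1 / c" using assms c_pos by (simp add: frac_le)
  finally show ?thesis .
qed

lemma kernel_integrable:
  assumes "p \<in> priors" "c \<le> s"
  shows "integrable p (\<lambda>t. \<phi> s (x - t))"
  using assms kernel_le[OF assms(2)] by (intro prior_integrable[of _ _ "1 / c"]) auto

lemma mean_kernel_integrable:
  assumes "p \<in> priors" "c \<le> s"
  shows "integrable p (\<lambda>t. t * \<phi> s (x - t))"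
  using assms kernel_le[OF assms(2)] M_pos c_pos
  by (intro prior_integrable[of _ _ "M * (1 / c)"]) (auto simp: abs_mult intro!: mult_mono simp del: times_divide_eq_right)

lemma mixture_density_pos:
  assumes p: "p \<in> priors" and s: "c \<le> s"
  shows "mixture_density p s x > 0"
proof -
  interpret prob_space p using priorD(1)[OF p] .
  have pos: "\<phi> s y > 0" for y using s c_pos by (intro kernel_pos) auto
  have "mixture_density p s x \<noteq> 0"
  proof
    assume "mixture_density p s x = 0"
    then have "AE t in p. \<phi> s (x - t) = 0"
      unfolding mixture_density_def
      using integral_nonneg_eq_0_iff_AE[OF kernel_integrable[OF p s]] by simp
    then have "AE t in p. False" by eventually_elim (use pos in \<open>metis less_irrefl\<close>)
    then show False by simp
  qed
  moreover have "mixture_density p s x \<ge> 0"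
    unfolding mixture_density_def by (intro integral_nonneg_AE) auto
  ultimately show ?thesis by simp
qed

lemma mixture_density_nonneg: "mixture_density p s x \<ge> 0"
  unfolding mixture_density_def by (intro integral_nonneg_AE) auto

lemma mixture_le_exp:
  assumes p: "p \<in> priors" and s: "c \<le> s" "c \<le> s'"
    and le: "\<And>t. \<bar>t\<bar> \<le> M \<Longrightarrow> \<phi> s (x - t) \<le> exp B * \<phi> s' (y - t)"
  shows "mixture_density p s x \<le> exp B * mixture_density p s' y"
proof -
  have "mixture_density p s x \<le> (\<integral>t. exp B * \<phi> s' (y - t) \<partial>p)"
    unfolding mixture_density_def
    using priorD(4)[OF p] le
    by (intro integral_mono_AE kernel_integrable p s integrable_mult_right) auto
  then show ?thesis by (simp add: mixture_density_def)
qed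

lemma ln_mixture_diff_le:
  assumes p: "p \<in> priors" and s: "c \<le> s" "c \<le> s'"
    and "\<And>t. \<bar>t\<bar> \<le> M \<Longrightarrow> \<phi> s (x - t) \<le> exp B * \<phi> s' (y - t)"
  shows "ln (mixture_density p s x) - ln (mixture_density p s' y) \<le> B"
proof -
  have "ln (mixture_density p s x) \<le> ln (exp B * mixture_density p s' y)"
    using mixture_density_pos[OF p] s mixture_le_exp[OF assms] by (intro ln_mono) auto
  also have "\<dots> = B + ln (mixture_density p s' y)"
    using mixture_density_pos[OF p s(2), of y] by (simp add: ln_mult)
  finally show ?thesis by simp
qed

lemma ln_mixture_argument:
  assumes p: "p \<in> priors" and s: "c \<le> s"
  shows "\<bar>ln (mixture_density p s x) - ln (mixture_density p s y)\<bar>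
    \<le> \<bar>x - y\<bar> * (\<bar>x\<bar> + \<bar>y\<bar> + 2 * M) / (2 * c\<^sup>2)"
  using ln_mixture_diff_le[OF p s s kernel_shift_argument[OF s], of x y]
        ln_mixture_diff_le[OF p s s kernel_shift_argument[OF s], of y x]
  by (simp add: abs_le_iff abs_minus_commute add.commute)

lemma ln_mixture_scale:
  assumes p: "p \<in> priors" and s: "c \<le> s" "c \<le> s'"
  shows "\<bar>ln (mixture_density p s x) - ln (mixture_density p s' x)\<bar>
    \<le> scale_const * (1 + x\<^sup>2) * \<bar>s - s'\<bar>"
  using ln_mixture_diff_le[OF p s kernel_shift_scale[OF s], of x]
        ln_mixture_diff_le[OF p s(2,1) kernel_shift_scale[OF s(2,1)], of x]
  by (simp add: abs_le_iff abs_minus_commute add.commute)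

lemma posterior_mean_bounded:
  assumes p: "p \<in> priors" and s: "c \<le> s"
  shows "\<bar>posterior_mean p s x\<bar> \<le> M"
proof -
  let ?f = "mixture_density p s x"
  have "\<bar>\<integral>t. t * \<phi> s (x - t) \<partial>p\<bar> \<le> (\<integral>t. \<bar>t * \<phi> s (x - t)\<bar> \<partial>p)"
    by (rule integral_abs_bound)
  also have "\<dots> \<le> (\<integral>t. M * \<phi> s (x - t) \<partial>p)"
    using priorD(4)[OF p]
    by (intro integral_mono_AE integrable_abs mean_kernel_integrable kernel_integrable p s integrable_mult_right)
       (auto simp: abs_mult intro!: mult_right_mono)
  also have "\<dots> = M * ?f" by (simp add: mixture_density_def)
  finally show ?thesis
    using mixture_density_pos[OF p s, of x] by (simp add: posterior_mean_def field_simps)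
qed

text \<open>A factor between \<open>exp (- B)\<close> and \<open>exp B\<close> on the weights moves a weighted mean by \<open>O(B)\<close>, because
  the values being averaged are bounded. A further factor \<open>k\<close> common to all locations cancels in the
  quotient; it absorbs the part of the kernel that is unbounded in the argument, which makes the
  posterior mean globally Lipschitz.\<close>

lemma posterior_mean_diff_le:
  assumes p: "p \<in> priors" and s: "c \<le> s" "c \<le> s'" and k: "k > 0"
    and le: "\<And>t. \<bar>t\<bar> \<le> M \<Longrightarrow> \<phi> s (x - t) \<le> exp B * (k * \<phi> s' (y - t))"
    and ge: "\<And>t. \<bar>t\<bar> \<le> M \<Longrightarrow> k * \<phi> s' (y - t) \<le> exp B * \<phi> s (x - t)"
  shows "\<bar>posterior_mean p s x - posterior_mean p s' y\<bar> \<le> 4 * M * B"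
proof -
  let ?a = "\<lambda>t. \<phi> s (x - t)" and ?b = "\<lambda>t. \<phi> s' (y - t)"
  let ?m = "posterior_mean p s' y"
  have B: "B \<ge> 0"
  proof -
    have pos: "?a 0 > 0" using s c_pos by (intro kernel_pos) auto
    have "?a 0 \<le> exp B * (k * ?b 0)" using le[of 0] M_pos by simp
    also have "\<dots> \<le> exp B * (exp B * ?a 0)" using ge[of 0] M_pos by simp
    finally have "?a 0 * 1 \<le> ?a 0 * exp (B + B)" by (simp only: exp_add mult_ac mult_1_right)
    then have "exp 0 \<le> exp (B + B)" by (simp only: mult_le_cancel_left_pos[OF pos] exp_zero)
    then have "0 \<le> B + B" by (simp only: exp_le_cancel_iff)
    then show ?thesis by simp
  qed
  have fa: "mixture_density p s x > 0" and fb: "mixture_density p s' y > 0"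
    using mixture_density_pos p s by auto
  have mb: "\<bar>?m\<bar> \<le> M" "\<bar>posterior_mean p s x\<bar> \<le> M"
    using posterior_mean_bounded[OF p] s by auto
  have ia: "integrable p ?a" "integrable p (\<lambda>t. t * ?a t)"
   and ib: "integrable p ?b" "integrable p (\<lambda>t. t * ?b t)"
    using kernel_integrable[OF p] mean_kernel_integrable[OF p] s by auto
  \<comment> \<open>the mean of \<open>t - m\<close> under the second weights vanishes, so they may be subtracted\<close>
  have "(\<integral>t. t * ?b t - ?m * ?b t \<partial>p) = 0"
    using fb ib by (simp add: posterior_mean_def mixture_density_def)
  then have "(\<integral>t. k * (t * ?b t - ?m * ?b t) \<partial>p) = 0" by simp
  moreover have "(\<integral>t. t * ?a t - ?m * ?a t \<partial>p) = (posterior_mean p s x - ?m) * mixture_density p s x"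
    using fa ia by (simp add: posterior_mean_def mixture_density_def field_simps)
  ultimately have "(posterior_mean p s x - ?m) * mixture_density p s x
     = (\<integral>t. (t * ?a t - ?m * ?a t) - k * (t * ?b t - ?m * ?b t) \<partial>p)"
    using ia ib by (subst Bochner_Integration.integral_diff) auto
  also have "\<dots> = (\<integral>t. (t - ?m) * (?a t - k * ?b t) \<partial>p)"
    by (rule Bochner_Integration.integral_cong) (auto simp: algebra_simps)
  finally have eq: "(posterior_mean p s x - ?m) * mixture_density p s x = (\<integral>t. (t - ?m) * (?a t - k * ?b t) \<partial>p)" .
  have pt: "\<bar>(t - ?m) * (?a t - k * ?b t)\<bar> \<le> 2 * M * ((exp B - 1) * ?a t)" if t: "\<bar>t\<bar> \<le> M" for t
  proof -
    have "?a t - k * ?b t \<le> (exp B - 1) * ?a t"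
    proof -
      have "(1 - exp (- B)) * ?a t \<le> (exp B - 1) * ?a t"
      proof (rule mult_right_mono)
        have "2 \<le> exp B + exp (- B)"
          using exp_ge_add_one_self[of B] exp_ge_add_one_self[of "-B"] by linarith
        then show "1 - exp (- B) \<le> exp B - 1" by simp
      qed simp
      moreover have "exp (- B) * ?a t \<le> k * ?b t"
        using le[OF t] by (simp add: exp_minus field_simps)
      ultimately show ?thesis by (simp add: algebra_simps)
    qed
    moreover have "k * ?b t - ?a t \<le> (exp B - 1) * ?a t" using ge[OF t] by (simp add: algebra_simps)
    ultimately have "\<bar>?a t - k * ?b t\<bar> \<le> (exp B - 1) * ?a t" by linarith
    moreover have "\<bar>t - ?m\<bar> \<le> 2 * M" using t mb by linarith
    ultimately show ?thesis unfolding abs_mult by (intro mult_mono) (use M_pos in auto)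
  qed
  have "\<bar>posterior_mean p s x - ?m\<bar> * mixture_density p s x
    = \<bar>(posterior_mean p s x - ?m) * mixture_density p s x\<bar>" using fa by (simp add: abs_mult)
  also have "\<dots> \<le> (\<integral>t. \<bar>(t - ?m) * (?a t - k * ?b t)\<bar> \<partial>p)" unfolding eq by (rule integral_abs_bound)
  also have "\<dots> \<le> (\<integral>t. 2 * M * ((exp B - 1) * ?a t) \<partial>p)"
  proof (rule integral_mono_AE)
    have "integrable p (\<lambda>t. (t * ?a t - ?m * ?a t) - k * (t * ?b t - ?m * ?b t))"
      using ia ib by auto
    then show "integrable p (\<lambda>t. \<bar>(t - ?m) * (?a t - k * ?b t)\<bar>)"
      by (intro integrable_abs) (simp add: algebra_simps)
  qed (use priorD(4)[OF p] ia pt in auto)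
  also have "\<dots> = 2 * M * (exp B - 1) * mixture_density p s x"
    by (simp add: mixture_density_def)
  finally have main: "\<bar>posterior_mean p s x - ?m\<bar> \<le> 2 * M * (exp B - 1)" using fa by simp
  show ?thesis
  proof (cases "B \<le> 1")
    case True
    have "exp B \<le> 1 + B + B\<^sup>2" using exp_bound[OF B True] .
    also have "B\<^sup>2 \<le> B" using B True by (simp add: power2_eq_square mult_left_le)
    finally have "exp B - 1 \<le> 2 * B" by simp
    then have "2 * M * (exp B - 1) \<le> 2 * M * (2 * B)" using M_pos by (intro mult_left_mono) auto
    with main show ?thesis by (simp add: algebra_simps)
  next
    case False
    have "\<bar>posterior_mean p s x - ?m\<bar> \<le> 2 * M" using mb by linarith
    also have "\<dots> \<le> 4 * M * B" using False M_pos by simp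
    finally show ?thesis .
  qed
qed

lemma posterior_mean_scale:
  assumes p: "p \<in> priors" and s: "c \<le> s" "c \<le> s'"
  shows "\<bar>posterior_mean p s x - posterior_mean p s' x\<bar>
    \<le> 4 * M * (scale_const * (1 + x\<^sup>2) * \<bar>s - s'\<bar>)"
  using kernel_shift_scale[OF s] kernel_shift_scale[OF s(2,1)]
  by (intro posterior_mean_diff_le[where k=1] p s) (auto simp: abs_minus_commute)

lemma posterior_mean_lipschitz:
  assumes p: "p \<in> priors" and s: "c \<le> s"
  shows "\<bar>posterior_mean p s x - posterior_mean p s y\<bar> \<le> 4 * M * (M / c\<^sup>2 * \<bar>x - y\<bar>)"
proof -
  define k where "k = exp ((y\<^sup>2 - x\<^sup>2) / (2 * s\<^sup>2))"
  have s0: "s > 0" using s c_pos by simp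
  \<comment> \<open>the part of the exponent that does not involve \<open>t\<close> goes into the common factor\<close>
  have eq: "\<phi> s (x - t) = exp ((x - y) * t / s\<^sup>2) * (k * \<phi> s (y - t))" for t
  proof -
    have "-(x - t)\<^sup>2 / (2 * s\<^sup>2) = (x - y) * t / s\<^sup>2 + ((y\<^sup>2 - x\<^sup>2) / (2 * s\<^sup>2) + -(y - t)\<^sup>2 / (2 * s\<^sup>2))"
      using s0 by (simp add: field_simps power2_eq_square)
    then show ?thesis by (simp add: normal_density_def k_def exp_add[symmetric] mult_ac)
  qed
  have bd: "\<bar>(x - y) * t / s\<^sup>2\<bar> \<le> M / c\<^sup>2 * \<bar>x - y\<bar>" if "\<bar>t\<bar> \<le> M" for t
  proof -
    have "\<bar>(x - y) * t / s\<^sup>2\<bar> = (\<bar>x - y\<bar> * \<bar>t\<bar>) / s\<^sup>2" by (simp add: abs_mult)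
    also have "\<dots> \<le> (\<bar>x - y\<bar> * M) / c\<^sup>2"
      using that scale_sq_mono[OF s] c_pos M_pos by (intro frac_le mult_left_mono) auto
    finally show ?thesis by (simp add: mult_ac)
  qed
  have k0: "k > 0" by (simp add: k_def)
  have nn: "0 \<le> k * \<phi> s (y - t)" for t using k0 by simp
  show ?thesis
  proof (rule posterior_mean_diff_le[OF p s s k0])
    fix t :: real assume t: "\<bar>t\<bar> \<le> M"
    show "\<phi> s (x - t) \<le> exp (M / c\<^sup>2 * \<bar>x - y\<bar>) * (k * \<phi> s (y - t))"
      unfolding eq using abs_le_D1[OF bd[OF t]] nn[of t] by (intro mult_right_mono) simp_all
    have "k * \<phi> s (y - t) = exp (- ((x - y) * t / s\<^sup>2)) * \<phi> s (x - t)"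
      unfolding eq by (simp add: mult.assoc[symmetric] exp_add[symmetric])
    also have "\<dots> \<le> exp (M / c\<^sup>2 * \<bar>x - y\<bar>) * \<phi> s (x - t)"
      using abs_le_D2[OF bd[OF t]] by (intro mult_right_mono) simp_all
    finally show "k * \<phi> s (y - t) \<le> exp (M / c\<^sup>2 * \<bar>x - y\<bar>) * \<phi> s (x - t)" .
  qed
qed

end

section \<open>Gaussian mixtures as probability measures\<close>

lemma normal_density_shift: "normal_density 0 s (x - t) = normal_density t s x"
  by (simp add: normal_density_def)

lemma prob_space_normal_measure: "s > 0 \<Longrightarrow> prob_space (normal_measure t s)"
  unfolding normal_measure_def by (rule prob_space_normal_density)

lemma sets_normal_measure [simp, measurable_cong]: "sets (normal_measure t s) = sets borel"
  by (simp add: normal_measure_def)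

lemma space_normal_measure [simp]: "space (normal_measure t s) = UNIV"
  by (simp add: normal_measure_def)

lemma sets_mixture_measure [simp, measurable_cong]: "sets (mixture_measure p s) = sets borel"
  by (simp add: mixture_measure_def)

lemma space_mixture_measure [simp]: "space (mixture_measure p s) = UNIV"
  by (simp add: mixture_measure_def)

lemma char_normal_measure:
  assumes s: "s > 0"
  shows "char (normal_measure t s) u = iexp (u * t) * exp (- (s * u)\<^sup>2 / 2)"
proof -
  have "char (normal_measure t s) u = (CLINT x|lborel. normal_density t s x *\<^sub>R iexp (u * x))"
    unfolding char_def normal_measure_def by (subst integral_density) auto
  also have "\<dots> = \<bar>s\<bar> *\<^sub>R (CLINT x|lborel. normal_density t s (t + s * x) *\<^sub>R iexp (u * (t + s * x)))"
    by (rule lborel_integral_real_affine) (use s in auto)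
  also have "\<dots> = (CLINT x|lborel. iexp (u * t) * (std_normal_density x *\<^sub>R iexp ((s * u) * x)))"
  proof -
    have "normal_density t s (t + s * x) = std_normal_density x / s" for x
      using s by (simp add: normal_density_def power_mult_distrib real_sqrt_mult)
    then show ?thesis using s
      by (subst integral_scaleR_right[symmetric])
         (auto intro!: Bochner_Integration.integral_cong simp: algebra_simps exp_add scaleR_conv_of_real)
  qed
  also have "\<dots> = iexp (u * t) * (CLINT x|lborel. std_normal_density x *\<^sub>R iexp ((s * u) * x))"
    by (rule integral_mult_right_zero)
  also have "(CLINT x|lborel. std_normal_density x *\<^sub>R iexp ((s * u) * x)) = char std_normal_distribution (s * u)"
    unfolding char_def by (subst integral_density) auto
  finally show ?thesis by (simp add: char_std_normal_distribution)
qed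

definition sq_tail :: "real \<Rightarrow> real \<Rightarrow> real" where
  "sq_tail T x = x\<^sup>2 * indicator {x. T \<le> \<bar>x\<bar>} x"

lemma sq_tail_nonneg: "0 \<le> sq_tail T x" and sq_tail_le: "sq_tail T x \<le> x\<^sup>2"
  by (auto simp: sq_tail_def indicator_def)

lemma sq_tail_measurable [measurable]: "sq_tail T \<in> borel_measurable borel"
  unfolding sq_tail_def by measurable

context gaussian_location_model
begin

lemma mixture_density_measurable [measurable]:
  assumes "p \<in> priors"
  shows "mixture_density p s \<in> borel_measurable borel"
proof -
  interpret p: prob_space p using priorD(1)[OF assms] .
  have [measurable_cong]: "sets p = sets borel" using priorD(2)[OF assms] .
  show ?thesis unfolding mixture_density_def by measurable
qed

lemma nn_integral_mixture:
  assumes p: "p \<in> priors" and s: "c \<le> s" and [measurable]: "h \<in> borel_measurable borel"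
  shows "(\<integral>\<^sup>+x. h x \<partial>mixture_measure p s) = (\<integral>\<^sup>+t. (\<integral>\<^sup>+x. h x \<partial>normal_measure t s) \<partial>p)"
proof -
  interpret p: prob_space p using priorD(1)[OF p] .
  interpret pair_sigma_finite lborel p ..
  have [measurable_cong]: "sets p = sets borel" using priorD(2)[OF p] .
  note mixture_density_measurable[OF p, measurable]
  have "(\<integral>\<^sup>+x. h x \<partial>mixture_measure p s) = (\<integral>\<^sup>+x. ennreal (mixture_density p s x) * h x \<partial>lborel)"
    unfolding mixture_measure_def by (subst nn_integral_density) auto
  also have "\<dots> = (\<integral>\<^sup>+x. (\<integral>\<^sup>+t. ennreal (\<phi> s (x - t)) * h x \<partial>p) \<partial>lborel)"
  proof (rule nn_integral_cong)
    fix x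
    have "ennreal (mixture_density p s x) = (\<integral>\<^sup>+t. ennreal (\<phi> s (x - t)) \<partial>p)"
      unfolding mixture_density_def
      by (rule nn_integral_eq_integral[symmetric]) (use kernel_integrable[OF p s] in auto)
    then show "ennreal (mixture_density p s x) * h x = (\<integral>\<^sup>+t. ennreal (\<phi> s (x - t)) * h x \<partial>p)"
      by (simp add: nn_integral_multc)
  qed
  also have "\<dots> = (\<integral>\<^sup>+t. (\<integral>\<^sup>+x. ennreal (\<phi> s (x - t)) * h x \<partial>lborel) \<partial>p)"
    by (rule Fubini'[symmetric]) measurable
  also have "\<dots> = (\<integral>\<^sup>+t. (\<integral>\<^sup>+x. h x \<partial>normal_measure t s) \<partial>p)"
    unfolding normal_measure_def
    by (intro nn_integral_cong, subst nn_integral_density) (auto simp: normal_density_shift)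
  finally show ?thesis .
qed

lemma prob_space_mixture_measure:
  assumes p: "p \<in> priors" and s: "c \<le> s"
  shows "prob_space (mixture_measure p s)"
proof
  interpret p: prob_space p using priorD(1)[OF p] .
  have "emeasure (mixture_measure p s) UNIV = (\<integral>\<^sup>+x. 1 \<partial>mixture_measure p s)"
    by simp
  also have "\<dots> = (\<integral>\<^sup>+t. (\<integral>\<^sup>+x. 1 \<partial>normal_measure t s) \<partial>p)"
    by (rule nn_integral_mixture[OF p s]) simp
  also have "\<dots> = (\<integral>\<^sup>+t. 1 \<partial>p)"
  proof (rule nn_integral_cong)
    fix t
    interpret prob_space "normal_measure t s" using s c_pos by (intro prob_space_normal_measure) auto
    show "(\<integral>\<^sup>+x. 1 \<partial>normal_measure t s) = 1" using emeasure_space_1 by simp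
  qed
  also have "\<dots> = 1" using p.emeasure_space_1 by simp
  finally show "emeasure (mixture_measure p s) (space (mixture_measure p s)) = 1" by simp
qed

lemma integral_mixture_measure:
  fixes h :: "real \<Rightarrow> real"
  assumes p: "p \<in> priors" and [measurable]: "h \<in> borel_measurable borel"
  shows "(\<integral>x. h x \<partial>mixture_measure p s) = (\<integral>x. mixture_density p s x * h x \<partial>lborel)"
  unfolding mixture_measure_def using mixture_density_measurable[OF p]
  by (subst integral_density) (auto simp: mixture_density_nonneg)

lemma integrable_mixture_measure:
  fixes h :: "real \<Rightarrow> real"
  assumes p: "p \<in> priors" and [measurable]: "h \<in> borel_measurable borel"
  shows "integrable (mixture_measure p s) h \<longleftrightarrow> integrable lborel (\<lambda>x. mixture_density p s x * h x)"
  unfolding mixture_measure_def using mixture_density_measurable[OF p]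
  by (subst integrable_density) (auto simp: mixture_density_nonneg)

lemma mixture_density_integrable:
  assumes p: "p \<in> priors" and s: "c \<le> s"
  shows "integrable lborel (mixture_density p s)" "(\<integral>x. mixture_density p s x \<partial>lborel) = 1"
proof -
  interpret prob_space "mixture_measure p s" using prob_space_mixture_measure[OF p s] .
  have "integrable (mixture_measure p s) (\<lambda>_. 1::real)" by simp
  then show "integrable lborel (mixture_density p s)" by (subst (asm) integrable_mixture_measure[OF p]) auto
  have "(\<integral>x. 1 \<partial>mixture_measure p s) = (1::real)" using prob_space by simp
  then show "(\<integral>x. mixture_density p s x \<partial>lborel) = 1"
    by (subst (asm) integral_mixture_measure[OF p]) auto
qed

definition fourth_moment_bound :: real where
  "fourth_moment_bound = 8 * (M ^ 4 + 3 * C ^ 4)"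

lemma fourth_moment_normal:
  assumes t: "\<bar>t\<bar> \<le> M" and s: "0 < s" "s \<le> C"
  shows "(\<integral>\<^sup>+x. ennreal (x ^ 4) \<partial>normal_measure t s) \<le> ennreal fourth_moment_bound"
proof -
  interpret prob_space "normal_measure t s" using s by (intro prob_space_normal_measure) auto
  have m: "has_bochner_integral lborel (\<lambda>x. normal_density t s x * (x - t) ^ 4) (3 * s ^ 4)"
    using normal_moment_even[of s t 2] s by (simp add: fact_numeral field_simps power_mult_distrib)
  then have I: "integrable (normal_measure t s) (\<lambda>x. (x - t) ^ 4)"
    and E: "(\<integral>x. (x - t) ^ 4 \<partial>normal_measure t s) = 3 * s ^ 4"
    unfolding normal_measure_def
    by (auto simp: integrable_density integral_density has_bochner_integral_iff)
  have pt: "x ^ 4 \<le> 8 * (M ^ 4 + (x - t) ^ 4)" for x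
  proof -
    have sq: "(a + b)\<^sup>2 \<le> 2 * (a\<^sup>2 + b\<^sup>2)" for a b :: real
      using sum_squares_ge_zero[of "a - b" 0] by (simp add: power2_eq_square algebra_simps)
    have "x\<^sup>2 \<le> 2 * (t\<^sup>2 + (x - t)\<^sup>2)" using sq[of t "x - t"] by simp
    then have "(x\<^sup>2)\<^sup>2 \<le> (2 * (t\<^sup>2 + (x - t)\<^sup>2))\<^sup>2" by (intro power_mono) auto
    also have "\<dots> = 4 * (t\<^sup>2 + (x - t)\<^sup>2)\<^sup>2" unfolding power_mult_distrib by simp
    also have "\<dots> \<le> 4 * (2 * ((t\<^sup>2)\<^sup>2 + ((x - t)\<^sup>2)\<^sup>2))" by (intro mult_left_mono sq) auto
    finally have "x ^ 4 \<le> 8 * (t ^ 4 + (x - t) ^ 4)" by simp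
    moreover have "t ^ 4 \<le> M ^ 4" using power_mono[OF t, of 4] by simp
    ultimately show ?thesis by simp
  qed
  have "(\<integral>\<^sup>+x. ennreal (x ^ 4) \<partial>normal_measure t s)
      \<le> (\<integral>\<^sup>+x. ennreal (8 * (M ^ 4 + (x - t) ^ 4)) \<partial>normal_measure t s)"
    by (intro nn_integral_mono ennreal_leI pt)
  also have "\<dots> = ennreal (8 * (M ^ 4 + 3 * s ^ 4))"
    using I E M_pos by (subst nn_integral_eq_integral) (auto simp: prob_space[simplified] intro!: add_nonneg_nonneg)
  also have "\<dots> \<le> ennreal fourth_moment_bound"
    unfolding fourth_moment_bound_def using s
    by (intro ennreal_leI mult_left_mono add_left_mono power_mono) auto
  finally show ?thesis .
qed

lemma fourth_moment_mixture:
  assumes p: "p \<in> priors" and s: "c \<le> s" "s \<le> C"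
  shows "integrable (mixture_measure p s) (\<lambda>x. x ^ 4)"
    and "(\<integral>x. x ^ 4 \<partial>mixture_measure p s) \<le> fourth_moment_bound"
proof -
  interpret p: prob_space p using priorD(1)[OF p] .
  have nn: "fourth_moment_bound \<ge> 0" unfolding fourth_moment_bound_def by auto
  have "(\<integral>\<^sup>+x. ennreal (x ^ 4) \<partial>mixture_measure p s)
     = (\<integral>\<^sup>+t. (\<integral>\<^sup>+x. ennreal (x ^ 4) \<partial>normal_measure t s) \<partial>p)"
    by (rule nn_integral_mixture[OF p s(1)]) measurable
  also have "\<dots> \<le> (\<integral>\<^sup>+t. ennreal fourth_moment_bound \<partial>p)"
  proof (rule nn_integral_mono_AE)
    show "AE t in p. (\<integral>\<^sup>+x. ennreal (x ^ 4) \<partial>normal_measure t s) \<le> ennreal fourth_moment_bound"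
      using priorD(4)[OF p] by eventually_elim (use s c_pos in \<open>auto intro!: fourth_moment_normal\<close>)
  qed
  also have "\<dots> = ennreal fourth_moment_bound" by (simp add: p.emeasure_space_1)
  finally have le: "(\<integral>\<^sup>+x. ennreal (x ^ 4) \<partial>mixture_measure p s) \<le> ennreal fourth_moment_bound" .
  show I: "integrable (mixture_measure p s) (\<lambda>x. x ^ 4)"
    by (rule integrableI_bounded) (use le in \<open>auto simp: power_even_abs_numeral intro: le_less_trans\<close>)
  have "ennreal (\<integral>x. x ^ 4 \<partial>mixture_measure p s) \<le> ennreal fourth_moment_bound"
    using le by (subst (asm) nn_integral_eq_integral[OF I]) auto
  then show "(\<integral>x. x ^ 4 \<partial>mixture_measure p s) \<le> fourth_moment_bound" using nn by simp
qed

lemma mixture_second_moment: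
  assumes p: "p \<in> priors" and s: "c \<le> s" "s \<le> C"
  shows "integrable (mixture_measure p s) (\<lambda>x. x\<^sup>2)"
proof (rule Bochner_Integration.integrable_bound)
  interpret prob_space "mixture_measure p s" using prob_space_mixture_measure[OF p s(1)] .
  show "integrable (mixture_measure p s) (\<lambda>x. 1 + x ^ 4)"
    using fourth_moment_mixture(1)[OF p s] by simp
  have "x\<^sup>2 \<le> 1 + x ^ 4" for x :: real
  proof -
    have "0 \<le> (x\<^sup>2 - 1)\<^sup>2" by simp
    also have "\<dots> = x ^ 4 - 2 * x\<^sup>2 + 1" unfolding power2_diff by (simp flip: power_mult)
    finally show ?thesis using zero_le_power2[of x] by linarith
  qed
  then show "AE x in mixture_measure p s. norm (x\<^sup>2) \<le> norm (1 + x ^ 4)"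
    by (intro AE_I2) (auto intro: order_trans abs_ge_self)
qed auto

text \<open>Fourth moments make the squares uniformly integrable over all priors and scales.\<close>

lemma mixture_sq_tail:
  assumes p: "p \<in> priors" and s: "c \<le> s" "s \<le> C" and T: "T > 0"
  shows "(\<integral>x. sq_tail T x \<partial>mixture_measure p s) \<le> fourth_moment_bound / T\<^sup>2"
proof -
  have pt: "sq_tail T x \<le> x ^ 4 / T\<^sup>2" for x
  proof (cases "T \<le> \<bar>x\<bar>")
    case True
    then have "T\<^sup>2 \<le> x\<^sup>2" using power_mono[of T "\<bar>x\<bar>" 2] T by simp
    then have "x\<^sup>2 * T\<^sup>2 \<le> x\<^sup>2 * x\<^sup>2" by (intro mult_left_mono) auto
    then show ?thesis using T True by (simp add: sq_tail_def field_simps)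
  qed (simp add: sq_tail_def)
  have I: "integrable (mixture_measure p s) (\<lambda>x. x ^ 4 / T\<^sup>2)"
    using fourth_moment_mixture(1)[OF p s] by simp
  have "(\<integral>x. sq_tail T x \<partial>mixture_measure p s) \<le> (\<integral>x. x ^ 4 / T\<^sup>2 \<partial>mixture_measure p s)"
  proof (rule integral_mono_AE)
    show "integrable (mixture_measure p s) (sq_tail T)"
      by (rule Bochner_Integration.integrable_bound[OF mixture_second_moment[OF p s]])
         (auto simp: sq_tail_nonneg sq_tail_le)
  qed (use I pt in auto)
  also have "\<dots> \<le> fourth_moment_bound / T\<^sup>2"
    using fourth_moment_mixture(2)[OF p s] by (simp add: divide_right_mono)
  finally show ?thesis .
qed

text \<open>The mixture is the convolution of the prior with a centred normal law.\<close>

lemma char_mixture_measure: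
  assumes p: "p \<in> priors" and s: "c \<le> s"
  shows "char (mixture_measure p s) u = char p u * exp (- (s * u)\<^sup>2 / 2)"
proof -
  interpret p: prob_space p using priorD(1)[OF p] .
  interpret pair_sigma_finite lborel p ..
  have [measurable_cong]: "sets p = sets borel" using priorD(2)[OF p] .
  note mixture_density_measurable[OF p, measurable]
  let ?f = "\<lambda>x t. \<phi> s (x - t) *\<^sub>R iexp (u * x)"
  have int: "integrable (lborel \<Otimes>\<^sub>M p) (\<lambda>(x, t). ?f x t)"
  proof (subst integrable_iff_bounded, intro conjI)
    have "(\<integral>\<^sup>+z. ennreal (norm (case z of (x, t) \<Rightarrow> ?f x t)) \<partial>(lborel \<Otimes>\<^sub>M p))
      = (\<integral>\<^sup>+z. ennreal (case z of (x, t) \<Rightarrow> \<phi> s (x - t)) \<partial>(lborel \<Otimes>\<^sub>M p))"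
      by (intro nn_integral_cong) auto
    also have "\<dots> = (\<integral>\<^sup>+t. (\<integral>\<^sup>+x. ennreal (\<phi> s (x - t)) \<partial>lborel) \<partial>p)"
      by (subst nn_integral_snd[symmetric]) auto
    also have "\<dots> = (\<integral>\<^sup>+t. 1 \<partial>p)"
      unfolding normal_density_shift using s c_pos
      by (intro nn_integral_cong, subst nn_integral_eq_integral) auto
    also have "\<dots> < \<infinity>" using p.emeasure_space_1 by simp
    finally show "(\<integral>\<^sup>+z. ennreal (norm (case z of (x, t) \<Rightarrow> ?f x t)) \<partial>(lborel \<Otimes>\<^sub>M p)) < \<infinity>" .
  qed measurable
  have "char (mixture_measure p s) u = (CLINT x|lborel. mixture_density p s x *\<^sub>R iexp (u * x))"
    unfolding char_def mixture_measure_def by (subst integral_density) (auto simp: mixture_density_nonneg)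
  also have "\<dots> = (CLINT x|lborel. (CLINT t|p. ?f x t))"
    unfolding mixture_density_def using kernel_integrable[OF p s]
    by (intro Bochner_Integration.integral_cong integral_scaleR_left[symmetric]) auto
  also have "\<dots> = (CLINT t|p. (CLINT x|lborel. ?f x t))"
    by (rule Fubini_integral[OF int, symmetric])
  also have "\<dots> = (CLINT t|p. char (normal_measure t s) u)"
    unfolding char_def normal_measure_def normal_density_shift
    by (intro Bochner_Integration.integral_cong refl integral_density[symmetric]) auto
  also have "\<dots> = (CLINT t|p. iexp (u * t) * exp (- (s * u)\<^sup>2 / 2))"
    using s c_pos by (simp add: char_normal_measure)
  also have "\<dots> = char p u * exp (- (s * u)\<^sup>2 / 2)"
    unfolding char_def by (rule integral_mult_left_zero)
  finally show ?thesis .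
qed

end

section \<open>Quadratic growth and Wasserstein distances\<close>

text \<open>A derivative of at most linear growth, expressed by increments. Log-densities of Gaussian
  mixtures have this property, and it makes a function integrable under every law with a finite
  second moment.\<close>

definition quadratic_growth :: "real \<Rightarrow> (real \<Rightarrow> real) \<Rightarrow> bool" where
  "quadratic_growth K g \<longleftrightarrow> (\<forall>x y. \<bar>g x - g y\<bar> \<le> K * \<bar>x - y\<bar> * (1 + \<bar>x\<bar> + \<bar>y\<bar>))"

lemma quadratic_growth_nonneg: "quadratic_growth K g \<Longrightarrow> 0 \<le> K"
  unfolding quadratic_growth_def by (drule spec[of _ 1], drule spec[of _ 0]) auto

lemma quadratic_growth_continuous:
  assumes "quadratic_growth K g"
  shows "continuous_on UNIV g"
proof -
  have "isCont g x" for x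
  proof -
    have "((\<lambda>y. g y - g x) \<longlongrightarrow> 0) (at x)"
    proof (rule Lim_null_comparison)
      show "\<forall>\<^sub>F y in at x. norm (g y - g x) \<le> K * \<bar>y - x\<bar> * (1 + \<bar>y\<bar> + \<bar>x\<bar>)"
        using assms by (auto simp: quadratic_growth_def intro!: always_eventually)
      show "((\<lambda>y. K * \<bar>y - x\<bar> * (1 + \<bar>y\<bar> + \<bar>x\<bar>)) \<longlongrightarrow> 0) (at x)"
        by (auto intro!: tendsto_eq_intros)
    qed
    then show ?thesis unfolding isCont_def by (rule LIM_zero_cancel)
  qed
  then show ?thesis by (simp add: continuous_at_imp_continuous_on)
qed

lemma quadratic_growth_measurable:
  "quadratic_growth K g \<Longrightarrow> g \<in> borel_measurable borel"
  by (intro borel_measurable_continuous_onI quadratic_growth_continuous)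

lemma quadratic_growth_bound:
  assumes g: "quadratic_growth K g"
  shows "\<bar>g x\<bar> \<le> \<bar>g 0\<bar> + K * (1 + 2 * x\<^sup>2)"
proof -
  have "\<bar>g x\<bar> \<le> \<bar>g 0\<bar> + \<bar>g x - g 0\<bar>" by linarith
  also have "\<bar>g x - g 0\<bar> \<le> K * \<bar>x\<bar> * (1 + \<bar>x\<bar>)"
    using g[unfolded quadratic_growth_def, rule_format, of x 0] by simp
  also have "\<dots> = K * (\<bar>x\<bar> + x\<^sup>2)" by (simp add: power2_eq_square algebra_simps)
  also have "\<dots> \<le> K * (1 + 2 * x\<^sup>2)"
  proof (rule mult_left_mono[OF _ quadratic_growth_nonneg[OF g]])
    have "0 \<le> (\<bar>x\<bar> - 1 / 2)\<^sup>2" by simp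
    then have "\<bar>x\<bar> \<le> x\<^sup>2 + 1 / 4" by (simp add: power2_diff power_divide)
    then show "\<bar>x\<bar> + x\<^sup>2 \<le> 1 + 2 * x\<^sup>2" by simp
  qed
  finally show ?thesis by simp
qed

lemma quadratic_growth_integrable:
  assumes g: "quadratic_growth K g" and "prob_space \<mu>" and [measurable_cong]: "sets \<mu> = sets borel"
    and int: "integrable \<mu> (\<lambda>x. x\<^sup>2)"
  shows "integrable \<mu> g"
proof (rule Bochner_Integration.integrable_bound)
  interpret prob_space \<mu> by fact
  show "integrable \<mu> (\<lambda>x. \<bar>g 0\<bar> + K * (1 + 2 * x\<^sup>2))" using int by simp
  show "g \<in> borel_measurable \<mu>" using quadratic_growth_measurable[OF g] by simp
  show "AE x in \<mu>. norm (g x) \<le> norm (\<bar>g 0\<bar> + K * (1 + 2 * x\<^sup>2))"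
    using quadratic_growth_bound[OF g] by (intro AE_I2) (auto intro: order_trans[OF _ abs_ge_self])
qed

definition clip :: "real \<Rightarrow> real \<Rightarrow> real" where
  "clip T x = max (- T) (min T x)"

lemma clip_bounds: "0 \<le> T \<Longrightarrow> \<bar>clip T x\<bar> \<le> T" and clip_id: "\<bar>x\<bar> \<le> T \<Longrightarrow> clip T x = x"
  and clip_lipschitz: "\<bar>clip T x - clip T y\<bar> \<le> \<bar>x - y\<bar>"
  and clip_diff: "0 \<le> T \<Longrightarrow> \<bar>x - clip T x\<bar> \<le> \<bar>x\<bar>"
  and clip_le: "0 \<le> T \<Longrightarrow> \<bar>clip T x\<bar> \<le> \<bar>x\<bar>"
  unfolding clip_def by linarith+

lemma clip_continuous [continuous_intros]: "continuous_on A (clip T)"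
  unfolding clip_def[abs_def] by (intro continuous_intros)

lemma quadratic_growth_clip:
  assumes g: "quadratic_growth K g" and T: "1 \<le> T"
  shows "\<bar>g (clip T x) - g (clip T y)\<bar> \<le> K * (1 + 2 * T) * \<bar>x - y\<bar>"
    and "\<bar>g x - g (clip T x)\<bar> \<le> 3 * K * sq_tail T x"
    and "\<bar>g (clip T x)\<bar> \<le> \<bar>g 0\<bar> + K * (1 + 2 * T\<^sup>2)"
proof -
  note K = quadratic_growth_nonneg[OF g]
  have gd: "\<bar>g a - g b\<bar> \<le> K * \<bar>a - b\<bar> * (1 + \<bar>a\<bar> + \<bar>b\<bar>)" for a b
    using g by (simp add: quadratic_growth_def)
  have b: "\<bar>clip T z\<bar> \<le> T" for z using T by (intro clip_bounds) simp
  have "\<bar>g (clip T x) - g (clip T y)\<bar> \<le> K * \<bar>clip T x - clip T y\<bar> * (1 + \<bar>clip T x\<bar> + \<bar>clip T y\<bar>)"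
    by (rule gd)
  also have "\<dots> \<le> K * \<bar>x - y\<bar> * (1 + 2 * T)"
    using K b[of x] b[of y] clip_lipschitz[of T x y] by (intro mult_mono) auto
  finally show "\<bar>g (clip T x) - g (clip T y)\<bar> \<le> K * (1 + 2 * T) * \<bar>x - y\<bar>" by (simp add: mult_ac)
  show "\<bar>g x - g (clip T x)\<bar> \<le> 3 * K * sq_tail T x"
  proof (cases "T \<le> \<bar>x\<bar>")
    case True
    have "\<bar>g x - g (clip T x)\<bar> \<le> K * \<bar>x - clip T x\<bar> * (1 + \<bar>x\<bar> + \<bar>clip T x\<bar>)" by (rule gd)
    also have "\<dots> \<le> K * \<bar>x\<bar> * (3 * \<bar>x\<bar>)"
      using K T True clip_diff[of T x] clip_le[of T x] by (intro mult_mono) auto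
    also have "\<dots> = 3 * K * sq_tail T x" using True by (simp add: sq_tail_def power2_eq_square)
    finally show ?thesis .
  next
    case False
    then show ?thesis using K sq_tail_nonneg[of T x] by (simp add: clip_id)
  qed
  have "\<bar>g (clip T x)\<bar> \<le> \<bar>g 0\<bar> + K * (1 + 2 * (clip T x)\<^sup>2)" by (rule quadratic_growth_bound[OF g])
  also have "(clip T x)\<^sup>2 \<le> T\<^sup>2" using power_mono[OF b[of x], of 2] by simp
  then have "\<bar>g 0\<bar> + K * (1 + 2 * (clip T x)\<^sup>2) \<le> \<bar>g 0\<bar> + K * (1 + 2 * T\<^sup>2)"
    using K by (intro add_left_mono mult_left_mono) auto
  finally show "\<bar>g (clip T x)\<bar> \<le> \<bar>g 0\<bar> + K * (1 + 2 * T\<^sup>2)" .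
qed

lemma convex_abs_power:
  assumes "p \<ge> 1"
  shows "convex_on UNIV (\<lambda>x::real. \<bar>x\<bar> ^ p)"
proof (rule convex_onI)
  have c: "convex_on {0::real..} (\<lambda>x. x ^ p)"
    using convex_power_even[of p] convex_power_odd[of p] convex_on_subset[of UNIV _ "{0::real..}"]
    by (cases "even p") auto
  fix t x y :: real assume t: "0 < t" "t < 1"
  have "\<bar>(1 - t) *\<^sub>R x + t *\<^sub>R y\<bar> \<le> \<bar>(1 - t) * x\<bar> + \<bar>t * y\<bar>" by simp
  also have "\<dots> = (1 - t) * \<bar>x\<bar> + t * \<bar>y\<bar>" using t by (simp add: abs_mult)
  finally have "\<bar>(1 - t) *\<^sub>R x + t *\<^sub>R y\<bar> ^ p \<le> ((1 - t) * \<bar>x\<bar> + t * \<bar>y\<bar>) ^ p"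
    by (intro power_mono) auto
  also have "\<dots> \<le> (1 - t) * \<bar>x\<bar> ^ p + t * \<bar>y\<bar> ^ p"
    using convex_onD[OF c, of t "\<bar>x\<bar>" "\<bar>y\<bar>"] t by simp
  finally show "\<bar>(1 - t) *\<^sub>R x + t *\<^sub>R y\<bar> ^ p \<le> (1 - t) * \<bar>x\<bar> ^ p + t * \<bar>y\<bar> ^ p" .
qed auto

lemma wasserstein_power:
  assumes "p \<ge> 1"
  shows "(wasserstein p \<mu> \<nu>) ^ p = (INF \<gamma>\<in>couplings \<mu> \<nu>. \<integral>\<^sup>+z. ennreal (\<bar>fst z - snd z\<bar> ^ p) \<partial>\<gamma>)"
proof -
  have "(ennreal_root p x) ^ p = x" for x
    using assms by (cases x) (auto simp: ennreal_root_def ennreal_power top_power_ennreal)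
  then show ?thesis by (simp add: wasserstein_def)
qed

text \<open>The easy half of Kantorovich duality: along every coupling a Lipschitz function differs by at
  most a multiple of the transport distance, and Jensen's inequality covers exponents above one.\<close>

lemma lipschitz_le_wasserstein:
  fixes g :: "real \<Rightarrow> real"
  assumes p: "p \<ge> 1" and \<mu>: "prob_space \<mu>" "sets \<mu> = sets borel" and \<nu>: "sets \<nu> = sets borel"
    and lip: "\<And>x y. \<bar>g x - g y\<bar> \<le> L * \<bar>x - y\<bar>" and L: "L > 0"
    and bnd: "\<And>x. \<bar>g x\<bar> \<le> b" and g[measurable]: "g \<in> borel_measurable borel"
  shows "ennreal ((\<bar>(\<integral>x. g x \<partial>\<mu>) - (\<integral>x. g x \<partial>\<nu>)\<bar> / L) ^ p) \<le> (wasserstein p \<mu> \<nu>) ^ p"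
  unfolding wasserstein_power[OF p]
proof (rule INF_greatest)
  fix \<gamma> assume \<gamma>: "\<gamma> \<in> couplings \<mu> \<nu>"
  then have [measurable_cong]: "sets \<gamma> = sets (borel \<Otimes>\<^sub>M borel)"
    and d: "distr \<gamma> borel fst = \<mu>" "distr \<gamma> borel snd = \<nu>" by (auto simp: couplings_def)
  interpret prob_space \<gamma> by (rule prob_space_distrD[of fst _ borel]) (use d \<mu> in auto)
  have int: "integrable \<gamma> (\<lambda>z. g (fst z))" "integrable \<gamma> (\<lambda>z. g (snd z))"
    by (rule integrable_const_bound[of _ b]; use bnd in simp)+
  let ?h = "\<lambda>z. (g (fst z) - g (snd z)) / L"
  have "(\<integral>x. g x \<partial>\<mu>) = (\<integral>z. g (fst z) \<partial>\<gamma>)" "(\<integral>x. g x \<partial>\<nu>) = (\<integral>z. g (snd z) \<partial>\<gamma>)"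
    unfolding d[symmetric] by (subst integral_distr; simp)+
  then have eq: "\<bar>(\<integral>x. g x \<partial>\<mu>) - (\<integral>x. g x \<partial>\<nu>)\<bar> / L = \<bar>\<integral>z. ?h z \<partial>\<gamma>\<bar>"
    using int L by simp
  have hb: "\<bar>?h z\<bar> \<le> 2 * b / L" for z
  proof -
    have "\<bar>g (fst z) - g (snd z)\<bar> \<le> 2 * b" using bnd[of "fst z"] bnd[of "snd z"] by linarith
    then show ?thesis using L by (simp add: abs_divide divide_right_mono)
  qed
  have hp: "integrable \<gamma> (\<lambda>z. \<bar>?h z\<bar> ^ p)"
    by (rule integrable_const_bound[of _ "(2 * b / L) ^ p"])
       (use power_mono[OF hb, of _ p] in \<open>auto simp del: abs_divide\<close>)
  have "\<bar>\<integral>z. ?h z \<partial>\<gamma>\<bar> ^ p \<le> (\<integral>z. \<bar>?h z\<bar> ^ p \<partial>\<gamma>)"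
    by (rule jensens_inequality[where I=UNIV, OF _ _ _ hp convex_abs_power[OF p]]) (use int in auto)
  then have "ennreal ((\<bar>(\<integral>x. g x \<partial>\<mu>) - (\<integral>x. g x \<partial>\<nu>)\<bar> / L) ^ p) \<le> ennreal (\<integral>z. \<bar>?h z\<bar> ^ p \<partial>\<gamma>)"
    unfolding eq by (rule ennreal_leI)
  also have "\<dots> = (\<integral>\<^sup>+z. ennreal (\<bar>?h z\<bar> ^ p) \<partial>\<gamma>)"
    by (rule nn_integral_eq_integral[symmetric]) (use hp in auto)
  also have "\<dots> \<le> (\<integral>\<^sup>+z. ennreal (\<bar>fst z - snd z\<bar> ^ p) \<partial>\<gamma>)"
  proof (intro nn_integral_mono ennreal_leI power_mono)
    fix z show "\<bar>?h z\<bar> \<le> \<bar>fst z - snd z\<bar>"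
      using lip[of "fst z" "snd z"] L by (simp add: abs_divide field_simps)
  qed auto
  finally show "ennreal ((\<bar>(\<integral>x. g x \<partial>\<mu>) - (\<integral>x. g x \<partial>\<nu>)\<bar> / L) ^ p) \<le> (\<integral>\<^sup>+z. ennreal (\<bar>fst z - snd z\<bar> ^ p) \<partial>\<gamma>)" .
qed

text \<open>The distance of order one sees only Lipschitz functions. Clipping the argument at \<open>T\<close> makes \<open>g\<close>
  Lipschitz with a constant of order \<open>T\<close>, and the change is controlled by the tails of the second moments.\<close>

lemma quadratic_growth_wasserstein:
  assumes g: "quadratic_growth K g" and T: "1 \<le> T"
    and \<mu>: "prob_space \<mu>" "sets \<mu> = sets borel" "integrable \<mu> (\<lambda>x. x\<^sup>2)"
    and \<nu>: "prob_space \<nu>" "sets \<nu> = sets borel" "integrable \<nu> (\<lambda>x. x\<^sup>2)"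
    and W: "wasserstein 1 \<mu> \<nu> < \<infinity>"
  shows "\<bar>(\<integral>x. g x \<partial>\<mu>) - (\<integral>x. g x \<partial>\<nu>)\<bar>
     \<le> K * (1 + 2 * T) * enn2real (wasserstein 1 \<mu> \<nu>) + 3 * K * ((\<integral>x. sq_tail T x \<partial>\<mu>) + (\<integral>x. sq_tail T x \<partial>\<nu>))"
proof -
  note K = quadratic_growth_nonneg[OF g]
  note [measurable] = quadratic_growth_measurable[OF g]
  have [measurable]: "clip T \<in> borel_measurable borel" by (intro borel_measurable_continuous_onI clip_continuous)
  have tail: "\<bar>(\<integral>x. g x \<partial>\<rho>) - (\<integral>x. g (clip T x) \<partial>\<rho>)\<bar> \<le> 3 * K * (\<integral>x. sq_tail T x \<partial>\<rho>)"
    if \<rho>: "prob_space \<rho>" "sets \<rho> = sets borel" "integrable \<rho> (\<lambda>x. x\<^sup>2)" for \<rho>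
  proof -
    interpret prob_space \<rho> by fact
    note [measurable_cong] = \<rho>(2)
    have i1: "integrable \<rho> g" by (rule quadratic_growth_integrable[OF g \<rho>])
    have i2: "integrable \<rho> (\<lambda>x. g (clip T x))"
      by (rule integrable_const_bound[of _ "\<bar>g 0\<bar> + K * (1 + 2 * T\<^sup>2)"])
         (use quadratic_growth_clip(3)[OF g T] in auto)
    have i3: "integrable \<rho> (sq_tail T)"
      by (rule Bochner_Integration.integrable_bound[OF \<rho>(3)]) (auto simp: sq_tail_nonneg sq_tail_le)
    have "(\<integral>x. g x \<partial>\<rho>) - (\<integral>x. g (clip T x) \<partial>\<rho>) = (\<integral>x. g x - g (clip T x) \<partial>\<rho>)"
      using i1 i2 by simp
    also have "\<bar>\<dots>\<bar> \<le> (\<integral>x. \<bar>g x - g (clip T x)\<bar> \<partial>\<rho>)" by (rule integral_abs_bound)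
    also have "\<dots> \<le> (\<integral>x. 3 * K * sq_tail T x \<partial>\<rho>)"
      using i1 i2 i3 quadratic_growth_clip(2)[OF g T] by (intro integral_mono) auto
    also have "\<dots> = 3 * K * (\<integral>x. sq_tail T x \<partial>\<rho>)" by simp
    finally show ?thesis .
  qed
  have mid: "\<bar>(\<integral>x. g (clip T x) \<partial>\<mu>) - (\<integral>x. g (clip T x) \<partial>\<nu>)\<bar> \<le> K * (1 + 2 * T) * enn2real (wasserstein 1 \<mu> \<nu>)"
  proof (cases "K = 0")
    case True
    then have "g (clip T x) = g 0" for x using g by (auto simp: quadratic_growth_def)
    then show ?thesis using True \<mu>(1) \<nu>(1) by (simp add: prob_space.prob_space)
  next
    case False
    let ?L = "K * (1 + 2 * T)"
    have L: "?L > 0" using False K T by simp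
    have "ennreal ((\<bar>(\<integral>x. g (clip T x) \<partial>\<mu>) - (\<integral>x. g (clip T x) \<partial>\<nu>)\<bar> / ?L) ^ 1) \<le> (wasserstein 1 \<mu> \<nu>) ^ 1"
      by (rule lipschitz_le_wasserstein[OF _ \<mu>(1,2) \<nu>(2) quadratic_growth_clip(1)[OF g T] L quadratic_growth_clip(3)[OF g T]]) auto
    then have "\<bar>(\<integral>x. g (clip T x) \<partial>\<mu>) - (\<integral>x. g (clip T x) \<partial>\<nu>)\<bar> / ?L \<le> enn2real (wasserstein 1 \<mu> \<nu>)"
      using W by (cases "wasserstein 1 \<mu> \<nu>") auto
    then show ?thesis using L by (simp add: divide_le_eq mult.commute)
  qed
  show ?thesis using tail[OF \<mu>] tail[OF \<nu>] mid by (simp add: algebra_simps)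
qed

section \<open>Log-likelihood, Hellinger distance and identifiability\<close>

context gaussian_location_model
begin

definition log_growth :: real where "log_growth = (1 + 2 * M) / (2 * c\<^sup>2)"

lemma quadratic_growth_ln_mixture:
  assumes p: "p \<in> priors" and s: "c \<le> s"
  shows "quadratic_growth log_growth (\<lambda>x. ln (mixture_density p s x))"
  unfolding quadratic_growth_def
proof (intro allI)
  fix x y :: real
  have "\<bar>ln (mixture_density p s x) - ln (mixture_density p s y)\<bar> \<le> \<bar>x - y\<bar> * (\<bar>x\<bar> + \<bar>y\<bar> + 2 * M) / (2 * c\<^sup>2)"
    by (rule ln_mixture_argument[OF p s])
  also have "\<dots> \<le> \<bar>x - y\<bar> * ((1 + 2 * M) * (1 + \<bar>x\<bar> + \<bar>y\<bar>)) / (2 * c\<^sup>2)"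
    using M_pos by (intro divide_right_mono mult_left_mono) (auto simp: algebra_simps)
  finally show "\<bar>ln (mixture_density p s x) - ln (mixture_density p s y)\<bar> \<le> log_growth * \<bar>x - y\<bar> * (1 + \<bar>x\<bar> + \<bar>y\<bar>)"
    by (simp add: log_growth_def mult_ac)
qed

lemma ln_mixture_integrable:
  assumes p: "p \<in> priors" and q: "q \<in> priors" and s: "c \<le> s" "s \<le> C"
  shows "integrable (mixture_measure q s) (\<lambda>x. ln (mixture_density p s x))"
  by (rule quadratic_growth_integrable[OF quadratic_growth_ln_mixture[OF p s(1)]
        prob_space_mixture_measure[OF q s(1)] _ mixture_second_moment[OF q s]]) simp

lemma hellinger_integrable:
  assumes p: "p \<in> priors" and q: "q \<in> priors" and s: "c \<le> s"
  shows "integrable lborel (\<lambda>x. (sqrt (mixture_density p s x) - sqrt (mixture_density q s x))\<^sup>2)"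
proof (rule Bochner_Integration.integrable_bound)
  show "integrable lborel (\<lambda>x. mixture_density p s x + mixture_density q s x)"
    using mixture_density_integrable p q s by auto
  show "(\<lambda>x. (sqrt (mixture_density p s x) - sqrt (mixture_density q s x))\<^sup>2) \<in> borel_measurable lborel"
    using mixture_density_measurable[OF p] mixture_density_measurable[OF q] by simp
  show "AE x in lborel. norm ((sqrt (mixture_density p s x) - sqrt (mixture_density q s x))\<^sup>2)
     \<le> norm (mixture_density p s x + mixture_density q s x)"
  proof (rule AE_I2)
    fix x
    have "(sqrt (mixture_density p s x) - sqrt (mixture_density q s x))\<^sup>2 \<le> mixture_density p s x + mixture_density q s x"
      by (simp add: power2_diff mixture_density_nonneg)
    then show "norm ((sqrt (mixture_density p s x) - sqrt (mixture_density q s x))\<^sup>2)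
     \<le> norm (mixture_density p s x + mixture_density q s x)"
      by (simp add: mixture_density_nonneg)
  qed
qed

text \<open>This is \<open>ln r \<le> 2 (sqrt r - 1)\<close> at the likelihood ratio \<open>r\<close>, integrated against \<open>q\<close>.\<close>

lemma hellinger_le_log_likelihood:
  assumes p: "p \<in> priors" and q: "q \<in> priors" and s: "c \<le> s" "s \<le> C"
  shows "(\<integral>x. ln (mixture_density p s x) \<partial>mixture_measure q s) - (\<integral>x. ln (mixture_density q s x) \<partial>mixture_measure q s)
     \<le> - 2 * hellinger_sq (mixture_density p s) (mixture_density q s)"
proof -
  let ?f = "mixture_density p s" and ?g = "mixture_density q s"
  note [measurable] = mixture_density_measurable[OF p] mixture_density_measurable[OF q]
  note I = ln_mixture_integrable[OF p q s] ln_mixture_integrable[OF q q s]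
  note D = mixture_density_integrable[OF p s(1)] mixture_density_integrable[OF q s(1)] hellinger_integrable[OF p q s(1)]
  have "(\<integral>x. ln (?f x) \<partial>mixture_measure q s) - (\<integral>x. ln (?g x) \<partial>mixture_measure q s)
     = (\<integral>x. ln (?f x) - ln (?g x) \<partial>mixture_measure q s)" using I by simp
  also have "\<dots> = (\<integral>x. ?g x * (ln (?f x) - ln (?g x)) \<partial>lborel)"
    by (rule integral_mixture_measure[OF q]) simp
  also have "\<dots> \<le> (\<integral>x. ?f x - ?g x - (sqrt (?f x) - sqrt (?g x))\<^sup>2 \<partial>lborel)"
  proof (rule integral_mono)
    show "integrable lborel (\<lambda>x. ?g x * (ln (?f x) - ln (?g x)))"
      using I by (subst integrable_mixture_measure[OF q, symmetric]) auto
    show "integrable lborel (\<lambda>x. ?f x - ?g x - (sqrt (?f x) - sqrt (?g x))\<^sup>2)" using D by auto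
    fix x
    have f: "?f x > 0" and g: "?g x > 0" using mixture_density_pos p q s by auto
    have "ln (?f x) - ln (?g x) = 2 * ln (sqrt (?f x) / sqrt (?g x))"
      using f g by (simp add: ln_div ln_sqrt)
    also have "\<dots> \<le> 2 * (sqrt (?f x) / sqrt (?g x) - 1)"
      using f g by (intro mult_left_mono ln_le_minus_one) auto
    finally have "?g x * (ln (?f x) - ln (?g x)) \<le> ?g x * (2 * (sqrt (?f x) / sqrt (?g x) - 1))"
      using g by (intro mult_left_mono) auto
    also have "\<dots> = 2 * (sqrt (?f x) * sqrt (?g x)) - 2 * ?g x"
    proof -
      have "?g x / sqrt (?g x) = sqrt (?g x)" using g by (simp add: real_div_sqrt)
      then have "?g x * (sqrt (?f x) / sqrt (?g x)) = sqrt (?f x) * sqrt (?g x)"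
        by (metis mult.commute times_divide_eq_left times_divide_eq_right)
      then show ?thesis by (simp add: algebra_simps)
    qed
    also have "\<dots> = ?f x - ?g x - (sqrt (?f x) - sqrt (?g x))\<^sup>2"
      using f g by (simp add: power2_diff)
    finally show "?g x * (ln (?f x) - ln (?g x)) \<le> ?f x - ?g x - (sqrt (?f x) - sqrt (?g x))\<^sup>2" .
  qed
  also have "\<dots> = - 2 * hellinger_sq ?f ?g" using D by (simp add: hellinger_sq_def)
  finally show ?thesis .
qed

lemma hellinger_sq_nonneg: "0 \<le> hellinger_sq f g"
  unfolding hellinger_sq_def by (intro mult_nonneg_nonneg integral_nonneg_AE) auto

text \<open>The \<open>L\<^sup>1\<close> distance of the densities bounds the difference of the characteristic functions of the
  mixtures, and dividing by the Gaussian factor costs the exponential. The free weight \<open>k\<close> stands in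
  for the square root in the usual bound of the \<open>L\<^sup>1\<close> distance by the Hellinger distance.\<close>

lemma char_diff_le_hellinger:
  assumes p: "p \<in> priors" and q: "q \<in> priors" and s: "c \<le> s" "s \<le> C" and k: "k > 0"
  shows "norm (char p u - char q u)
    \<le> exp ((C * u)\<^sup>2 / 2) * (k * hellinger_sq (mixture_density p s) (mixture_density q s) + 2 / k)"
proof -
  let ?f = "mixture_density p s" and ?g = "mixture_density q s"
  note [measurable] = mixture_density_measurable[OF p] mixture_density_measurable[OF q]
  note D = mixture_density_integrable[OF p s(1)] mixture_density_integrable[OF q s(1)] hellinger_integrable[OF p q s(1)]
  have ch: "char (mixture_measure r s) u = (CLINT x|lborel. mixture_density r s x *\<^sub>R iexp (u * x))"
      "integrable lborel (\<lambda>x. mixture_density r s x *\<^sub>R iexp (u * x))" if r: "r \<in> priors" for r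
  proof -
    note [measurable] = mixture_density_measurable[OF r]
    show "char (mixture_measure r s) u = (CLINT x|lborel. mixture_density r s x *\<^sub>R iexp (u * x))"
      unfolding char_def mixture_measure_def by (subst integral_density) (auto simp: mixture_density_nonneg)
    show "integrable lborel (\<lambda>x. mixture_density r s x *\<^sub>R iexp (u * x))"
      by (rule Bochner_Integration.integrable_bound[OF mixture_density_integrable(1)[OF r s(1)]]) auto
  qed
  have "norm (char (mixture_measure p s) u - char (mixture_measure q s) u)
     = norm (CLINT x|lborel. (?f x - ?g x) *\<^sub>R iexp (u * x))"
    using ch p q by (simp add: scaleR_left_diff_distrib)
  also have "\<dots> \<le> (\<integral>x. norm ((?f x - ?g x) *\<^sub>R iexp (u * x)) \<partial>lborel)"
    by (rule integral_norm_bound)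
  also have "\<dots> \<le> (\<integral>x. k / 2 * (sqrt (?f x) - sqrt (?g x))\<^sup>2 + 1 / k * (?f x + ?g x) \<partial>lborel)"
  proof (rule integral_mono)
    show "integrable lborel (\<lambda>x. norm ((?f x - ?g x) *\<^sub>R iexp (u * x)))"
      using ch(2)[OF p] ch(2)[OF q] by (intro integrable_norm) (simp add: scaleR_left_diff_distrib)
    show "integrable lborel (\<lambda>x. k / 2 * (sqrt (?f x) - sqrt (?g x))\<^sup>2 + 1 / k * (?f x + ?g x))"
      using D by auto
    fix x
    define a b where "a = sqrt (?f x)" and "b = sqrt (?g x)"
    have fa: "?f x = a\<^sup>2" and gb: "?g x = b\<^sup>2" and ab: "a \<ge> 0" "b \<ge> 0"
      by (auto simp: a_def b_def mixture_density_nonneg)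
    \<comment> \<open>\<open>\<bar>a\<^sup>2 - b\<^sup>2\<bar> = \<bar>a - b\<bar> (a + b)\<close>, and \<open>u v \<le> (k u\<^sup>2 + v\<^sup>2 / k) / 2\<close> splits the product\<close>
    have "a\<^sup>2 - b\<^sup>2 = (a - b) * (a + b)" by (simp add: power2_eq_square algebra_simps)
    then have "\<bar>a\<^sup>2 - b\<^sup>2\<bar> = \<bar>a - b\<bar> * (a + b)" using ab by (simp add: abs_mult)
    also have "\<dots> \<le> k / 2 * (a - b)\<^sup>2 + 1 / (2 * k) * (a + b)\<^sup>2"
    proof -
      have "0 \<le> (k * \<bar>a - b\<bar> - (a + b))\<^sup>2 / (2 * k)" using k by simp
      also have "\<dots> = k / 2 * (a - b)\<^sup>2 + 1 / (2 * k) * (a + b)\<^sup>2 - \<bar>a - b\<bar> * (a + b)"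
        using k by (simp add: power2_eq_square field_simps)
      finally show ?thesis by simp
    qed
    also have "1 / (2 * k) * (a + b)\<^sup>2 \<le> 1 / (2 * k) * (2 * (a\<^sup>2 + b\<^sup>2))"
      using k sum_squares_ge_zero[of "a - b" 0]
      by (intro mult_left_mono) (auto simp: power2_eq_square algebra_simps)
    also have "1 / (2 * k) * (2 * (a\<^sup>2 + b\<^sup>2)) = 1 / k * (a\<^sup>2 + b\<^sup>2)" using k by (simp add: field_simps)
    finally show "norm ((?f x - ?g x) *\<^sub>R iexp (u * x)) \<le> k / 2 * (sqrt (?f x) - sqrt (?g x))\<^sup>2 + 1 / k * (?f x + ?g x)"
      by (simp add: fa gb ab real_sqrt_abs)
  qed
  also have "\<dots> = k * hellinger_sq ?f ?g + 2 / k"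
    using D by (simp add: hellinger_sq_def)
  finally have 1: "norm (char (mixture_measure p s) u - char (mixture_measure q s) u) \<le> k * hellinger_sq ?f ?g + 2 / k" .
  have "norm (char (mixture_measure p s) u - char (mixture_measure q s) u)
     = norm ((char p u - char q u) * of_real (exp (- (s * u)\<^sup>2 / 2)))"
    by (simp add: char_mixture_measure p q s left_diff_distrib)
  also have "\<dots> = norm (char p u - char q u) * exp (- (s * u)\<^sup>2 / 2)"
    by (simp only: norm_mult norm_of_real abs_exp_cancel)
  finally have "norm (char p u - char q u) = exp ((s * u)\<^sup>2 / 2) * norm (char (mixture_measure p s) u - char (mixture_measure q s) u)"
    by (simp add: exp_minus field_simps)
  also have "\<dots> \<le> exp ((C * u)\<^sup>2 / 2) * (k * hellinger_sq ?f ?g + 2 / k)"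
  proof (rule mult_mono[OF _ 1])
    have "(s * u)\<^sup>2 \<le> (C * u)\<^sup>2" unfolding power_mult_distrib using s c_pos
      by (intro mult_right_mono power_mono) auto
    then show "exp ((s * u)\<^sup>2 / 2) \<le> exp ((C * u)\<^sup>2 / 2)" by simp
  qed auto
  finally show ?thesis .
qed

text \<open>The rate \<open>1 / (k + 1)\<^sup>2\<close> makes the bound of \<open>char_diff_le_hellinger\<close> with weight \<open>k + 1\<close> vanish, so
  Levy's continuity theorem applies. The scales may vary along the sequence.\<close>

lemma hellinger_imp_weak_conv:
  assumes p: "\<And>k. p k \<in> priors" and q: "q \<in> priors" and s: "\<And>k. c \<le> s k" "\<And>k. s k \<le> C"
    and h: "\<And>k. hellinger_sq (mixture_density (p k) (s k)) (mixture_density q (s k)) \<le> 1 / (real k + 1)\<^sup>2"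
  shows "weak_conv_m p q"
proof (rule levy_continuity)
  fix u
  let ?E = "exp ((C * u)\<^sup>2 / 2)"
  have "(\<lambda>k. char (p k) u - char q u) \<longlonglongrightarrow> 0"
  proof (rule Lim_null_comparison)
    show "\<forall>\<^sub>F k in sequentially. norm (char (p k) u - char q u) \<le> ?E * 3 * (1 / (real k + 1))"
    proof (rule always_eventually, rule allI)
      fix k :: nat
      let ?h = "hellinger_sq (mixture_density (p k) (s k)) (mixture_density q (s k))"
      have "norm (char (p k) u - char q u) \<le> ?E * ((real k + 1) * ?h + 2 / (real k + 1))"
        by (rule char_diff_le_hellinger) (use p q s in auto)
      also have "\<dots> \<le> ?E * ((real k + 1) * (1 / (real k + 1)\<^sup>2) + 2 / (real k + 1))"
        by (intro mult_left_mono add_right_mono h) auto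
      also have "\<dots> = ?E * 3 * (1 / (real k + 1))"
      proof -
        have "a * (1 / a\<^sup>2) + 2 / a = 3 * (1 / a)" if "a > 0" for a :: real
          using that by (simp add: power2_eq_square)
        from this[of "real k + 1"] show ?thesis by simp
      qed
      finally show "norm (char (p k) u - char q u) \<le> ?E * 3 * (1 / (real k + 1))" .
    qed
    have "(\<lambda>k. 1 / (real k + 1)) \<longlonglongrightarrow> 0" using LIMSEQ_inverse_real_of_nat by (simp add: inverse_eq_divide add.commute)
    then show "(\<lambda>k. ?E * 3 * (1 / (real k + 1))) \<longlonglongrightarrow> 0" by (rule tendsto_mult_right_zero)
  qed
  then show "(\<lambda>k. char (p k) u) \<longlonglongrightarrow> char q u" by (rule LIM_zero_cancel)
qed (use p q prior_real_distribution in auto)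

lemma weak_conv_integral:
  fixes g :: "real \<Rightarrow> real"
  assumes p: "\<And>k. p k \<in> priors" and q: "q \<in> priors" and w: "weak_conv_m p q" and g: "continuous_on UNIV g"
  shows "(\<lambda>k. \<integral>t. g t \<partial>p k) \<longlonglongrightarrow> (\<integral>t. g t \<partial>q)"
proof -
  \<comment> \<open>all measures live on \<open>[-M, M]\<close>, so \<open>g\<close> may be made bounded outside\<close>
  have cont: "continuous_on UNIV (\<lambda>t. g (clip M t))"
    by (rule continuous_on_compose2[OF g clip_continuous]) auto
  have eq: "(\<integral>t. g t \<partial>r) = (\<integral>t. g (clip M t) \<partial>r)" if r: "r \<in> priors" for r
  proof (rule integral_cong_AE)
    show "g \<in> borel_measurable r" "(\<lambda>t. g (clip M t)) \<in> borel_measurable r"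
      using borel_measurable_continuous_onI[OF g] borel_measurable_continuous_onI[OF cont] priorD(2)[OF r]
      by (auto cong: measurable_cong_sets)
    show "AE t in r. g t = g (clip M t)" using priorD(4)[OF r] by eventually_elim (simp add: clip_id)
  qed
  have "compact (g ` {-M..M})"
    by (rule compact_continuous_image) (auto intro: continuous_on_subset[OF g])
  then obtain B where B: "\<And>x. x \<in> g ` {-M..M} \<Longrightarrow> norm x \<le> B"
    using compact_imp_bounded bounded_iff by metis
  have "(\<lambda>k. \<integral>t. g (clip M t) \<partial>p k) \<longlonglongrightarrow> (\<integral>t. g (clip M t) \<partial>q)"
  proof (rule weak_conv_imp_integral_bdd_continuous_conv[OF _ _ w])
    show "isCont (\<lambda>t. g (clip M t)) x" for x using cont by (simp add: continuous_on_eq_continuous_at)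
    have "clip M x \<in> {-M..M}" for x using clip_bounds[of M x] M_pos by (simp add: abs_le_iff)
    then show "norm (g (clip M x)) \<le> B" for x by (intro B) blast
  qed (use p q prior_real_distribution in auto)
  then show ?thesis using eq p q by simp
qed

text \<open>Otherwise there would be a sequence of priors whose Hellinger distances vanish as fast as wanted
  but which does not converge weakly.\<close>

lemma hellinger_determines_integral:
  fixes g :: "real \<Rightarrow> real"
  assumes q: "q \<in> priors" and g: "continuous_on UNIV g" and e: "e > 0"
  shows "\<exists>d>0. \<forall>p\<in>priors. \<forall>s\<in>{c..C}.
    hellinger_sq (mixture_density p s) (mixture_density q s) \<le> d \<longrightarrow> \<bar>(\<integral>t. g t \<partial>p) - (\<integral>t. g t \<partial>q)\<bar> \<le> e"
proof (rule ccontr)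
  assume "\<not> ?thesis"
  then have "\<exists>p s. p \<in> priors \<and> s \<in> {c..C} \<and> hellinger_sq (mixture_density p s) (mixture_density q s) \<le> d
     \<and> \<bar>(\<integral>t. g t \<partial>p) - (\<integral>t. g t \<partial>q)\<bar> > e" if "d > 0" for d
    using that by (metis linorder_not_le)
  then have "\<forall>k::nat. \<exists>p s. p \<in> priors \<and> s \<in> {c..C} \<and> hellinger_sq (mixture_density p s) (mixture_density q s) \<le> 1 / (real k + 1)\<^sup>2
     \<and> \<bar>(\<integral>t. g t \<partial>p) - (\<integral>t. g t \<partial>q)\<bar> > e" by simp
  then obtain p s where ps: "\<And>k::nat. p k \<in> priors" "\<And>k. s k \<in> {c..C}"
    "\<And>k. hellinger_sq (mixture_density (p k) (s k)) (mixture_density q (s k)) \<le> 1 / (real k + 1)\<^sup>2"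
    "\<And>k. \<bar>(\<integral>t. g t \<partial>p k) - (\<integral>t. g t \<partial>q)\<bar> > e" by metis
  have w: "weak_conv_m p q" by (rule hellinger_imp_weak_conv[OF ps(1) q _ _ ps(3)]) (use ps(2) in auto)
  have "(\<lambda>k. \<integral>t. g t \<partial>p k) \<longlonglongrightarrow> (\<integral>t. g t \<partial>q)" by (rule weak_conv_integral) (use ps q w g in auto)
  then have "\<forall>\<^sub>F k in sequentially. dist (\<integral>t. g t \<partial>p k) (\<integral>t. g t \<partial>q) < e" using e by (rule tendstoD)
  from this obtain k where "dist (\<integral>t. g t \<partial>p k) (\<integral>t. g t \<partial>q) < e"
    using eventually_happens'[OF sequentially_bot] by blast
  then show False using ps(4)[of k] by (simp add: dist_real_def)
qed

text \<open>Weak convergence gives convergence of posterior means at a fixed argument and scale. Since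
  posterior means are Lipschitz in the argument and the scale with constants independent of the
  prior, compactness of \<open>[-T, T] \<times> [c, C]\<close> makes it uniform.\<close>

lemma hellinger_determines_posterior_mean:
  assumes q: "q \<in> priors" and e: "e > 0"
  shows "\<exists>d>0. \<forall>p\<in>priors. \<forall>s\<in>{c..C}. hellinger_sq (mixture_density p s) (mixture_density q s) \<le> d \<longrightarrow>
    (\<forall>x\<in>{-T..T}. \<forall>s'\<in>{c..C}. \<bar>posterior_mean p s' x - posterior_mean q s' x\<bar> \<le> e)"
proof (rule ccontr)
  assume neg: "\<not> ?thesis"
  have "\<forall>k::nat. \<exists>p s x s'. p \<in> priors \<and> s \<in> {c..C} \<and> hellinger_sq (mixture_density p s) (mixture_density q s) \<le> 1 / (real k + 1)\<^sup>2
     \<and> x \<in> {-T..T} \<and> s' \<in> {c..C} \<and> \<bar>posterior_mean p s' x - posterior_mean q s' x\<bar> > e"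
  proof
    fix k :: nat
    have "0 < 1 / (real k + 1)\<^sup>2" by simp
    with neg show "\<exists>p s x s'. p \<in> priors \<and> s \<in> {c..C} \<and> hellinger_sq (mixture_density p s) (mixture_density q s) \<le> 1 / (real k + 1)\<^sup>2
     \<and> x \<in> {-T..T} \<and> s' \<in> {c..C} \<and> \<bar>posterior_mean p s' x - posterior_mean q s' x\<bar> > e"
      by (meson linorder_not_le)
  qed
  then obtain p s x s' where ps: "\<And>k::nat. p k \<in> priors" "\<And>k. s k \<in> {c..C}"
    "\<And>k. hellinger_sq (mixture_density (p k) (s k)) (mixture_density q (s k)) \<le> 1 / (real k + 1)\<^sup>2"
    "\<And>k. x k \<in> {-T..T}" "\<And>k. s' k \<in> {c..C}"
    "\<And>k. \<bar>posterior_mean (p k) (s' k) (x k) - posterior_mean q (s' k) (x k)\<bar> > e" by metis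
  have w: "weak_conv_m p q" by (rule hellinger_imp_weak_conv[OF ps(1) q _ _ ps(3)]) (use ps(2) in auto)
  have "seq_compact ({-T..T} \<times> {c..C})"
    by (intro compact_imp_seq_compact compact_Times) auto
  moreover have "\<forall>k. (x k, s' k) \<in> {-T..T} \<times> {c..C}" using ps by auto
  ultimately obtain z r where z: "z \<in> {-T..T} \<times> {c..C}" and r: "strict_mono r"
    and lim: "((\<lambda>k. (x k, s' k)) \<circ> r) \<longlonglongrightarrow> z" by (rule seq_compactE)
  obtain x0 s0 where zs: "z = (x0, s0)" by (cases z)
  have xl: "(\<lambda>k. x (r k)) \<longlonglongrightarrow> x0" and sl: "(\<lambda>k. s' (r k)) \<longlonglongrightarrow> s0"
    using tendsto_fst[OF lim] tendsto_snd[OF lim] by (auto simp: zs o_def)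
  have s0: "c \<le> s0" using z zs by simp
  define b where "b k = 4 * M * (M / c\<^sup>2 * \<bar>x k - x0\<bar>) + 4 * M * (scale_const * (1 + x0\<^sup>2) * \<bar>s' k - s0\<bar>)" for k
  have move: "\<bar>posterior_mean \<rho> (s' k) (x k) - posterior_mean \<rho> s0 x0\<bar> \<le> b k" if \<rho>: "\<rho> \<in> priors" for \<rho> k
  proof -
    have s'k: "c \<le> s' k" using ps(5)[of k] by simp
    show ?thesis
      using posterior_mean_lipschitz[OF \<rho> s'k, of "x k" x0] posterior_mean_scale[OF \<rho> s'k s0, of x0]
      unfolding b_def by linarith
  qed
  have b0: "(\<lambda>k. b (r k)) \<longlonglongrightarrow> 0"
  proof -
    have "(\<lambda>k. \<bar>x (r k) - x0\<bar>) \<longlonglongrightarrow> 0" "(\<lambda>k. \<bar>s' (r k) - s0\<bar>) \<longlonglongrightarrow> 0"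
      using xl sl by (auto intro!: tendsto_rabs_zero LIM_zero)
    then have "(\<lambda>k. 4 * M * (M / c\<^sup>2 * \<bar>x (r k) - x0\<bar>) + 4 * M * (scale_const * (1 + x0\<^sup>2) * \<bar>s' (r k) - s0\<bar>)) \<longlonglongrightarrow> 0 + 0"
      by (intro tendsto_add tendsto_mult_right_zero)
    then show ?thesis by (simp add: b_def)
  qed
  have kc: "continuous_on UNIV (\<lambda>t. \<phi> s0 (x0 - t))"
    unfolding normal_density_def using s0 c_pos by (intro continuous_intros) auto
  have "(\<lambda>k. posterior_mean (p k) s0 x0) \<longlonglongrightarrow> posterior_mean q s0 x0"
    unfolding posterior_mean_def mixture_density_def
  proof (rule tendsto_divide)
    show "(\<lambda>k. \<integral>t. t * \<phi> s0 (x0 - t) \<partial>p k) \<longlonglongrightarrow> (\<integral>t. t * \<phi> s0 (x0 - t) \<partial>q)"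
      by (rule weak_conv_integral[OF ps(1) q w]) (intro continuous_intros kc)
    show "(\<lambda>k. \<integral>t. \<phi> s0 (x0 - t) \<partial>p k) \<longlonglongrightarrow> (\<integral>t. \<phi> s0 (x0 - t) \<partial>q)"
      by (rule weak_conv_integral[OF ps(1) q w kc])
    show "(\<integral>t. \<phi> s0 (x0 - t) \<partial>q) \<noteq> 0"
      using mixture_density_pos[OF q s0, of x0] by (simp add: mixture_density_def)
  qed
  from LIMSEQ_subseq_LIMSEQ[OF this r]
  have "(\<lambda>k. \<bar>posterior_mean (p (r k)) s0 x0 - posterior_mean q s0 x0\<bar>) \<longlonglongrightarrow> 0"
    by (intro tendsto_rabs_zero LIM_zero) (simp add: o_def)
  from tendsto_add[OF this tendsto_mult_right_zero[OF b0, of 2]]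
  have "(\<lambda>k. \<bar>posterior_mean (p (r k)) s0 x0 - posterior_mean q s0 x0\<bar> + 2 * b (r k)) \<longlonglongrightarrow> 0" by simp
  then have "\<forall>\<^sub>F k in sequentially. \<bar>posterior_mean (p (r k)) s0 x0 - posterior_mean q s0 x0\<bar> + 2 * b (r k) < e"
    using e by (rule order_tendstoD)
  then obtain k where "\<bar>posterior_mean (p (r k)) s0 x0 - posterior_mean q s0 x0\<bar> + 2 * b (r k) < e"
    using eventually_happens'[OF sequentially_bot] by blast
  then show False using ps(6)[of "r k"] move[OF ps(1), of "r k" "r k"] move[OF q, of "r k"] by linarith
qed

end

section \<open>A finite net of log-mixtures\<close>

context gaussian_location_model
begin

text \<open>Division by this constant turns the logarithms of finite mixtures into functions that satisfy
  the normalization of \<open>test_function\<close>.\<close>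

definition test_scale :: real where
  "test_scale = 1 + M / c\<^sup>2 + (M\<^sup>2 / c\<^sup>2 + 1) / c\<^sup>2"

lemma test_scale_pos: "0 < test_scale"
  unfolding test_scale_def using M_pos by (intro add_pos_nonneg) auto

lemma ln_le_of_le_exp:
  assumes "0 < a" "0 < b" "a \<le> exp B * b" shows "ln a - ln b \<le> (B::real)"
proof -
  have "ln a \<le> ln (exp B * b)" using assms by (intro ln_mono) auto
  also have "\<dots> = B + ln b" using assms by (simp add: ln_mult)
  finally show ?thesis by simp
qed

context
  fixes J :: "nat set" and a t :: "nat \<Rightarrow> real" and s :: real
  assumes fin: "finite J" "J \<noteq> {}" and a: "\<And>j. j \<in> J \<Longrightarrow> 0 < a j"
    and t: "\<And>j. j \<in> J \<Longrightarrow> \<bar>t j\<bar> \<le> M" and s: "c \<le> s"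
begin

private lemma s_pos: "0 < s" using s c_pos by simp

lemma finite_mixture_pos: "0 < (\<Sum>j\<in>J. a j * \<phi> s (x - t j))"
  using fin a kernel_pos[OF s_pos] by (intro sum_pos) auto

text \<open>The logarithm of a finite Gaussian mixture has second derivative
  \<open>(v / s\<^sup>2 - 1) / s\<^sup>2\<close>, where \<open>v\<close> is the posterior variance of the location,
  which lies between \<open>0\<close> and \<open>M\<^sup>2\<close>.\<close>

lemma test_function_ln_finite_mixture:
  "test_function (\<lambda>x. ln (\<Sum>j\<in>J. a j * \<phi> s (x - t j)) / test_scale)"
proof -
  note s_pos [simp]
  define S where "S i x = (\<Sum>j\<in>J. a j * t j ^ i * \<phi> s (x - t j))" for i x
  have S0: "S 0 x > 0" for x using finite_mixture_pos by (simp add: S_def)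
  have dS: "(S i has_real_derivative (S (Suc i) x - x * S i x) / s\<^sup>2) (at x)" for i x
  proof -
    have k: "((\<lambda>x. \<phi> s (x - t j)) has_real_derivative (t j - x) / s\<^sup>2 * \<phi> s (x - t j)) (at x)" for j
    proof -
      have "s \<noteq> 0" by (rule less_imp_neq[OF s_pos, symmetric])
      then have "((\<lambda>x. - (x - t j - 0)\<^sup>2 / (2 * s\<^sup>2)) has_real_derivative (t j - x) / s\<^sup>2) (at x)"
        by (auto intro!: derivative_eq_intros simp: field_simps)
      from DERIV_cmult[OF DERIV_fun_exp[OF this], of "1 / sqrt (2 * pi * s\<^sup>2)"]
      show ?thesis by (simp add: normal_density_def mult_ac)
    qed
    have "(S i has_real_derivative (\<Sum>j\<in>J. a j * t j ^ i * ((t j - x) / s\<^sup>2 * \<phi> s (x - t j)))) (at x)"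
      unfolding S_def by (intro DERIV_sum DERIV_cmult k)
    also have "(\<Sum>j\<in>J. a j * t j ^ i * ((t j - x) / s\<^sup>2 * \<phi> s (x - t j))) = (S (Suc i) x - x * S i x) / s\<^sup>2"
      unfolding S_def sum_distrib_left sum_subtractf[symmetric] sum_divide_distrib
      by (intro sum.cong) (auto simp: field_simps)
    finally show ?thesis .
  qed
  define f where "f x = ln (S 0 x) / test_scale" for x
  define f1 where "f1 x = (S 1 x / S 0 x - x) / s\<^sup>2 / test_scale" for x
  define f2 where "f2 x = ((S 2 x * S 0 x - (S 1 x)\<^sup>2) / (s\<^sup>2 * (S 0 x)\<^sup>2) - 1) / s\<^sup>2 / test_scale" for x
  have d1: "(f has_real_derivative f1 x) (at x)" for x
  proof -
    have "((\<lambda>x. ln (S 0 x)) has_real_derivative (S 1 x / S 0 x - x) / s\<^sup>2) (at x)"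
      using S0[of x] s_pos
      by (auto intro!: derivative_eq_intros dS simp: field_simps)
    then show ?thesis unfolding f_def f1_def by (rule DERIV_cdivide)
  qed
  have d2: "(f1 has_real_derivative f2 x) (at x)" for x
  proof -
    have q: "((\<lambda>x. S 1 x / S 0 x) has_real_derivative (S 2 x * S 0 x - (S 1 x)\<^sup>2) / (s\<^sup>2 * (S 0 x)\<^sup>2)) (at x)"
    proof -
      have "((\<lambda>x. S 1 x / S 0 x) has_real_derivative
         ((S 2 x - x * S 1 x) / s\<^sup>2 * S 0 x - S 1 x * ((S 1 x - x * S 0 x) / s\<^sup>2)) / (S 0 x * S 0 x)) (at x)"
        using dS[of 1 x] dS[of 0 x] S0[of x] by (intro DERIV_divide) (auto simp: numeral_2_eq_2)
      also have "((S 2 x - x * S 1 x) / s\<^sup>2 * S 0 x - S 1 x * ((S 1 x - x * S 0 x) / s\<^sup>2)) / (S 0 x * S 0 x)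
         = (S 2 x * S 0 x - (S 1 x)\<^sup>2) / (s\<^sup>2 * (S 0 x)\<^sup>2)"
      proof -
        have "(S 2 x - x * S 1 x) / s\<^sup>2 * S 0 x - S 1 x * ((S 1 x - x * S 0 x) / s\<^sup>2) = (S 2 x * S 0 x - (S 1 x)\<^sup>2) / s\<^sup>2"
          by (simp add: algebra_simps power2_eq_square diff_divide_distrib)
        then show ?thesis by (simp add: power2_eq_square)
      qed
      finally show ?thesis .
    qed
    show ?thesis unfolding f1_def f2_def
      by (intro DERIV_cdivide DERIV_diff q DERIV_ident)
  qed
  have e1: "deriv f = f1" using d1 by (auto intro!: DERIV_imp_deriv)
  have e2: "deriv f1 = f2" using d2 by (auto intro!: DERIV_imp_deriv)
  have b1: "\<bar>S 1 x\<bar> \<le> M * S 0 x" for x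
    unfolding S_def sum_distrib_left
  proof (rule order_trans[OF sum_abs], rule sum_mono)
    fix j assume j: "j \<in> J"
    have "\<bar>t j\<bar> * (a j * \<phi> s (x - t j)) \<le> M * (a j * \<phi> s (x - t j))"
      using a[OF j] t[OF j] by (intro mult_right_mono) auto
    then show "\<bar>a j * t j ^ 1 * \<phi> s (x - t j)\<bar> \<le> M * (a j * t j ^ 0 * \<phi> s (x - t j))"
      using a[OF j] by (simp add: abs_mult mult_ac)
  qed
  have b2: "0 \<le> S 2 x" "S 2 x \<le> M\<^sup>2 * S 0 x" for x
  proof -
    show "0 \<le> S 2 x" unfolding S_def using a by (intro sum_nonneg mult_nonneg_nonneg) (auto intro: less_imp_le)
    show "S 2 x \<le> M\<^sup>2 * S 0 x" unfolding S_def sum_distrib_left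
    proof (rule sum_mono)
      fix j assume j: "j \<in> J"
      have "(t j)\<^sup>2 \<le> M\<^sup>2" using power_mono[OF t[OF j], of 2] by simp
      then have "(t j)\<^sup>2 * (a j * \<phi> s (x - t j)) \<le> M\<^sup>2 * (a j * \<phi> s (x - t j))"
        using a[OF j] by (intro mult_right_mono) auto
      then show "a j * (t j)\<^sup>2 * \<phi> s (x - t j) \<le> M\<^sup>2 * (a j * t j ^ 0 * \<phi> s (x - t j))"
        by (simp add: mult_ac)
    qed
  qed
  have c2: "c\<^sup>2 \<le> s\<^sup>2" "0 < c\<^sup>2" using scale_sq_mono[OF s] c_pos by auto
  have B1: "\<bar>f1 0\<bar> \<le> 1"
  proof -
    have "\<bar>S 1 0 / S 0 0\<bar> \<le> M" using b1[of 0] S0[of 0] by (simp add: abs_divide divide_le_eq)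
    then have "\<bar>S 1 0 / S 0 0\<bar> / s\<^sup>2 \<le> M / c\<^sup>2" using c2 M_pos by (intro frac_le) auto
    also have "\<dots> \<le> test_scale" unfolding test_scale_def by (simp add: add_nonneg_nonneg)
    finally have le: "\<bar>S 1 0 / S 0 0\<bar> / s\<^sup>2 \<le> test_scale" .
    have "\<bar>f1 0\<bar> = \<bar>S 1 0 / S 0 0\<bar> / s\<^sup>2 / test_scale"
      using test_scale_pos by (simp add: f1_def abs_mult)
    also have "\<dots> \<le> 1" using le test_scale_pos by (simp only: pos_divide_le_eq mult_1_left)
    finally show ?thesis .
  qed
  have B2: "\<bar>f2 x\<bar> \<le> 1" for x
  proof -
    have "(S 1 x)\<^sup>2 \<le> (M * S 0 x)\<^sup>2" using power_mono[OF b1[of x], of 2] by simp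
    moreover have "S 2 x * S 0 x \<le> (M * S 0 x)\<^sup>2"
      using mult_right_mono[OF b2(2)[of x], of "S 0 x"] S0[of x] by (simp add: power2_eq_square mult_ac)
    moreover have "0 \<le> S 2 x * S 0 x" using b2(1)[of x] S0[of x] by simp
    moreover have "0 \<le> (S 1 x)\<^sup>2" by simp
    ultimately have "\<bar>S 2 x * S 0 x - (S 1 x)\<^sup>2\<bar> \<le> (M * S 0 x)\<^sup>2" by linarith
    then have "\<bar>S 2 x * S 0 x - (S 1 x)\<^sup>2\<bar> / (s\<^sup>2 * (S 0 x)\<^sup>2) \<le> M\<^sup>2 * (S 0 x)\<^sup>2 / (c\<^sup>2 * (S 0 x)\<^sup>2)"
      using c2 S0[of x] by (intro frac_le) (auto simp: power_mult_distrib)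
    also have "\<dots> = M\<^sup>2 / c\<^sup>2" using S0[of x] by simp
    finally have "\<bar>(S 2 x * S 0 x - (S 1 x)\<^sup>2) / (s\<^sup>2 * (S 0 x)\<^sup>2)\<bar> \<le> M\<^sup>2 / c\<^sup>2" by (simp add: abs_divide abs_mult)
    then have "\<bar>(S 2 x * S 0 x - (S 1 x)\<^sup>2) / (s\<^sup>2 * (S 0 x)\<^sup>2) - 1\<bar> \<le> M\<^sup>2 / c\<^sup>2 + 1" by linarith
    then have "\<bar>(S 2 x * S 0 x - (S 1 x)\<^sup>2) / (s\<^sup>2 * (S 0 x)\<^sup>2) - 1\<bar> / s\<^sup>2 \<le> (M\<^sup>2 / c\<^sup>2 + 1) / c\<^sup>2"
      using c2 by (intro frac_le) auto
    also have "\<dots> \<le> test_scale" unfolding test_scale_def using M_pos by simp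
    finally have le: "\<bar>(S 2 x * S 0 x - (S 1 x)\<^sup>2) / (s\<^sup>2 * (S 0 x)\<^sup>2) - 1\<bar> / s\<^sup>2 \<le> test_scale" .
    have "\<bar>f2 x\<bar> = \<bar>(S 2 x * S 0 x - (S 1 x)\<^sup>2) / (s\<^sup>2 * (S 0 x)\<^sup>2) - 1\<bar> / s\<^sup>2 / test_scale"
      using test_scale_pos unfolding f2_def abs_divide by simp
    also have "\<dots> \<le> 1" using le test_scale_pos by (simp only: pos_divide_le_eq mult_1_left)
    finally show ?thesis .
  qed
  have "test_function f"
    unfolding test_function_def e1 e2 using B1 B2 d1 d2 by (auto simp: real_differentiable_def)
  then show ?thesis by (simp add: f_def[abs_def] S_def)
qed

lemma quadratic_growth_ln_finite_mixture:
  "quadratic_growth log_growth (\<lambda>x. ln (\<Sum>j\<in>J. a j * \<phi> s (x - t j)))"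
proof -
  let ?F = "\<lambda>x. \<Sum>j\<in>J. a j * \<phi> s (x - t j)"
  have le: "ln (?F x) - ln (?F y) \<le> log_growth * \<bar>x - y\<bar> * (1 + \<bar>x\<bar> + \<bar>y\<bar>)" for x y
  proof -
    let ?B = "\<bar>x - y\<bar> * (\<bar>x\<bar> + \<bar>y\<bar> + 2 * M) / (2 * c\<^sup>2)"
    have "?F x \<le> exp ?B * ?F y" unfolding sum_distrib_left
    proof (rule sum_mono)
      fix j assume j: "j \<in> J"
      show "a j * \<phi> s (x - t j) \<le> exp ?B * (a j * \<phi> s (y - t j))"
        using mult_left_mono[OF kernel_shift_argument[OF s t[OF j], of x y], of "a j"] a[OF j]
        by (simp add: mult_ac)
    qed
    then have "ln (?F x) - ln (?F y) \<le> ?B"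
      using finite_mixture_pos by (intro ln_le_of_le_exp) auto
    also have "\<dots> \<le> \<bar>x - y\<bar> * ((1 + 2 * M) * (1 + \<bar>x\<bar> + \<bar>y\<bar>)) / (2 * c\<^sup>2)"
      using M_pos by (intro divide_right_mono mult_left_mono) (auto simp: algebra_simps)
    finally show ?thesis by (simp add: log_growth_def mult_ac)
  qed
  show ?thesis unfolding quadratic_growth_def
  proof (intro allI)
    fix x y
    show "\<bar>ln (?F x) - ln (?F y)\<bar> \<le> log_growth * \<bar>x - y\<bar> * (1 + \<bar>x\<bar> + \<bar>y\<bar>)"
      using le[of x y] le[of y x] by (simp add: abs_le_iff abs_minus_commute add_ac)
  qed
qed

end

definition grid :: "nat \<Rightarrow> nat \<Rightarrow> real" where
  "grid k j = - M + real j * (2 * M / real k)"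

definition grid_mixture :: "nat \<Rightarrow> nat \<Rightarrow> (nat \<Rightarrow> nat) \<Rightarrow> real \<Rightarrow> real \<Rightarrow> real" where
  "grid_mixture k N m s x = (\<Sum>j\<le>k. real (m j) / real N * \<phi> s (x - grid k j))"

lemma grid_bounded: "0 < k \<Longrightarrow> j \<le> k \<Longrightarrow> \<bar>grid k j\<bar> \<le> M"
proof -
  assume k: "0 < k" "j \<le> k"
  have "real j * (2 * M / real k) \<le> real k * (2 * M / real k)" using k M_pos by (intro mult_right_mono) auto
  also have "\<dots> = 2 * M" using k by simp
  finally show ?thesis using M_pos unfolding grid_def by (simp add: abs_le_iff)
qed

text \<open>Moving the atoms by at most \<open>2 M / k\<close> changes the density by a factor close to one on bounded sets.
  Rounding weights up only increases the mixture, and the excess \<open>1 / N\<close> per grid point is compared with the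
  original mixture through the crude bound for two arbitrary locations in \<open>[-M, M]\<close>; this is why
  the exponential in the upper bound carries the factor \<open>(k + 1) / N\<close> but no small exponent.\<close>

lemma grid_mixture_approximates:
  assumes p: "p \<in> priors" and k: "0 < k" and N: "0 < N"
  obtains m where "m \<in> {..k} \<rightarrow>\<^sub>E {1..N + 1}"
    and "\<And>s x. c \<le> s \<Longrightarrow> ln (mixture_density p s x) - ln (grid_mixture k N m s x) \<le> 2 * M / real k * (\<bar>x\<bar> + M) / c\<^sup>2"
    and "\<And>s x. c \<le> s \<Longrightarrow> ln (grid_mixture k N m s x) - ln (mixture_density p s x)
       \<le> 2 * M / real k * (\<bar>x\<bar> + M) / c\<^sup>2 + ln (1 + (real k + 1) / real N * exp (2 * M * (\<bar>x\<bar> + M) / c\<^sup>2))"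
proof -
  interpret prob_space p using priorD(1)[OF p] .
  have [measurable_cong]: "sets p = sets borel" using priorD(2)[OF p] .
  have [simp]: "space p = UNIV" using priorD(3)[OF p] .
  define h where "h = 2 * M / real k"
  have h: "0 < h" "h * real k = 2 * M" using k M_pos by (auto simp: h_def)
  \<comment> \<open>the index of the grid point below \<open>t\<close>; clipping keeps it in range off the support of \<open>p\<close>\<close>
  define J where "J t = nat \<lfloor>(clip M t + M) / h\<rfloor>" for t
  have clipM: "\<bar>clip M t\<bar> \<le> M" for t using M_pos by (intro clip_bounds) auto
  have Jk: "J t \<le> k" for t
  proof -
    have "(clip M t + M) / h \<le> real k" using clipM[of t] h by (simp add: divide_le_eq mult.commute abs_le_iff)
    then show ?thesis unfolding J_def by linarith
  qed
  have Jd: "\<bar>t - grid k (J t)\<bar> \<le> h" if "\<bar>t\<bar> \<le> M" for t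
  proof -
    have ct: "clip M t = t" using that by (rule clip_id)
    let ?y = "(t + M) / h"
    have y: "0 \<le> ?y" using that h by (auto simp: abs_le_iff)
    have J: "real (J t) \<le> ?y" "?y \<le> real (J t) + 1" unfolding J_def ct using y by linarith+
    have "real (J t) * h \<le> t + M" using J(1) h by (simp add: le_divide_eq)
    moreover have "t + M \<le> (real (J t) + 1) * h" using J(2) unfolding pos_divide_le_eq[OF h(1)] .
    moreover have "grid k (J t) = - M + real (J t) * h" by (simp add: grid_def h_def)
    ultimately show ?thesis by (simp add: abs_le_iff algebra_simps)
  qed
  have [measurable]: "clip M \<in> borel_measurable borel" by (intro borel_measurable_continuous_onI clip_continuous)
  have [measurable]: "J \<in> measurable borel (count_space UNIV)" unfolding J_def[abs_def] by measurable
  define w where "w j = prob {t. J t = j}" for j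
  \<comment> \<open>rounding up strictly, so that also grid cells without mass get a positive weight\<close>
  define m where "m = (\<lambda>j\<in>{..k}. nat \<lfloor>real N * w j\<rfloor> + 1)"
  have w: "0 \<le> w j" "w j \<le> 1" for j by (auto simp: w_def)
  have mw: "w j \<le> real (m j) / real N" "real (m j) / real N \<le> w j + 1 / real N" "m j \<in> {1..N + 1}" if j: "j \<le> k" for j
  proof -
    have nn: "0 \<le> real N * w j" "real N * w j \<le> real N" using w[of j] by (auto intro: mult_left_le)
    have mj: "m j = nat \<lfloor>real N * w j\<rfloor> + 1" using j by (simp add: m_def)
    have "real N * w j \<le> real (m j)" unfolding mj using nn by linarith
    moreover have "real (m j) \<le> real N * w j + 1" unfolding mj using nn by linarith
    ultimately show "w j \<le> real (m j) / real N" "real (m j) / real N \<le> w j + 1 / real N"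
      using N by (auto simp: field_simps)
    show "m j \<in> {1..N + 1}" unfolding mj using nn by (simp; linarith)
  qed
  have mE: "m \<in> {..k} \<rightarrow>\<^sub>E {1..N + 1}" using mw(3) by (auto simp: m_def PiE_iff extensional_def)
  have m0: "0 < real (m j) / real N" if "j \<le> k" for j using mw(3)[OF that] N by simp
  have grid_int: "integrable p (\<lambda>t. \<phi> s (x - grid k (J t)))"
    and grid_sum: "(\<integral>t. \<phi> s (x - grid k (J t)) \<partial>p) = (\<Sum>j\<le>k. w j * \<phi> s (x - grid k j))" for s x
  proof -
    have eq: "\<phi> s (x - grid k (J t)) = (\<Sum>j\<le>k. indicator {t. J t = j} t * \<phi> s (x - grid k j))" for t
    proof -
      have "(\<Sum>j\<le>k. indicator {t. J t = j} t * \<phi> s (x - grid k j))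
         = (\<Sum>j\<le>k. if j = J t then \<phi> s (x - grid k j) else 0)"
        by (intro sum.cong) (auto simp: indicator_def)
      then show ?thesis using Jk[of t] by simp
    qed
    show "integrable p (\<lambda>t. \<phi> s (x - grid k (J t)))"
      unfolding eq by (intro Bochner_Integration.integrable_sum integrable_mult_left) (auto simp: integrable_indicator_iff emeasure_eq_measure)
    show "(\<integral>t. \<phi> s (x - grid k (J t)) \<partial>p) = (\<Sum>j\<le>k. w j * \<phi> s (x - grid k j))"
      unfolding eq by (subst Bochner_Integration.integral_sum) (auto simp: integrable_indicator_iff emeasure_eq_measure w_def)
  qed
  show thesis
  proof (rule that[OF mE])
    fix s x assume s: "c \<le> s"
    let ?f = "mixture_density p s x" and ?F = "grid_mixture k N m s x"
    let ?b = "2 * M / real k * (\<bar>x\<bar> + M) / c\<^sup>2" and ?K = "2 * M * (\<bar>x\<bar> + M) / c\<^sup>2"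
    have f: "?f > 0" by (rule mixture_density_pos[OF p s])
    have F: "?F > 0" unfolding grid_mixture_def
      by (rule finite_mixture_pos) (use m0 grid_bounded[OF k] s in auto)
    have near: "\<phi> s (x - t) \<le> exp ?b * \<phi> s (x - grid k (J t))"
         "\<phi> s (x - grid k (J t)) \<le> exp ?b * \<phi> s (x - t)" if t: "\<bar>t\<bar> \<le> M" for t
    proof -
      have g: "\<bar>grid k (J t)\<bar> \<le> M" by (rule grid_bounded[OF k Jk])
      have "\<bar>t - grid k (J t)\<bar> * (\<bar>x\<bar> + M) / c\<^sup>2 \<le> ?b"
        using Jd[OF t] M_pos unfolding h_def by (intro divide_right_mono mult_right_mono) auto
      then have e: "exp (\<bar>t - grid k (J t)\<bar> * (\<bar>x\<bar> + M) / c\<^sup>2) \<le> exp ?b" by simp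
      show "\<phi> s (x - t) \<le> exp ?b * \<phi> s (x - grid k (J t))"
        using kernel_shift_location[OF s t g, of x] mult_right_mono[OF e normal_density_nonneg] by (rule order_trans)
      show "\<phi> s (x - grid k (J t)) \<le> exp ?b * \<phi> s (x - t)"
        using kernel_shift_location[OF s g t, of x] mult_right_mono[OF e normal_density_nonneg]
        unfolding abs_minus_commute[of "grid k (J t)"] by (rule order_trans)
    qed
    have "?f \<le> (\<integral>t. exp ?b * \<phi> s (x - grid k (J t)) \<partial>p)"
      unfolding mixture_density_def using priorD(4)[OF p] near(1)
      by (intro integral_mono_AE kernel_integrable p s integrable_mult_right grid_int) auto
    also have "\<dots> = exp ?b * (\<Sum>j\<le>k. w j * \<phi> s (x - grid k j))" using grid_sum by simp
    also have "\<dots> \<le> exp ?b * ?F"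
      unfolding grid_mixture_def using mw(1) by (intro mult_left_mono sum_mono mult_right_mono) auto
    finally show "ln ?f - ln ?F \<le> ?b" using f F by (intro ln_le_of_le_exp)
    have far: "\<phi> s (x - grid k j) \<le> exp ?K * ?f" if j: "j \<le> k" for j
    proof -
      have g: "\<bar>grid k j\<bar> \<le> M" by (rule grid_bounded[OF k j])
      have pt: "\<phi> s (x - grid k j) \<le> exp ?K * \<phi> s (x - t)" if t: "\<bar>t\<bar> \<le> M" for t
      proof -
        have "\<bar>grid k j - t\<bar> \<le> 2 * M" using g t by linarith
        then have "\<bar>grid k j - t\<bar> * (\<bar>x\<bar> + M) / c\<^sup>2 \<le> ?K"
          using M_pos by (intro divide_right_mono mult_right_mono) auto
        then have e: "exp (\<bar>grid k j - t\<bar> * (\<bar>x\<bar> + M) / c\<^sup>2) \<le> exp ?K" by simp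
        show ?thesis
          using kernel_shift_location[OF s g t, of x] mult_right_mono[OF e normal_density_nonneg] by (rule order_trans)
      qed
      have "(\<integral>t. \<phi> s (x - grid k j) \<partial>p) \<le> (\<integral>t. exp ?K * \<phi> s (x - t) \<partial>p)"
        using priorD(4)[OF p] pt
        by (intro integral_mono_AE kernel_integrable p s integrable_mult_right) auto
      then show ?thesis by (simp add: mixture_density_def prob_space[simplified])
    qed
    have "?F \<le> (\<Sum>j\<le>k. (w j + 1 / real N) * \<phi> s (x - grid k j))"
      unfolding grid_mixture_def using mw(2) by (intro sum_mono mult_right_mono) auto
    also have "\<dots> = (\<integral>t. \<phi> s (x - grid k (J t)) \<partial>p) + (\<Sum>j\<le>k. 1 / real N * \<phi> s (x - grid k j))"
      by (simp add: grid_sum distrib_right sum.distrib)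
    also have "\<dots> \<le> exp ?b * ?f + (\<Sum>j\<le>k. 1 / real N * (exp ?K * ?f))"
    proof (rule add_mono)
      have "(\<integral>t. \<phi> s (x - grid k (J t)) \<partial>p) \<le> (\<integral>t. exp ?b * \<phi> s (x - t) \<partial>p)"
        using priorD(4)[OF p] near(2)
        by (intro integral_mono_AE kernel_integrable p s integrable_mult_right grid_int) auto
      then show "(\<integral>t. \<phi> s (x - grid k (J t)) \<partial>p) \<le> exp ?b * ?f" by (simp add: mixture_density_def)
    qed (intro sum_mono mult_left_mono far, auto)
    also have "\<dots> = (exp ?b + (real k + 1) / real N * exp ?K) * ?f"
      by (simp add: algebra_simps add_divide_distrib)
    also have "\<dots> \<le> (exp ?b * (1 + (real k + 1) / real N * exp ?K)) * ?f"
    proof (rule mult_right_mono)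
      have "1 * ((real k + 1) / real N * exp ?K) \<le> exp ?b * ((real k + 1) / real N * exp ?K)"
        using M_pos k by (intro mult_right_mono) auto
      then show "exp ?b + (real k + 1) / real N * exp ?K \<le> exp ?b * (1 + (real k + 1) / real N * exp ?K)"
        by (simp only: distrib_left mult_1_left mult_1_right)
    qed (use f in simp)
    also have "\<dots> = exp (?b + ln (1 + (real k + 1) / real N * exp ?K)) * ?f"
      by (subst exp_add, subst exp_ln) (auto intro: add_pos_nonneg)
    finally show "ln ?F - ln ?f \<le> ?b + ln (1 + (real k + 1) / real N * exp ?K)"
      using f F by (intro ln_le_of_le_exp)
  qed
qed

definition net_tail_const :: real where
  "net_tail_const = 1 + 4 * M * (1 + M) / c\<^sup>2"

text \<open>First \<open>k\<close> and then \<open>N\<close> are chosen large for the given \<open>e\<close> and \<open>T\<close>. Outside \<open>[-T, T]\<close> the estimates are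
  only of order \<open>1 + \<bar>x\<bar>\<close>, but uniformly in \<open>k\<close> and in \<open>N \<ge> k + 1\<close>; hence the factor of the tail is the same for
  every accuracy.\<close>

lemma log_mixture_net:
  assumes e: "e > 0" and T: "T \<ge> 1"
  obtains G :: "(real \<Rightarrow> real \<Rightarrow> real) set" where "finite G"
    and "\<And>g s. g \<in> G \<Longrightarrow> c \<le> s \<Longrightarrow> test_function (\<lambda>x. g s x / test_scale)"
    and "\<And>g s. g \<in> G \<Longrightarrow> c \<le> s \<Longrightarrow> quadratic_growth log_growth (g s)"
    and "\<And>p. p \<in> priors \<Longrightarrow> \<exists>g\<in>G. \<forall>s\<ge>c. \<forall>x. \<bar>g s x - ln (mixture_density p s x)\<bar> \<le> e + net_tail_const * sq_tail T x"
proof -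
  obtain k0 :: nat where k0: "4 * M * (T + M) / (c\<^sup>2 * e) \<le> real k0" using real_arch_simple by blast
  define k where "k = Suc k0"
  have k: "0 < k" and kb: "4 * M * (T + M) / (c\<^sup>2 * e) \<le> real k" using k0 by (auto simp: k_def)
  define E where "E = exp (2 * M * (T + M) / c\<^sup>2)"
  obtain N0 :: nat where N0: "(real k + 1) * (1 + 2 * E / e) \<le> real N0" using real_arch_simple by blast
  define N where "N = Suc N0"
  have N: "0 < N" and Nb: "(real k + 1) * (1 + 2 * E / e) \<le> real N" using N0 by (auto simp: N_def)
  have E: "E > 0" by (simp add: E_def)
  define r where "r = (real k + 1) / real N"
  have r0: "0 < r" using N by (simp add: r_def)
  have rb: "r * (1 + 2 * E / e) \<le> 1" using Nb N by (simp add: r_def divide_le_eq)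
  have r1: "r \<le> 1"
  proof -
    have "r * 1 \<le> r * (1 + 2 * E / e)" using r0 E e by (intro mult_left_mono) auto
    then show ?thesis using rb by simp
  qed
  have rE: "r * E \<le> e / 2"
  proof -
    have "r * (2 * E / e) \<le> 1" using rb r0 by (simp add: distrib_left)
    then show ?thesis using e by (simp add: field_simps)
  qed
  define G where "G = (\<lambda>m s x. ln (grid_mixture k N m s x)) ` ({..k} \<rightarrow>\<^sub>E {1..N + 1})"
  have pos: "0 < real (m j) / real N" if "m \<in> {..k} \<rightarrow>\<^sub>E {1..N + 1}" "j \<in> {..k}" for m j
  proof -
    have "m j \<in> {1..N+1}" using that by (auto simp: PiE_iff)
    then show ?thesis using N by simp
  qed
  show thesis
  proof (rule that)
    show "finite G" unfolding G_def by (intro finite_imageI finite_PiE) auto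
    fix g s assume g: "g \<in> G" and s: "c \<le> s"
    then obtain m where m: "m \<in> {..k} \<rightarrow>\<^sub>E {1..N + 1}" and geq: "g = (\<lambda>s x. ln (grid_mixture k N m s x))"
      by (auto simp: G_def)
    show "test_function (\<lambda>x. g s x / test_scale)" unfolding geq grid_mixture_def
      by (rule test_function_ln_finite_mixture) (use pos[OF m] grid_bounded[OF k] s in auto)
    show "quadratic_growth log_growth (g s)" unfolding geq grid_mixture_def
      by (rule quadratic_growth_ln_finite_mixture) (use pos[OF m] grid_bounded[OF k] s in auto)
  next
    fix p assume p: "p \<in> priors"
    obtain m where m: "m \<in> {..k} \<rightarrow>\<^sub>E {1..N + 1}"
      and lo: "\<And>s x. c \<le> s \<Longrightarrow> ln (mixture_density p s x) - ln (grid_mixture k N m s x) \<le> 2 * M / real k * (\<bar>x\<bar> + M) / c\<^sup>2"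
      and up: "\<And>s x. c \<le> s \<Longrightarrow> ln (grid_mixture k N m s x) - ln (mixture_density p s x)
       \<le> 2 * M / real k * (\<bar>x\<bar> + M) / c\<^sup>2 + ln (1 + r * exp (2 * M * (\<bar>x\<bar> + M) / c\<^sup>2))"
      using grid_mixture_approximates[OF p k N] unfolding r_def by blast
    show "\<exists>g\<in>G. \<forall>s\<ge>c. \<forall>x. \<bar>g s x - ln (mixture_density p s x)\<bar> \<le> e + net_tail_const * sq_tail T x"
    proof (rule bexI[of _ "\<lambda>s x. ln (grid_mixture k N m s x)"], intro allI impI)
      show "(\<lambda>s x. ln (grid_mixture k N m s x)) \<in> G" using m by (auto simp: G_def)
      fix s x assume s: "c \<le> s"
      let ?K = "2 * M * (\<bar>x\<bar> + M) / c\<^sup>2"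
      let ?b = "2 * M / real k * (\<bar>x\<bar> + M) / c\<^sup>2" and ?l = "ln (1 + r * exp ?K)"
      have l0: "0 \<le> ?l" using r0 by (intro ln_ge_zero) auto
      have abs: "\<bar>ln (grid_mixture k N m s x) - ln (mixture_density p s x)\<bar> \<le> ?b + ?l"
        using lo[OF s, of x] up[OF s, of x] l0 by linarith
      have tc: "0 \<le> net_tail_const" unfolding net_tail_const_def using M_pos by auto
      show "\<bar>ln (grid_mixture k N m s x) - ln (mixture_density p s x)\<bar> \<le> e + net_tail_const * sq_tail T x"
      proof (cases "T \<le> \<bar>x\<bar>")
        case False
        have "?b \<le> 2 * M / real k * (T + M) / c\<^sup>2"
          using False M_pos by (intro divide_right_mono mult_left_mono) auto
        also have "\<dots> \<le> e / 2"
        proof -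
          have "4 * M * (T + M) \<le> real k * (c\<^sup>2 * e)" using kb c_pos e by (simp add: pos_divide_le_eq)
          then show ?thesis using k c_pos by (simp add: field_simps)
        qed
        finally have b: "?b \<le> e / 2" .
        have "?l \<le> r * exp ?K" using r0 by (intro ln_add_one_self_le_self) auto
        also have "\<dots> \<le> r * E" unfolding E_def using r0 False M_pos
          by (intro mult_left_mono) (auto intro!: divide_right_mono mult_left_mono)
        also note rE
        finally have "?b + ?l \<le> e" using b by simp
        then show ?thesis using abs mult_nonneg_nonneg[OF tc sq_tail_nonneg[of T x]] by linarith
      next
        case True
        then have x1: "1 \<le> \<bar>x\<bar>" using T by linarith
        have K0: "0 \<le> ?K" using M_pos by auto
        have "?b \<le> ?K" using k M_pos by (intro divide_right_mono mult_right_mono) (auto simp: divide_le_eq)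
        moreover have "?l \<le> 1 + ?K"
        proof -
          have "1 + r * exp ?K \<le> 1 + 1 * exp ?K" using r1 by (intro add_left_mono mult_right_mono) auto
          also have "\<dots> \<le> 2 * exp ?K" using K0 by simp
          also have "\<dots> \<le> exp 1 * exp ?K" using exp_ge_add_one_self[of 1] by (intro mult_right_mono) auto
          finally have "ln (1 + r * exp ?K) \<le> ln (exp (1 + ?K))"
            using r0 by (intro ln_mono) (auto simp: exp_add intro: add_pos_pos)
          then show ?thesis by simp
        qed
        moreover have "1 + 2 * ?K \<le> net_tail_const * x\<^sup>2"
        proof -
          have x2: "1 \<le> x\<^sup>2" using power_mono[OF x1, of 2] by simp
          have "\<bar>x\<bar> \<le> x\<^sup>2" using mult_left_mono[OF x1, of "\<bar>x\<bar>"] by (simp add: power2_eq_square)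
          moreover have "M \<le> M * x\<^sup>2" using M_pos x2 by simp
          ultimately have "\<bar>x\<bar> + M \<le> (1 + M) * x\<^sup>2" by (simp add: algebra_simps)
          then have "4 * M / c\<^sup>2 * (\<bar>x\<bar> + M) \<le> 4 * M / c\<^sup>2 * ((1 + M) * x\<^sup>2)"
            using M_pos by (intro mult_left_mono) auto
          then have "1 + 4 * M / c\<^sup>2 * (\<bar>x\<bar> + M) \<le> x\<^sup>2 + 4 * M / c\<^sup>2 * ((1 + M) * x\<^sup>2)" using x2 by simp
          then show ?thesis by (simp add: net_tail_const_def algebra_simps add_divide_distrib)
        qed
        ultimately show ?thesis using abs e True by (simp add: sq_tail_def)
      qed
    qed
  qed
qed

end

section \<open>Averages, and events of high probability\<close>

definition avg :: "nat \<Rightarrow> (nat \<Rightarrow> real) \<Rightarrow> real" where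
  "avg n f = 1 / real n * (\<Sum>i=1..n. f i)"

lemma avg_mono: "(\<And>i. i \<in> {1..n} \<Longrightarrow> f i \<le> g i) \<Longrightarrow> avg n f \<le> avg n g"
  unfolding avg_def by (intro mult_left_mono sum_mono) auto

lemma avg_add: "avg n (\<lambda>i. f i + g i) = avg n f + avg n g"
  and avg_diff: "avg n (\<lambda>i. f i - g i) = avg n f - avg n g"
  and avg_cmult: "avg n (\<lambda>i. k * f i) = k * avg n f"
  by (simp_all add: avg_def sum.distrib sum_subtractf sum_distrib_left algebra_simps)

lemma avg_const_le: "0 \<le> k \<Longrightarrow> avg n (\<lambda>_. k) \<le> k"
  by (cases "n = 0") (auto simp: avg_def)

lemma avg_abs: "\<bar>avg n f\<bar> \<le> avg n (\<lambda>i. \<bar>f i\<bar>)"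
  unfolding avg_def abs_mult by (intro mult_mono sum_abs) auto

lemma avg_nonneg: "(\<And>i. i \<in> {1..n} \<Longrightarrow> 0 \<le> f i) \<Longrightarrow> 0 \<le> avg n f"
  unfolding avg_def by (intro mult_nonneg_nonneg sum_nonneg) auto

lemma avg_ge_min:
  assumes "0 < n"
  obtains i where "i \<in> {1..n}" "f i \<le> avg n f"
proof (rule ccontr)
  assume neg: "\<not> thesis"
  note entry = that
  have "avg n f < f i" if i: "i \<in> {1..n}" for i using entry[OF i] neg by (cases "f i \<le> avg n f") auto
  then have "(\<Sum>i=1..n. avg n f) < (\<Sum>i=1..n. f i)" using assms by (intro sum_strict_mono) auto
  then show False using assms by (simp add: avg_def)
qed

lemma ennreal_avg:
  assumes "\<And>i. i \<in> {1..n} \<Longrightarrow> 0 \<le> f i"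
  shows "ennreal (avg n f) = ennreal (1 / real n) * (\<Sum>i=1..n. ennreal (f i))"
proof -
  have "ennreal (avg n f) = ennreal (1 / real n) * ennreal (\<Sum>i=1..n. f i)"
    unfolding avg_def by (rule ennreal_mult) (use assms in \<open>auto intro: sum_nonneg\<close>)
  then show ?thesis using assms by (subst sum_ennreal) auto
qed

lemma integral_avg:
  "(\<And>i. i \<in> {1..n} \<Longrightarrow> integrable M (f i)) \<Longrightarrow> (\<integral>\<omega>. avg n (\<lambda>i. f i \<omega>) \<partial>M) = avg n (\<lambda>i. \<integral>\<omega>. f i \<omega> \<partial>M)"
  unfolding avg_def by (simp only: integral_mult_right_zero) (subst Bochner_Integration.integral_sum; simp)

lemma integrable_avg:
  "(\<And>i. i \<in> {1..n} \<Longrightarrow> integrable M (f i)) \<Longrightarrow> integrable M (\<lambda>\<omega>. avg n (\<lambda>i. f i \<omega>))"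
  unfolding avg_def by (intro integrable_mult_right Bochner_Integration.integrable_sum) auto

lemma avg_measurable [measurable (raw)]:
  "(\<And>i. i \<in> {1..n} \<Longrightarrow> f i \<in> borel_measurable M) \<Longrightarrow> (\<lambda>\<omega>. avg n (\<lambda>i. f i \<omega>)) \<in> borel_measurable M"
  unfolding avg_def by (intro borel_measurable_times borel_measurable_sum) auto

text \<open>Only the exceptional event has to be measurable. The property \<open>\<Phi>\<close> may involve a supremum over
  all priors, whose measurability is thereby avoided.\<close>

definition except_prob :: "(nat \<Rightarrow> 'a measure) \<Rightarrow> real \<Rightarrow> (nat \<Rightarrow> 'a \<Rightarrow> bool) \<Rightarrow> bool" where
  "except_prob P d \<Phi> \<longleftrightarrow> (\<forall>\<^sub>F n in sequentially. \<exists>B\<in>sets (P n). measure (P n) B \<le> d \<and>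
     (AE \<omega> in P n. \<omega> \<notin> B \<longrightarrow> \<Phi> n \<omega>))"

lemma except_prob_mono:
  assumes "except_prob P d \<Phi>" and "\<forall>\<^sub>F n in sequentially. \<forall>\<omega>. \<Phi> n \<omega> \<longrightarrow> \<Psi> n \<omega>"
  shows "except_prob P d \<Psi>"
  using assms unfolding except_prob_def
proof eventually_elim
  case (elim n)
  then obtain B where B: "B \<in> sets (P n)" "measure (P n) B \<le> d" "AE \<omega> in P n. \<omega> \<notin> B \<longrightarrow> \<Phi> n \<omega>" by blast
  from B(3) have "AE \<omega> in P n. \<omega> \<notin> B \<longrightarrow> \<Psi> n \<omega>" by eventually_elim (use elim(2) in blast)
  then show ?case using B by blast
qed

lemma except_prob_eventually_mono:
  assumes "except_prob P d \<Phi>" and "\<forall>\<^sub>F n in sequentially. R n"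
    and imp: "\<And>n \<omega>. R n \<Longrightarrow> \<Phi> n \<omega> \<Longrightarrow> \<Psi> n \<omega>"
  shows "except_prob P d \<Psi>"
  using assms(1)
proof (rule except_prob_mono)
  show "\<forall>\<^sub>F n in sequentially. \<forall>\<omega>. \<Phi> n \<omega> \<longrightarrow> \<Psi> n \<omega>"
    using assms(2) by eventually_elim (use imp in blast)
qed

lemma except_prob_AE:
  assumes "\<And>n. AE \<omega> in P n. \<Phi> n \<omega>" and "0 \<le> d"
  shows "except_prob P d \<Phi>"
  unfolding except_prob_def using assms by (intro always_eventually allI bexI[of _ "{}"]) auto

lemma except_prob_conj:
  assumes "\<And>n. prob_space (P n)" "except_prob P d \<Phi>" "except_prob P d' \<Psi>"
  shows "except_prob P (d + d') (\<lambda>n \<omega>. \<Phi> n \<omega> \<and> \<Psi> n \<omega>)"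
  using assms(2,3) unfolding except_prob_def
proof eventually_elim
  case (elim n)
  then obtain A B where A: "A \<in> sets (P n)" "measure (P n) A \<le> d" "AE \<omega> in P n. \<omega> \<notin> A \<longrightarrow> \<Phi> n \<omega>"
    and B: "B \<in> sets (P n)" "measure (P n) B \<le> d'" "AE \<omega> in P n. \<omega> \<notin> B \<longrightarrow> \<Psi> n \<omega>" by blast
  interpret prob_space "P n" by fact
  show ?case
  proof (intro bexI[of _ "A \<union> B"] conjI)
    show "prob (A \<union> B) \<le> d + d'" using measure_Un_le[OF A(1) B(1)] A(2) B(2) by simp
    show "AE \<omega> in P n. \<omega> \<notin> A \<union> B \<longrightarrow> \<Phi> n \<omega> \<and> \<Psi> n \<omega>" using A(3) B(3) by eventually_elim auto
  qed (use A B in auto)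
qed

lemma except_prob_finite:
  assumes P: "\<And>n. prob_space (P n)" and "finite G"
    and "\<And>g d. g \<in> G \<Longrightarrow> 0 < d \<Longrightarrow> except_prob P d (\<Phi> g)" and "0 < d"
  shows "except_prob P d (\<lambda>n \<omega>. \<forall>g\<in>G. \<Phi> g n \<omega>)"
  using assms(2,3,4)
proof (induction arbitrary: d)
  case empty
  then show ?case by (intro except_prob_AE) auto
next
  case (insert g G)
  have "except_prob P (d / 2) (\<Phi> g)" "except_prob P (d / 2) (\<lambda>n \<omega>. \<forall>g\<in>G. \<Phi> g n \<omega>)"
    using insert by auto
  from except_prob_conj[OF P this] show ?case by simp
qed

lemma except_prob_of_converges:
  assumes "converges_in_prob P Y l" and [measurable]: "\<And>n. Y n \<in> borel_measurable (P n)"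
    and e: "0 < e" and d: "0 < d"
  shows "except_prob P d (\<lambda>n \<omega>. \<bar>Y n \<omega> - l\<bar> \<le> e)"
proof -
  have "(\<lambda>n. measure (P n) {\<omega> \<in> space (P n). \<bar>Y n \<omega> - l\<bar> > e}) \<longlonglongrightarrow> 0"
    using assms(1) e by (simp add: converges_in_prob_def)
  from order_tendstoD(2)[OF this d] show ?thesis unfolding except_prob_def
  proof eventually_elim
    case (elim n)
    show ?case
      by (rule bexI[of _ "{\<omega> \<in> space (P n). \<bar>Y n \<omega> - l\<bar> > e}"]) (use elim in \<open>auto intro!: AE_I2\<close>)
  qed
qed

lemma converges_of_except_prob:
  assumes P: "\<And>n. prob_space (P n)"
    and "\<And>e d. 0 < e \<Longrightarrow> 0 < d \<Longrightarrow> except_prob P d (\<lambda>n \<omega>. \<bar>Y n \<omega> - l\<bar> \<le> e)"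
  shows "converges_in_prob P Y l"
  unfolding converges_in_prob_def
proof (intro allI impI)
  fix e :: real assume e: "0 < e"
  show "(\<lambda>n. measure (P n) {\<omega> \<in> space (P n). \<bar>Y n \<omega> - l\<bar> > e}) \<longlonglongrightarrow> 0"
  proof (rule LIMSEQ_I)
    fix r :: real assume r: "0 < r"
    have "except_prob P (r / 2) (\<lambda>n \<omega>. \<bar>Y n \<omega> - l\<bar> \<le> e)" using assms(2) e r by simp
    then have "\<forall>\<^sub>F n in sequentially. norm (measure (P n) {\<omega> \<in> space (P n). \<bar>Y n \<omega> - l\<bar> > e} - 0) < r"
      unfolding except_prob_def
    proof eventually_elim
      case (elim n)
      then obtain B where B: "B \<in> sets (P n)" "measure (P n) B \<le> r / 2"
        "AE \<omega> in P n. \<omega> \<notin> B \<longrightarrow> \<bar>Y n \<omega> - l\<bar> \<le> e" by blast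
      interpret prob_space "P n" by fact
      have "prob {\<omega> \<in> space (P n). \<bar>Y n \<omega> - l\<bar> > e} \<le> prob B"
        by (rule finite_measure_mono_AE) (use B in auto)
      then show ?case using B r by simp
    qed
    then show "\<exists>no. \<forall>n\<ge>no. norm (measure (P n) {\<omega> \<in> space (P n). \<bar>Y n \<omega> - l\<bar> > e} - 0) < r"
      by (simp add: eventually_sequentially)
  qed
qed

section \<open>Uniform law of large numbers and consistency\<close>

locale gaussian_array = gaussian_location_model M c C
  for M c C :: real +
  fixes P :: "nat \<Rightarrow> 'a measure" and \<pi>star :: "real measure"
    and X :: "nat \<Rightarrow> nat \<Rightarrow> 'a \<Rightarrow> real" and \<mu> :: "nat \<Rightarrow> nat \<Rightarrow> real measure"
    and \<sigma> :: "nat \<Rightarrow> nat \<Rightarrow> real" and \<sigma>hat :: "nat \<Rightarrow> nat \<Rightarrow> 'a \<Rightarrow> real"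
    and \<pi>hat :: "nat \<Rightarrow> 'a \<Rightarrow> real measure" and r :: "nat \<Rightarrow> real"
  assumes \<pi>star: "\<pi>star \<in> priors"
    and P: "\<And>n. prob_space (P n)"
    and X: "\<And>n i. i \<in> {1..n} \<Longrightarrow> X n i \<in> borel_measurable (P n)"
    and law_X: "\<And>n i. i \<in> {1..n} \<Longrightarrow> distr (P n) borel (X n i) = \<mu> n i"
    and indep: "approx_independent P X"
    and \<sigma>hat: "\<And>n i. i \<in> {1..n} \<Longrightarrow> \<sigma>hat n i \<in> borel_measurable (P n)"
    and \<sigma>: "\<And>n i. i \<in> {1..n} \<Longrightarrow> c \<le> \<sigma> n i" "\<And>n i. i \<in> {1..n} \<Longrightarrow> \<sigma> n i \<le> C"
    and \<sigma>hat_bounds: "\<And>n. AE \<omega> in P n. \<forall>i\<in>{1..n}. c \<le> \<sigma>hat n i \<omega> \<and> \<sigma>hat n i \<omega> \<le> C"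
    and \<pi>hat_measurable: "\<And>n. \<pi>hat n \<in> P n \<rightarrow>\<^sub>M prob_algebra borel"
    and \<pi>hat: "\<And>n. AE \<omega> in P n. \<pi>hat n \<omega> \<in> priors"
    and r: "r \<longlonglongrightarrow> 0"
    and optimal: "\<And>n. AE \<omega> in P n. avg n (\<lambda>i. ln (mixture_density \<pi>star (\<sigma>hat n i \<omega>) (X n i \<omega>))) - r n
       \<le> avg n (\<lambda>i. ln (mixture_density (\<pi>hat n \<omega>) (\<sigma>hat n i \<omega>) (X n i \<omega>)))"
    and \<sigma>hat_consistent: "converges_in_prob P (\<lambda>n \<omega>. avg n (\<lambda>i. \<bar>\<sigma>hat n i \<omega> - \<sigma> n i\<bar>)) 0"
    and V: "V_dist \<mu> \<pi>star \<sigma> \<longlonglongrightarrow> 0"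
begin

abbreviation Q :: "nat \<Rightarrow> nat \<Rightarrow> real measure" where
  "Q n i \<equiv> mixture_measure \<pi>star (\<sigma> n i)"

abbreviation log_lik :: "real measure \<Rightarrow> nat \<Rightarrow> 'a \<Rightarrow> real" where
  "log_lik p n \<omega> \<equiv> avg n (\<lambda>i. ln (mixture_density p (\<sigma> n i) (X n i \<omega>)))"

abbreviation log_lik_hat :: "real measure \<Rightarrow> nat \<Rightarrow> 'a \<Rightarrow> real" where
  "log_lik_hat p n \<omega> \<equiv> avg n (\<lambda>i. ln (mixture_density p (\<sigma>hat n i \<omega>) (X n i \<omega>)))"

abbreviation mean_log_lik :: "real measure \<Rightarrow> nat \<Rightarrow> real" where
  "mean_log_lik p n \<equiv> avg n (\<lambda>i. \<integral>x. ln (mixture_density p (\<sigma> n i) x) \<partial>Q n i)"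

abbreviation mean_hellinger :: "nat \<Rightarrow> 'a \<Rightarrow> real" where
  "mean_hellinger n \<omega> \<equiv>
     avg n (\<lambda>i. hellinger_sq (mixture_density (\<pi>hat n \<omega>) (\<sigma> n i)) (mixture_density \<pi>star (\<sigma> n i)))"

abbreviation mean_tail :: "real \<Rightarrow> nat \<Rightarrow> 'a \<Rightarrow> real" where
  "mean_tail T n \<omega> \<equiv> avg n (\<lambda>i. sq_tail T (X n i \<omega>))"

abbreviation scale_error :: "nat \<Rightarrow> 'a \<Rightarrow> real" where
  "scale_error n \<omega> \<equiv> avg n (\<lambda>i. (1 + (X n i \<omega>)\<^sup>2) * \<bar>\<sigma>hat n i \<omega> - \<sigma> n i\<bar>)"

abbreviation good_scales :: "nat \<Rightarrow> 'a \<Rightarrow> bool" where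
  "good_scales n \<omega> \<equiv> \<forall>i\<in>{1..n}. c \<le> \<sigma>hat n i \<omega> \<and> \<sigma>hat n i \<omega> \<le> C"

text \<open>The free lower bound \<open>T0\<close> allows one truncation level to serve the observations and the Gaussian
  mixtures at the same time.\<close>

lemma X_tail:
  assumes e: "0 < e"
  obtains T where "T0 \<le> T" and "\<forall>\<^sub>F n in sequentially.
    (\<forall>i\<in>{1..n}. integrable (P n) (\<lambda>\<omega>. (X n i \<omega>)\<^sup>2)) \<and> avg n (\<lambda>i. \<integral>\<omega>. sq_tail T (X n i \<omega>) \<partial>P n) \<le> e"
proof -
  define A where "A T n = ennreal (1 / real n) *
          (\<Sum>i=1..n. \<integral>\<^sup>+\<omega>. ennreal ((X n i \<omega>)\<^sup>2) * indicator {\<omega>. \<bar>X n i \<omega>\<bar> \<ge> T} \<omega> \<partial>P n)" for T n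
  have "Limsup at_top (\<lambda>T::real. limsup (A T)) = 0"
    using indep unfolding approx_independent_def A_def[abs_def] by blast
  then have "Limsup at_top (\<lambda>T::real. limsup (A T)) < ennreal e" using e by simp
  then have "\<forall>\<^sub>F T in at_top. limsup (A T) < ennreal e" by (rule Limsup_lessD)
  then have "\<forall>\<^sub>F T in at_top. T0 \<le> T \<and> limsup (A T) < ennreal e"
    using eventually_ge_at_top by (rule eventually_conj[rotated])
  then obtain T where T: "T0 \<le> T" "limsup (A T) < ennreal e"
    using eventually_happens'[OF trivial_limit_at_top_linorder] by blast
  from Limsup_lessD[OF T(2)] have ev: "\<forall>\<^sub>F n in sequentially. A T n < ennreal e" .
  show thesis
  proof (rule that[OF T(1)])
    show "\<forall>\<^sub>F n in sequentially.
     (\<forall>i\<in>{1..n}. integrable (P n) (\<lambda>\<omega>. (X n i \<omega>)\<^sup>2)) \<and> avg n (\<lambda>i. \<integral>\<omega>. sq_tail T (X n i \<omega>) \<partial>P n) \<le> e"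
      using ev eventually_gt_at_top[of "0::nat"]
    proof eventually_elim
      case (elim n)
      interpret prob_space "P n" by (rule P)
      have eq: "ennreal ((X n i \<omega>)\<^sup>2) * indicator {\<omega>. \<bar>X n i \<omega>\<bar> \<ge> T} \<omega> = ennreal (sq_tail T (X n i \<omega>))" for i \<omega>
        by (auto simp: sq_tail_def indicator_def)
      have A: "A T n = ennreal (1 / real n) * (\<Sum>i=1..n. \<integral>\<^sup>+\<omega>. ennreal (sq_tail T (X n i \<omega>)) \<partial>P n)"
        unfolding A_def eq ..
      have "ennreal (1 / real n) * (\<Sum>i=1..n. \<integral>\<^sup>+\<omega>. ennreal (sq_tail T (X n i \<omega>)) \<partial>P n) < \<infinity>"
        using elim(1) unfolding A by (rule less_trans) simp
      then have "(\<Sum>i=1..n. \<integral>\<^sup>+\<omega>. ennreal (sq_tail T (X n i \<omega>)) \<partial>P n) < \<infinity>"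
        using elim(2) by (auto simp: ennreal_mult_less_top)
      then have fin: "(\<integral>\<^sup>+\<omega>. ennreal (sq_tail T (X n i \<omega>)) \<partial>P n) < \<infinity>" if "i \<in> {1..n}" for i
        using that by (simp add: ennreal_sum_less_top)
      have int: "integrable (P n) (\<lambda>\<omega>. sq_tail T (X n i \<omega>))" if i: "i \<in> {1..n}" for i
      proof (rule integrableI_nonneg)
        show "(\<lambda>\<omega>. sq_tail T (X n i \<omega>)) \<in> borel_measurable (P n)" using X[OF i] by measurable
      qed (use fin[OF i] sq_tail_nonneg in auto)
      have int2: "integrable (P n) (\<lambda>\<omega>. (X n i \<omega>)\<^sup>2)" if i: "i \<in> {1..n}" for i
      proof (rule Bochner_Integration.integrable_bound)
        show "integrable (P n) (\<lambda>\<omega>. T\<^sup>2 + sq_tail T (X n i \<omega>))" using int[OF i] by simp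
        have "x\<^sup>2 \<le> T\<^sup>2 + sq_tail T x" for x
          using power_mono[of "\<bar>x\<bar>" T 2] by (auto simp: sq_tail_def indicator_def)
        then show "AE \<omega> in P n. norm ((X n i \<omega>)\<^sup>2) \<le> norm (T\<^sup>2 + sq_tail T (X n i \<omega>))"
          using sq_tail_nonneg by (intro AE_I2) (auto intro: order_trans[OF _ abs_ge_self])
      qed (use X[OF i] in measurable)
      have "A T n = ennreal (1 / real n) * (\<Sum>i=1..n. ennreal (\<integral>\<omega>. sq_tail T (X n i \<omega>) \<partial>P n))"
        unfolding A using int
        by (intro arg_cong[where f="\<lambda>x. _ * x"] sum.cong refl nn_integral_eq_integral) (auto simp: sq_tail_nonneg)
      also have "\<dots> = ennreal (avg n (\<lambda>i. \<integral>\<omega>. sq_tail T (X n i \<omega>) \<partial>P n))"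
        by (rule ennreal_avg[symmetric]) (simp add: sq_tail_nonneg integral_nonneg_AE)
      finally have "avg n (\<lambda>i. \<integral>\<omega>. sq_tail T (X n i \<omega>) \<partial>P n) < e"
        using elim(1) by (simp add: ennreal_less_iff avg_nonneg integral_nonneg_AE sq_tail_nonneg)
      then show ?case using int2 by auto
    qed
  qed
qed

lemma X_tail_except_prob:
  assumes e: "0 < e" and d: "0 < d"
  obtains T where "T0 \<le> T" and "except_prob P d (\<lambda>n \<omega>. mean_tail T n \<omega> \<le> e)"
proof -
  have "0 < e * d" using e d by simp
  from X_tail[OF this] obtain T where T: "T0 \<le> T" and ev: "\<forall>\<^sub>F n in sequentially.
    (\<forall>i\<in>{1..n}. integrable (P n) (\<lambda>\<omega>. (X n i \<omega>)\<^sup>2)) \<and> avg n (\<lambda>i. \<integral>\<omega>. sq_tail T (X n i \<omega>) \<partial>P n) \<le> e * d" .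
  from ev have "except_prob P d (\<lambda>n \<omega>. mean_tail T n \<omega> \<le> e)"
    unfolding except_prob_def
  proof eventually_elim
    case (elim n)
    interpret prob_space "P n" by (rule P)
    let ?Y = "\<lambda>\<omega>. mean_tail T n \<omega>"
    have int: "integrable (P n) (\<lambda>\<omega>. sq_tail T (X n i \<omega>))" if i: "i \<in> {1..n}" for i
    proof (rule Bochner_Integration.integrable_bound)
      show "integrable (P n) (\<lambda>\<omega>. (X n i \<omega>)\<^sup>2)" using elim i by auto
      show "(\<lambda>\<omega>. sq_tail T (X n i \<omega>)) \<in> borel_measurable (P n)" using X[OF i] by measurable
    qed (auto simp: sq_tail_nonneg sq_tail_le)
    have Y: "integrable (P n) ?Y" using int by (rule integrable_avg)
    let ?B = "{\<omega> \<in> space (P n). e \<le> ?Y \<omega>}"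
    have B: "?B \<in> sets (P n)" using borel_measurable_integrable[OF Y] by measurable
    have "prob ?B \<le> (\<integral>\<omega>. ?Y \<omega> \<partial>P n) / e"
      by (rule integral_Markov_inequality_measure[OF Y sets.empty_sets]) (use e in \<open>auto simp: avg_nonneg sq_tail_nonneg\<close>)
    also have "\<dots> \<le> (e * d) / e"
    proof (rule divide_right_mono)
      show "(\<integral>\<omega>. ?Y \<omega> \<partial>P n) \<le> e * d" using elim by (subst integral_avg[OF int]) auto
    qed (use e in simp)
    finally have "prob ?B \<le> d" using e by simp
    then show ?case using B by (intro bexI[OF _ B] conjI) (auto intro!: AE_I2)
  qed
  then show thesis by (rule that[OF T])
qed

lemma \<sigma>hat_except_prob:
  assumes "0 < e" "0 < d"
  shows "except_prob P d (\<lambda>n \<omega>. avg n (\<lambda>i. \<bar>\<sigma>hat n i \<omega> - \<sigma> n i\<bar>) \<le> e)"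
proof -
  have "except_prob P d (\<lambda>n \<omega>. \<bar>avg n (\<lambda>i. \<bar>\<sigma>hat n i \<omega> - \<sigma> n i\<bar>) - 0\<bar> \<le> e)"
  proof (rule except_prob_of_converges[OF \<sigma>hat_consistent _ assms])
    fix n
    show "(\<lambda>\<omega>. avg n (\<lambda>i. \<bar>\<sigma>hat n i \<omega> - \<sigma> n i\<bar>)) \<in> borel_measurable (P n)"
      by (intro avg_measurable borel_measurable_abs borel_measurable_diff \<sigma>hat) auto
  qed
  then show ?thesis by (rule except_prob_mono) (auto intro!: always_eventually)
qed

text \<open>On \<open>[-T, T]\<close> the weights are bounded by \<open>1 + T\<^sup>2\<close>; outside, the error of the scale is bounded by
  \<open>C\<close> and the weights are controlled by uniform integrability.\<close>

lemma \<sigma>hat_weighted_except_prob: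
  assumes e: "0 < e" and d: "0 < d"
  shows "except_prob P d (\<lambda>n \<omega>. scale_error n \<omega> \<le> e)"
proof -
  have C: "0 < C" using c_pos c_le_C by simp
  obtain T where T: "1 \<le> T" and tail: "except_prob P (d / 2) (\<lambda>n \<omega>. mean_tail T n \<omega> \<le> e / (4 * C))"
    using X_tail_except_prob[of "e / (4 * C)" "d / 2"] e d C by auto
  have s: "except_prob P (d / 2) (\<lambda>n \<omega>. avg n (\<lambda>i. \<bar>\<sigma>hat n i \<omega> - \<sigma> n i\<bar>) \<le> e / (2 * (1 + T\<^sup>2)))"
    using e d T by (intro \<sigma>hat_except_prob) (auto intro!: divide_pos_pos add_pos_nonneg)
  have b: "except_prob P 0 (\<lambda>n \<omega>. good_scales n \<omega>)"
    using \<sigma>hat_bounds by (rule except_prob_AE) simp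
  have "except_prob P (d / 2 + d / 2 + 0) (\<lambda>n \<omega>. scale_error n \<omega> \<le> e)"
    using except_prob_conj[OF P except_prob_conj[OF P tail s] b]
  proof (rule except_prob_mono, intro always_eventually allI impI)
    fix n \<omega>
    assume *: "(mean_tail T n \<omega> \<le> e / (4 * C) \<and> avg n (\<lambda>i. \<bar>\<sigma>hat n i \<omega> - \<sigma> n i\<bar>) \<le> e / (2 * (1 + T\<^sup>2)))
      \<and> good_scales n \<omega>"
    have "scale_error n \<omega>
      \<le> avg n (\<lambda>i. (1 + T\<^sup>2) * \<bar>\<sigma>hat n i \<omega> - \<sigma> n i\<bar> + 2 * C * sq_tail T (X n i \<omega>))"
    proof (rule avg_mono)
      fix i assume i: "i \<in> {1..n}"
      let ?x = "X n i \<omega>" and ?\<delta> = "\<bar>\<sigma>hat n i \<omega> - \<sigma> n i\<bar>"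
      have "c \<le> \<sigma>hat n i \<omega>" "\<sigma>hat n i \<omega> \<le> C" using * i by blast+
      then have \<delta>: "?\<delta> \<le> C" using \<sigma>[OF i] c_pos by linarith
      show "(1 + ?x\<^sup>2) * ?\<delta> \<le> (1 + T\<^sup>2) * ?\<delta> + 2 * C * sq_tail T ?x"
      proof (cases "T \<le> \<bar>?x\<bar>")
        case True
        then have "1 \<le> ?x\<^sup>2" using T power_mono[of 1 "\<bar>?x\<bar>" 2] by simp
        then have "(1 + ?x\<^sup>2) * ?\<delta> \<le> (2 * ?x\<^sup>2) * C" using \<delta> by (intro mult_mono) auto
        moreover have "0 \<le> (1 + T\<^sup>2) * ?\<delta>" by (intro mult_nonneg_nonneg add_nonneg_nonneg) auto
        moreover have "2 * C * sq_tail T ?x = 2 * ?x\<^sup>2 * C" using True by (simp add: sq_tail_def)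
        ultimately show ?thesis by linarith
      next
        case False
        then have "?x\<^sup>2 \<le> T\<^sup>2" using power_mono[of "\<bar>?x\<bar>" T 2] by simp
        then have "(1 + ?x\<^sup>2) * ?\<delta> \<le> (1 + T\<^sup>2) * ?\<delta>" by (intro mult_right_mono) auto
        then show ?thesis using False by (simp add: sq_tail_def)
      qed
    qed
    also have "\<dots> = (1 + T\<^sup>2) * avg n (\<lambda>i. \<bar>\<sigma>hat n i \<omega> - \<sigma> n i\<bar>) + 2 * C * mean_tail T n \<omega>"
      by (simp add: avg_add avg_cmult)
    also have "\<dots> \<le> (1 + T\<^sup>2) * (e / (2 * (1 + T\<^sup>2))) + 2 * C * (e / (4 * C))"
      using * C by (intro add_mono mult_left_mono) auto
    also have "\<dots> = e"
    proof -
      have "1 + T\<^sup>2 > 0" by (intro add_pos_nonneg) auto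
      then show ?thesis using C by (simp add: field_simps)
    qed
    finally show "scale_error n \<omega> \<le> e" .
  qed
  then show ?thesis by simp
qed

lemma V_eventually:
  assumes e: "0 < e"
  shows "\<forall>\<^sub>F n in sequentially. (\<forall>i\<in>{1..n}. wasserstein 1 (\<mu> n i) (Q n i) < \<infinity>) \<and>
    avg n (\<lambda>i. enn2real (wasserstein 1 (\<mu> n i) (Q n i))) \<le> e"
proof -
  have "\<forall>\<^sub>F n in sequentially. V_dist \<mu> \<pi>star \<sigma> n < ennreal e" using V e by (intro order_tendstoD(2)) auto
  then show ?thesis using eventually_gt_at_top[of "0::nat"]
  proof eventually_elim
    case (elim n)
    let ?W = "\<lambda>i. wasserstein 1 (\<mu> n i) (Q n i)"
    have "ennreal (1 / real n) * (\<Sum>i=1..n. ?W i) < \<infinity>"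
      using elim(1) unfolding V_dist_def by (rule less_trans) simp
    then have "(\<Sum>i=1..n. ?W i) < \<infinity>" using elim(2) by (auto simp: ennreal_mult_less_top)
    then have fin: "?W i < \<infinity>" if "i \<in> {1..n}" for i using that by (simp add: ennreal_sum_less_top)
    have "ennreal (avg n (\<lambda>i. enn2real (?W i))) = V_dist \<mu> \<pi>star \<sigma> n"
    proof -
      have "(\<Sum>i=1..n. ?W i) = (\<Sum>i=1..n. ennreal (enn2real (?W i)))"
        using fin by (intro sum.cong) auto
      then show ?thesis unfolding V_dist_def by (subst ennreal_avg) auto
    qed
    then have "ennreal (avg n (\<lambda>i. enn2real (?W i))) < ennreal e" using elim(1) by (rule ord_eq_less_trans)
    then have "avg n (\<lambda>i. enn2real (?W i)) < e" by (subst (asm) ennreal_less_iff) (auto intro!: avg_nonneg)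
    then show ?case using fin by auto
  qed
qed

lemma integral_X:
  fixes g :: "real \<Rightarrow> real"
  assumes "i \<in> {1..n}" and [measurable]: "g \<in> borel_measurable borel"
  shows "(\<integral>\<omega>. g (X n i \<omega>) \<partial>P n) = (\<integral>x. g x \<partial>\<mu> n i)"
  unfolding law_X[OF assms(1), symmetric] using X[OF assms(1)] by (subst integral_distr) auto

lemma law_X_second_moment:
  assumes i: "i \<in> {1..n}" and "integrable (P n) (\<lambda>\<omega>. (X n i \<omega>)\<^sup>2)"
  shows "prob_space (\<mu> n i)" "sets (\<mu> n i) = sets borel" "integrable (\<mu> n i) (\<lambda>x. x\<^sup>2)"
proof -
  interpret prob_space "P n" by (rule P)
  show "prob_space (\<mu> n i)" unfolding law_X[OF i, symmetric] using X[OF i] by (rule prob_space_distr)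
  show "sets (\<mu> n i) = sets borel" unfolding law_X[OF i, symmetric] by simp
  show "integrable (\<mu> n i) (\<lambda>x. x\<^sup>2)" unfolding law_X[OF i, symmetric]
    using assms(2) X[OF i] by (subst integrable_distr_eq) auto
qed

text \<open>The threshold for \<open>n\<close> depends on the functions only through their growth constant, so it also
  serves functions that change with \<open>n\<close> and \<open>i\<close>.\<close>

lemma mean_eventually_gaussian:
  assumes e: "0 < e" and K: "0 \<le> K"
  shows "\<forall>\<^sub>F n in sequentially. \<forall>h. (\<forall>i\<in>{1..n}. quadratic_growth K (h i)) \<longrightarrow>
    avg n (\<lambda>i. \<bar>(\<integral>\<omega>. h i (X n i \<omega>) \<partial>P n) - (\<integral>x. h i x \<partial>Q n i)\<bar>) \<le> e"
proof -
  define e1 where "e1 = e / (9 * (K + 1))"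
  have e1: "0 < e1" using e K by (simp add: e1_def)
  define T0 where "T0 = 1 + fourth_moment_bound / e1"
  have F: "0 \<le> fourth_moment_bound" using c_pos c_le_C M_pos by (simp add: fourth_moment_bound_def)
  obtain T where T: "T0 \<le> T" and tail: "\<forall>\<^sub>F n in sequentially.
    (\<forall>i\<in>{1..n}. integrable (P n) (\<lambda>\<omega>. (X n i \<omega>)\<^sup>2)) \<and> avg n (\<lambda>i. \<integral>\<omega>. sq_tail T (X n i \<omega>) \<partial>P n) \<le> e1"
    using X_tail[OF e1] .
  have T1: "1 \<le> T" using T F e1 unfolding T0_def by (smt (verit) divide_nonneg_nonneg)
  have FT: "fourth_moment_bound / T\<^sup>2 \<le> e1"
  proof -
    have "fourth_moment_bound / e1 \<le> T" using T by (simp add: T0_def)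
    also have "T \<le> T\<^sup>2" using T1 by (simp add: power2_eq_square)
    finally show ?thesis using e1 T1 by (simp add: divide_le_eq mult.commute)
  qed
  define e2 where "e2 = e / (3 * (K + 1) * (1 + 2 * T))"
  have "0 < e2" using e K T1 by (simp add: e2_def)
  from V_eventually[OF this] tail show ?thesis
  proof eventually_elim
    case (elim n)
    let ?W = "\<lambda>i. enn2real (wasserstein 1 (\<mu> n i) (Q n i))"
    show ?case
    proof (intro allI impI)
      fix h assume h: "\<forall>i\<in>{1..n}. quadratic_growth K (h i)"
      have "avg n (\<lambda>i. \<bar>(\<integral>\<omega>. h i (X n i \<omega>) \<partial>P n) - (\<integral>x. h i x \<partial>Q n i)\<bar>)
        \<le> avg n (\<lambda>i. K * (1 + 2 * T) * ?W i + 3 * K * ((\<integral>\<omega>. sq_tail T (X n i \<omega>) \<partial>P n) + e1))"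
      proof (rule avg_mono)
        fix i assume i: "i \<in> {1..n}"
        note hi = h[rule_format, OF i]
        have "\<bar>(\<integral>x. h i x \<partial>\<mu> n i) - (\<integral>x. h i x \<partial>Q n i)\<bar>
          \<le> K * (1 + 2 * T) * ?W i + 3 * K * ((\<integral>x. sq_tail T x \<partial>\<mu> n i) + (\<integral>x. sq_tail T x \<partial>Q n i))"
          by (rule quadratic_growth_wasserstein[OF hi T1 law_X_second_moment[OF i] prob_space_mixture_measure[OF \<pi>star \<sigma>(1)[OF i]] _
              mixture_second_moment[OF \<pi>star \<sigma>(1)[OF i] \<sigma>(2)[OF i]]]) (use elim i in auto)
        also have "\<dots> \<le> K * (1 + 2 * T) * ?W i + 3 * K * ((\<integral>x. sq_tail T x \<partial>\<mu> n i) + e1)"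
          using mixture_sq_tail[OF \<pi>star \<sigma>(1)[OF i] \<sigma>(2)[OF i], of T] T1 FT K
          by (intro add_left_mono mult_left_mono) auto
        finally show "\<bar>(\<integral>\<omega>. h i (X n i \<omega>) \<partial>P n) - (\<integral>x. h i x \<partial>Q n i)\<bar>
           \<le> K * (1 + 2 * T) * ?W i + 3 * K * ((\<integral>\<omega>. sq_tail T (X n i \<omega>) \<partial>P n) + e1)"
          using i quadratic_growth_measurable[OF hi] by (simp add: integral_X)
      qed
      also have "\<dots> = K * (1 + 2 * T) * avg n ?W + 3 * K * (avg n (\<lambda>i. \<integral>\<omega>. sq_tail T (X n i \<omega>) \<partial>P n) + avg n (\<lambda>_. e1))"
        by (simp add: avg_add avg_cmult)
      also have "\<dots> \<le> K * (1 + 2 * T) * e2 + 3 * K * (e1 + e1)"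
        using elim K T1 avg_const_le[of e1 n] e1 by (intro add_mono mult_left_mono) auto
      also have "\<dots> \<le> (K + 1) * (1 + 2 * T) * e2 + 3 * (K + 1) * (e1 + e1)"
        using K T1 e1 \<open>0 < e2\<close> by (intro add_mono mult_right_mono) auto
      also have "\<dots> = e"
      proof -
        have "(K + 1) * (1 + 2 * T) * e2 = e / 3" "3 * (K + 1) * (e1 + e1) = 2 * e / 3"
          using K T1 by (simp_all add: e2_def e1_def divide_simps)
        then show ?thesis by linarith
      qed
      finally show "avg n (\<lambda>i. \<bar>(\<integral>\<omega>. h i (X n i \<omega>) \<partial>P n) - (\<integral>x. h i x \<partial>Q n i)\<bar>) \<le> e" .
    qed
  qed
qed

lemma law_of_large_numbers:
  assumes g: "\<And>s. c \<le> s \<Longrightarrow> test_function (\<lambda>x. g s x / test_scale)" and gm: "\<And>s. c \<le> s \<Longrightarrow> g s \<in> borel_measurable borel"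
    and e: "0 < e" and d: "0 < d"
  shows "except_prob P d (\<lambda>n \<omega>.
    \<bar>avg n (\<lambda>i. g (\<sigma> n i) (X n i \<omega>)) - avg n (\<lambda>i. \<integral>\<omega>. g (\<sigma> n i) (X n i \<omega>) \<partial>P n)\<bar> \<le> e)"
proof -
  let ?f = "\<lambda>n i x. g (\<sigma> n i) x / test_scale"
  let ?Y = "\<lambda>n \<omega>. 1 / real n * (\<Sum>i=1..n. ?f n i (X n i \<omega>) - (\<integral>\<omega>'. ?f n i (X n i \<omega>') \<partial>P n))"
  have lln: "\<forall>f. (\<forall>n. \<forall>i\<in>{1..n}. test_function (f n i)) \<longrightarrow> converges_in_prob P
          (\<lambda>n \<omega>. 1 / real n * (\<Sum>i=1..n. f n i (X n i \<omega>) - (\<integral>\<omega>'. f n i (X n i \<omega>') \<partial>P n))) 0"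
    using indep unfolding approx_independent_def by blast
  have "converges_in_prob P ?Y 0"
    by (rule lln[rule_format, of ?f]) (use g \<sigma> in blast)
  then have "except_prob P d (\<lambda>n \<omega>. \<bar>?Y n \<omega> - 0\<bar> \<le> e / test_scale)"
  proof (rule except_prob_of_converges)
    fix n
    have "(\<lambda>\<omega>. g (\<sigma> n i) (X n i \<omega>)) \<in> borel_measurable (P n)" if i: "i \<in> {1..n}" for i
      using gm[OF \<sigma>(1)[OF i]] X[OF i] by measurable
    then show "?Y n \<in> borel_measurable (P n)" by (intro borel_measurable_times borel_measurable_sum borel_measurable_diff borel_measurable_divide) auto
  qed (use e d test_scale_pos in auto)
  then show ?thesis
  proof (rule except_prob_mono, intro always_eventually allI impI)
    fix n \<omega> assume *: "\<bar>?Y n \<omega> - 0\<bar> \<le> e / test_scale"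
    have "?Y n \<omega> = (avg n (\<lambda>i. g (\<sigma> n i) (X n i \<omega>)) - avg n (\<lambda>i. \<integral>\<omega>. g (\<sigma> n i) (X n i \<omega>) \<partial>P n)) / test_scale"
      by (simp add: avg_def sum_subtractf sum_divide_distrib[symmetric] diff_divide_distrib right_diff_distrib)
    then show "\<bar>avg n (\<lambda>i. g (\<sigma> n i) (X n i \<omega>)) - avg n (\<lambda>i. \<integral>\<omega>. g (\<sigma> n i) (X n i \<omega>) \<partial>P n)\<bar> \<le> e"
      using * test_scale_pos by (simp add: abs_divide divide_le_cancel)
  qed
qed

text \<open>The difference passes through four steps of size at most \<open>e / 4\<close>: from \<open>p\<close> to its neighbour in
  the net at the data, from the data to their expectation, from the true laws to the Gaussian
  mixtures, and back from the neighbour to \<open>p\<close>.\<close>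

lemma uniform_law_of_large_numbers:
  assumes e: "0 < e" and d: "0 < d"
  shows "except_prob P d (\<lambda>n \<omega>. \<forall>p\<in>priors. \<bar>log_lik p n \<omega> - mean_log_lik p n\<bar> \<le> e)"
proof -
  have K: "0 < net_tail_const" unfolding net_tail_const_def using M_pos by (intro add_pos_nonneg) auto
  \<comment> \<open>the tail then contributes \<open>net_tail_const * e1 = e / 8\<close>, as much as the accuracy of the net\<close>
  define e1 where "e1 = e / (8 * net_tail_const)"
  have e1: "0 < e1" using e K by (simp add: e1_def)
  have F: "0 \<le> fourth_moment_bound" using c_pos c_le_C M_pos by (simp add: fourth_moment_bound_def)
  obtain T where T: "1 + fourth_moment_bound / e1 \<le> T"
    and tail: "except_prob P (d / 2) (\<lambda>n \<omega>. mean_tail T n \<omega> \<le> e1)"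
    using X_tail_except_prob[OF e1, of "d / 2"] d by auto
  have T1: "1 \<le> T" using T F e1 by (smt (verit) divide_nonneg_nonneg)
  have FT: "fourth_moment_bound / T\<^sup>2 \<le> e1"
  proof -
    have "fourth_moment_bound / e1 \<le> T" using T by simp
    also have "T \<le> T\<^sup>2" using T1 by (simp add: power2_eq_square)
    finally show ?thesis using e1 T1 by (simp add: divide_le_eq mult.commute)
  qed
  have "0 < e / 8" using e by simp
  from log_mixture_net[OF this T1] obtain G where G: "finite G"
    "\<And>g s. g \<in> G \<Longrightarrow> c \<le> s \<Longrightarrow> test_function (\<lambda>x. g s x / test_scale)"
    "\<And>g s. g \<in> G \<Longrightarrow> c \<le> s \<Longrightarrow> quadratic_growth log_growth (g s)"
    "\<And>p. p \<in> priors \<Longrightarrow> \<exists>g\<in>G. \<forall>s\<ge>c. \<forall>x. \<bar>g s x - ln (mixture_density p s x)\<bar> \<le> e / 8 + net_tail_const * sq_tail T x"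
    by blast
  have "except_prob P (d / 2) (\<lambda>n \<omega>. \<forall>g\<in>G.
    \<bar>avg n (\<lambda>i. g (\<sigma> n i) (X n i \<omega>)) - avg n (\<lambda>i. \<integral>\<omega>. g (\<sigma> n i) (X n i \<omega>) \<partial>P n)\<bar> \<le> e / 4)"
    using e d by (intro except_prob_finite[OF P G(1)] law_of_large_numbers G(2) quadratic_growth_measurable[OF G(3)]) auto
  from except_prob_conj[OF P tail this]
  have "except_prob P (d / 2 + d / 2) (\<lambda>n \<omega>. \<forall>p\<in>priors. \<bar>log_lik p n \<omega> - mean_log_lik p n\<bar> \<le> e)"
  proof (rule except_prob_eventually_mono)
    show "\<forall>\<^sub>F n in sequentially. \<forall>h. (\<forall>i\<in>{1..n}. quadratic_growth log_growth (h i)) \<longrightarrow>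
          avg n (\<lambda>i. \<bar>(\<integral>\<omega>. h i (X n i \<omega>) \<partial>P n) - (\<integral>x. h i x \<partial>Q n i)\<bar>) \<le> e / 4"
      using e M_pos by (intro mean_eventually_gaussian) (auto simp: log_growth_def)
  next
    fix n \<omega>
    assume mean: "\<forall>h. (\<forall>i\<in>{1..n}. quadratic_growth log_growth (h i)) \<longrightarrow>
          avg n (\<lambda>i. \<bar>(\<integral>\<omega>. h i (X n i \<omega>) \<partial>P n) - (\<integral>x. h i x \<partial>Q n i)\<bar>) \<le> e / 4"
      and ev: "mean_tail T n \<omega> \<le> e1 \<and>
      (\<forall>g\<in>G. \<bar>avg n (\<lambda>i. g (\<sigma> n i) (X n i \<omega>)) - avg n (\<lambda>i. \<integral>\<omega>. g (\<sigma> n i) (X n i \<omega>) \<partial>P n)\<bar> \<le> e / 4)"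
    show "\<forall>p\<in>priors. \<bar>log_lik p n \<omega> - mean_log_lik p n\<bar> \<le> e"
    proof
      fix p assume p: "p \<in> priors"
      let ?l = "\<lambda>i x. ln (mixture_density p (\<sigma> n i) x)"
      obtain g where g: "g \<in> G" "\<And>s x. c \<le> s \<Longrightarrow> \<bar>g s x - ln (mixture_density p s x)\<bar> \<le> e / 8 + net_tail_const * sq_tail T x"
        using G(4)[OF p] by blast
      have c8: "net_tail_const * e1 = e / 8" using K by (simp add: e1_def)
      have 1: "\<bar>avg n (\<lambda>i. ?l i (X n i \<omega>)) - avg n (\<lambda>i. g (\<sigma> n i) (X n i \<omega>))\<bar> \<le> e / 4"
      proof -
        have "\<bar>avg n (\<lambda>i. ?l i (X n i \<omega>)) - avg n (\<lambda>i. g (\<sigma> n i) (X n i \<omega>))\<bar>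
          \<le> avg n (\<lambda>i. \<bar>?l i (X n i \<omega>) - g (\<sigma> n i) (X n i \<omega>)\<bar>)"
          unfolding avg_diff[symmetric] by (rule avg_abs)
        also have "\<dots> \<le> avg n (\<lambda>i. e / 8 + net_tail_const * sq_tail T (X n i \<omega>))"
          using g(2)[OF \<sigma>(1)] by (intro avg_mono) (auto simp: abs_minus_commute)
        also have "\<dots> \<le> e / 8 + net_tail_const * e1"
          unfolding avg_add avg_cmult using ev K avg_const_le[of "e / 8" n] e by (intro add_mono mult_left_mono) auto
        finally show ?thesis using c8 by simp
      qed
      have 2: "\<bar>avg n (\<lambda>i. g (\<sigma> n i) (X n i \<omega>)) - avg n (\<lambda>i. \<integral>\<omega>. g (\<sigma> n i) (X n i \<omega>) \<partial>P n)\<bar> \<le> e / 4"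
        using ev g(1) by blast
      have 3: "\<bar>avg n (\<lambda>i. \<integral>\<omega>. g (\<sigma> n i) (X n i \<omega>) \<partial>P n) - avg n (\<lambda>i. \<integral>x. g (\<sigma> n i) x \<partial>Q n i)\<bar> \<le> e / 4"
      proof -
        have "avg n (\<lambda>i. \<bar>(\<integral>\<omega>. g (\<sigma> n i) (X n i \<omega>) \<partial>P n) - (\<integral>x. g (\<sigma> n i) x \<partial>Q n i)\<bar>) \<le> e / 4"
          by (rule mean[rule_format, of "\<lambda>i. g (\<sigma> n i)"]) (use G(3) g(1) \<sigma> in auto)
        then show ?thesis unfolding avg_diff[symmetric] by (rule order_trans[OF avg_abs])
      qed
      have 4: "\<bar>avg n (\<lambda>i. \<integral>x. g (\<sigma> n i) x \<partial>Q n i) - avg n (\<lambda>i. \<integral>x. ?l i x \<partial>Q n i)\<bar> \<le> e / 4"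
      proof -
        have "\<bar>avg n (\<lambda>i. \<integral>x. g (\<sigma> n i) x \<partial>Q n i) - avg n (\<lambda>i. \<integral>x. ?l i x \<partial>Q n i)\<bar>
          \<le> avg n (\<lambda>i. \<bar>(\<integral>x. g (\<sigma> n i) x \<partial>Q n i) - (\<integral>x. ?l i x \<partial>Q n i)\<bar>)"
          unfolding avg_diff[symmetric] by (rule avg_abs)
        also have "\<dots> \<le> avg n (\<lambda>_. e / 4)"
        proof (rule avg_mono)
          fix i assume i: "i \<in> {1..n}"
          note s = \<sigma>(1)[OF i] \<sigma>(2)[OF i]
          interpret Q: prob_space "Q n i" by (rule prob_space_mixture_measure[OF \<pi>star s(1)])
          have i1: "integrable (Q n i) (g (\<sigma> n i))"
            by (rule quadratic_growth_integrable[OF G(3)[OF g(1) s(1)] Q.prob_space_axioms _ mixture_second_moment[OF \<pi>star s]]) simp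
          have i2: "integrable (Q n i) (?l i)" by (rule ln_mixture_integrable[OF p \<pi>star s])
          have i3: "integrable (Q n i) (sq_tail T)"
            by (rule Bochner_Integration.integrable_bound[OF mixture_second_moment[OF \<pi>star s]])
               (auto simp: sq_tail_nonneg sq_tail_le)
          have "\<bar>(\<integral>x. g (\<sigma> n i) x \<partial>Q n i) - (\<integral>x. ?l i x \<partial>Q n i)\<bar> = \<bar>\<integral>x. g (\<sigma> n i) x - ?l i x \<partial>Q n i\<bar>"
            using i1 i2 by simp
          also have "\<dots> \<le> (\<integral>x. \<bar>g (\<sigma> n i) x - ?l i x\<bar> \<partial>Q n i)" by (rule integral_abs_bound)
          also have "\<dots> \<le> (\<integral>x. e / 8 + net_tail_const * sq_tail T x \<partial>Q n i)"
            using i1 i2 i3 g(2)[OF s(1)] by (intro integral_mono) auto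
          also have "\<dots> = e / 8 + net_tail_const * (\<integral>x. sq_tail T x \<partial>Q n i)"
            using i3 by (simp add: Q.prob_space[simplified])
          also have "\<dots> \<le> e / 8 + net_tail_const * e1"
            using mixture_sq_tail[OF \<pi>star s, of T] T1 FT K by (intro add_left_mono mult_left_mono) auto
          finally show "\<bar>(\<integral>x. g (\<sigma> n i) x \<partial>Q n i) - (\<integral>x. ?l i x \<partial>Q n i)\<bar> \<le> e / 4" using c8 by simp
        qed
        also have "\<dots> \<le> e / 4" using e by (intro avg_const_le) auto
        finally show ?thesis .
      qed
      show "\<bar>avg n (\<lambda>i. ?l i (X n i \<omega>)) - avg n (\<lambda>i. \<integral>x. ?l i x \<partial>Q n i)\<bar> \<le> e"
        using 1 2 3 4 by linarith
    qed
  qed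
  then show ?thesis by simp
qed

text \<open>Near-optimality for the estimated scales carries over to the true scales and then to the Gaussian
  expectations, where \<open>hellinger_le_log_likelihood\<close> turns it into a bound for the Hellinger distances.\<close>

lemma hellinger_except_prob:
  assumes e: "0 < e" and d: "0 < d"
  shows "except_prob P d (\<lambda>n \<omega>. mean_hellinger n \<omega> \<le> e)"
proof -
  note sc = scale_const_pos
  have 1: "except_prob P (d / 2) (\<lambda>n \<omega>. \<forall>p\<in>priors. \<bar>log_lik p n \<omega> - mean_log_lik p n\<bar> \<le> e / 4)"
    using e d by (intro uniform_law_of_large_numbers) auto
  have 2: "except_prob P (d / 2) (\<lambda>n \<omega>. scale_error n \<omega> \<le> e / (4 * scale_const))"
    using e d sc by (intro \<sigma>hat_weighted_except_prob) auto
  have 3: "except_prob P 0 (\<lambda>n \<omega>. good_scales n \<omega> \<and> \<pi>hat n \<omega> \<in> priors \<and>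
      log_lik_hat \<pi>star n \<omega> - r n \<le> log_lik_hat (\<pi>hat n \<omega>) n \<omega>)"
  proof (rule except_prob_AE)
    fix n
    show "AE \<omega> in P n. good_scales n \<omega> \<and> \<pi>hat n \<omega> \<in> priors \<and>
      log_lik_hat \<pi>star n \<omega> - r n \<le> log_lik_hat (\<pi>hat n \<omega>) n \<omega>"
      using \<sigma>hat_bounds[of n] \<pi>hat[of n] optimal[of n] by eventually_elim blast
  qed simp
  have "except_prob P (d / 2 + d / 2 + 0) (\<lambda>n \<omega>. mean_hellinger n \<omega> \<le> e)"
    using except_prob_conj[OF P except_prob_conj[OF P 1 2] 3]
  proof (rule except_prob_eventually_mono)
    show "\<forall>\<^sub>F n in sequentially. r n < e" using r e by (rule order_tendstoD)
  next
    fix n \<omega>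
    assume rn: "r n < e" and ev: "((\<forall>p\<in>priors. \<bar>log_lik p n \<omega> - mean_log_lik p n\<bar> \<le> e / 4) \<and>
       scale_error n \<omega> \<le> e / (4 * scale_const)) \<and>
       good_scales n \<omega> \<and> \<pi>hat n \<omega> \<in> priors \<and>
       log_lik_hat \<pi>star n \<omega> - r n \<le> log_lik_hat (\<pi>hat n \<omega>) n \<omega>"
    then have ul: "\<forall>p\<in>priors. \<bar>log_lik p n \<omega> - mean_log_lik p n\<bar> \<le> e / 4"
      and w: "scale_error n \<omega> \<le> e / (4 * scale_const)"
      and b: "good_scales n \<omega>" and ph: "\<pi>hat n \<omega> \<in> priors"
      and opt: "log_lik_hat \<pi>star n \<omega> - r n \<le> log_lik_hat (\<pi>hat n \<omega>) n \<omega>" by blast+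
    let ?h = "\<lambda>i. hellinger_sq (mixture_density (\<pi>hat n \<omega>) (\<sigma> n i)) (mixture_density \<pi>star (\<sigma> n i))"
    have sw: "\<bar>log_lik_hat p n \<omega> - log_lik p n \<omega>\<bar> \<le> e / 4"
      if p: "p \<in> priors" for p
    proof -
      have "\<bar>log_lik_hat p n \<omega> - log_lik p n \<omega>\<bar>
        \<le> avg n (\<lambda>i. \<bar>ln (mixture_density p (\<sigma>hat n i \<omega>) (X n i \<omega>)) - ln (mixture_density p (\<sigma> n i) (X n i \<omega>))\<bar>)"
        unfolding avg_diff[symmetric] by (rule avg_abs)
      also have "\<dots> \<le> avg n (\<lambda>i. scale_const * ((1 + (X n i \<omega>)\<^sup>2) * \<bar>\<sigma>hat n i \<omega> - \<sigma> n i\<bar>))"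
      proof (rule avg_mono)
        fix i assume i: "i \<in> {1..n}"
        then have "c \<le> \<sigma>hat n i \<omega>" using b by blast
        from ln_mixture_scale[OF p this \<sigma>(1)[OF i]]
        show "\<bar>ln (mixture_density p (\<sigma>hat n i \<omega>) (X n i \<omega>)) - ln (mixture_density p (\<sigma> n i) (X n i \<omega>))\<bar>
            \<le> scale_const * ((1 + (X n i \<omega>)\<^sup>2) * \<bar>\<sigma>hat n i \<omega> - \<sigma> n i\<bar>)" by (simp add: mult.assoc)
      qed
      also have "\<dots> \<le> scale_const * (e / (4 * scale_const))"
        unfolding avg_cmult using w sc by (intro mult_left_mono) auto
      also have "\<dots> = e / 4" using sc by simp
      finally show ?thesis .
    qed
    have "- (2 * e) \<le> mean_log_lik (\<pi>hat n \<omega>) n - mean_log_lik \<pi>star n"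
      using sw[OF ph] sw[OF \<pi>star] ul[rule_format, OF ph] ul[rule_format, OF \<pi>star] opt rn by linarith
    also have "\<dots> \<le> avg n (\<lambda>i. - 2 * ?h i)" unfolding avg_diff[symmetric]
      by (intro avg_mono hellinger_le_log_likelihood ph \<pi>star \<sigma>)
    also have "\<dots> = - 2 * mean_hellinger n \<omega>" by (rule avg_cmult)
    finally show "mean_hellinger n \<omega> \<le> e" by simp
  qed
  then show ?thesis by simp
qed

lemma hellinger_converges:
  "converges_in_prob P (\<lambda>n \<omega>. mean_hellinger n \<omega>) 0"
proof (rule converges_of_except_prob[OF P])
  fix e d :: real assume "0 < e" "0 < d"
  from hellinger_except_prob[OF this]
  show "except_prob P d (\<lambda>n \<omega>. \<bar>mean_hellinger n \<omega> - 0\<bar> \<le> e)"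
    by (rule except_prob_mono) (auto intro!: always_eventually simp: avg_nonneg hellinger_sq_nonneg)
qed

text \<open>The smallest term of an average is at most the average, and one scale at which the mixtures are
  close already identifies the prior.\<close>

lemma hellinger_entry_except_prob:
  assumes e: "0 < e" and d: "0 < d"
  shows "except_prob P d (\<lambda>n \<omega>. \<pi>hat n \<omega> \<in> priors \<and> (\<exists>s\<in>{c..C}.
      hellinger_sq (mixture_density (\<pi>hat n \<omega>) s) (mixture_density \<pi>star s) \<le> e))"
proof -
  have p0: "except_prob P 0 (\<lambda>n \<omega>. \<pi>hat n \<omega> \<in> priors)" by (rule except_prob_AE) (simp_all add: \<pi>hat)
  have "except_prob P (d + 0) (\<lambda>n \<omega>. mean_hellinger n \<omega> \<le> e \<and> \<pi>hat n \<omega> \<in> priors)"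
    by (rule except_prob_conj[OF P hellinger_except_prob[OF e d] p0])
  then have "except_prob P d (\<lambda>n \<omega>. mean_hellinger n \<omega> \<le> e \<and> \<pi>hat n \<omega> \<in> priors)"
    by (simp only: add_0_right)
  then show ?thesis
  proof (rule except_prob_eventually_mono[OF _ eventually_gt_at_top[of "0::nat"]], intro conjI)
    fix n :: nat and \<omega>
    assume n: "0 < n" and ev: "mean_hellinger n \<omega> \<le> e \<and> \<pi>hat n \<omega> \<in> priors"
    then have le: "mean_hellinger n \<omega> \<le> e" and ph: "\<pi>hat n \<omega> \<in> priors" by blast+
    show "\<pi>hat n \<omega> \<in> priors" by (rule ph)
    obtain i where i: "i \<in> {1..n}" "hellinger_sq (mixture_density (\<pi>hat n \<omega>) (\<sigma> n i)) (mixture_density \<pi>star (\<sigma> n i)) \<le>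
      mean_hellinger n \<omega>"
      by (rule avg_ge_min[OF n])
    then show "\<exists>s\<in>{c..C}. hellinger_sq (mixture_density (\<pi>hat n \<omega>) s) (mixture_density \<pi>star s) \<le> e"
      using le \<sigma>[OF i(1)] by (intro bexI[of _ "\<sigma> n i"]) auto
  qed
qed

lemma prior_converges: "converges_weakly_in_prob P \<pi>hat \<pi>star"
  unfolding converges_weakly_in_prob_def
proof (intro allI impI)
  fix g :: "real \<Rightarrow> real" assume g: "continuous_on UNIV g"
  show "converges_in_prob P (\<lambda>n \<omega>. \<integral>t. g t \<partial>\<pi>hat n \<omega>) (\<integral>t. g t \<partial>\<pi>star)"
  proof (rule converges_of_except_prob[OF P])
    fix e d :: real assume e: "0 < e" and d: "0 < d"
    from hellinger_determines_integral[OF \<pi>star g e] obtain \<delta> where \<delta>: "0 < \<delta>"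
      "\<And>p s. p \<in> priors \<Longrightarrow> s \<in> {c..C} \<Longrightarrow> hellinger_sq (mixture_density p s) (mixture_density \<pi>star s) \<le> \<delta> \<Longrightarrow>
         \<bar>(\<integral>t. g t \<partial>p) - (\<integral>t. g t \<partial>\<pi>star)\<bar> \<le> e" by blast
    from hellinger_entry_except_prob[OF \<delta>(1) d]
    show "except_prob P d (\<lambda>n \<omega>. \<bar>(\<integral>t. g t \<partial>\<pi>hat n \<omega>) - (\<integral>t. g t \<partial>\<pi>star)\<bar> \<le> e)"
      by (rule except_prob_mono) (use \<delta>(2) in \<open>auto intro!: always_eventually\<close>)
  qed
qed

end

section \<open>Disintegration of joint laws\<close>

lemma integral_kernel_measurable:
  fixes f :: "'a \<Rightarrow> 'b \<Rightarrow> real"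
  assumes [measurable]: "(\<lambda>(x, y). f x y) \<in> borel_measurable (M \<Otimes>\<^sub>M N)"
    and L[measurable]: "L \<in> measurable M (subprob_algebra N)"
  shows "(\<lambda>x. \<integral>y. f x y \<partial>L x) \<in> borel_measurable M"
proof -
  note measurable_distr2[measurable]
  have "(\<lambda>x. integral\<^sup>L (distr (L x) (M \<Otimes>\<^sub>M N) (\<lambda>y. (x, y))) (\<lambda>(x, y). f x y)) \<in> borel_measurable M"
    by measurable
  then show ?thesis
  proof (rule measurable_cong[THEN iffD1, rotated])
    fix x assume x: "x \<in> space M"
    have [measurable_cong]: "sets (L x) = sets N" using L x by (rule sets_kernel)
    show "integral\<^sup>L (distr (L x) (M \<Otimes>\<^sub>M N) (\<lambda>y. (x, y))) (\<lambda>(x, y). f x y) = (\<integral>y. f x y \<partial>L x)"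
      using x by (subst integral_distr) auto
  qed
qed

lemma normal_measure_translate: "normal_measure t s = distr (normal_measure 0 s) borel (\<lambda>e. t + e)"
proof -
  have "normal_measure t s = density (distr lborel borel ((+) t)) (\<lambda>x. ennreal (normal_density t s x))"
    by (simp add: normal_measure_def lborel_distr_plus)
  also have "\<dots> = distr (density lborel (\<lambda>e. ennreal (normal_density t s (t + e)))) borel ((+) t)"
    by (rule density_distr) auto
  also have "(\<lambda>e. ennreal (normal_density t s (t + e))) = (\<lambda>e. ennreal (normal_density 0 s e))"
    by (simp add: normal_density_def)
  finally show ?thesis by (simp add: normal_measure_def)
qed

lemma normal_kernel_measurable:
  assumes "0 < s"
  shows "(\<lambda>t. normal_measure t s) \<in> borel \<rightarrow>\<^sub>M prob_algebra borel"
proof -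
  have "(\<lambda>t. distr (normal_measure 0 s) borel (\<lambda>e. t + e)) \<in> borel \<rightarrow>\<^sub>M prob_algebra borel"
  proof (rule measurable_distr_prob_space2[where M=borel])
    show "(\<lambda>t. normal_measure 0 s) \<in> borel \<rightarrow>\<^sub>M prob_algebra borel"
      using prob_space_normal_measure[OF assms] by (intro measurable_const) (auto simp: space_prob_algebra)
  qed measurable
  also have "(\<lambda>t. distr (normal_measure 0 s) borel (\<lambda>e. t + e)) = (\<lambda>t. normal_measure t s)"
    by (rule ext, rule normal_measure_translate[symmetric])
  finally show ?thesis .
qed

text \<open>\<open>K\<close> is a conditional law of \<open>Y\<close> given \<open>\<theta>\<close>, expressed by integrals instead of measures of
  rectangles.\<close>

definition disintegrates :: "'a measure \<Rightarrow> ('a \<Rightarrow> real) \<Rightarrow> ('a \<Rightarrow> real) \<Rightarrow> (real \<Rightarrow> real measure) \<Rightarrow> bool" where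
  "disintegrates P Y \<theta> K \<longleftrightarrow> (\<forall>f\<in>borel_measurable (borel \<Otimes>\<^sub>M borel).
     (\<integral>\<^sup>+\<omega>. f (\<theta> \<omega>, Y \<omega>) \<partial>P) = (\<integral>\<^sup>+t. (\<integral>\<^sup>+x. f (t, x) \<partial>K t) \<partial>distr P borel \<theta>))"

text \<open>Rectangles generate the product sigma-algebra and are stable under intersection.\<close>

lemma is_cond_law_disintegrates:
  assumes P: "prob_space P" and [measurable]: "\<theta> \<in> borel_measurable P" "Y \<in> borel_measurable P"
    and K: "is_cond_law P Y \<theta> K"
  shows "disintegrates P Y \<theta> K"
proof -
  interpret prob_space P by fact
  define \<pi> where "\<pi> = distr P borel \<theta>"
  interpret \<pi>: prob_space \<pi> unfolding \<pi>_def by (rule prob_space_distr) simp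
  have [measurable_cong]: "sets \<pi> = sets borel" and sp: "space \<pi> = UNIV" by (simp_all add: \<pi>_def)
  have Km[measurable]: "K \<in> borel \<rightarrow>\<^sub>M prob_algebra borel" using K by (simp add: is_cond_law_def)
  have sK: "sets (K t) = sets borel" for t using sets_kernel[OF measurable_prob_algebraD[OF Km]] by simp
  define D where "D t = distr (K t) (borel \<Otimes>\<^sub>M borel) (\<lambda>x. (t, x))" for t
  have D[measurable]: "D \<in> borel \<rightarrow>\<^sub>M prob_algebra (borel \<Otimes>\<^sub>M borel)"
    unfolding D_def[abs_def] by (rule measurable_distr_prob_space2[OF Km]) measurable
  have D': "D \<in> \<pi> \<rightarrow>\<^sub>M subprob_algebra (borel \<Otimes>\<^sub>M borel)"
    using measurable_prob_algebraD[OF D] by measurable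
  have nnD: "(\<integral>\<^sup>+z. f z \<partial>D t) = (\<integral>\<^sup>+x. f (t, x) \<partial>K t)" if [measurable]: "f \<in> borel_measurable (borel \<Otimes>\<^sub>M borel)" for f t
    unfolding D_def using sK[of t, measurable_cong] by (subst nn_integral_distr) auto
  let ?J = "distr P (borel \<Otimes>\<^sub>M borel) (\<lambda>\<omega>. (\<theta> \<omega>, Y \<omega>))"
  have "?J = \<pi> \<bind> D"
  proof (rule measure_eqI_generator_eq[OF Int_stable_pair_measure_generator[of borel borel]])
    show "{a \<times> b |a b. a \<in> sets (borel::real measure) \<and> b \<in> sets (borel::real measure)} \<subseteq> Pow UNIV" by simp
    fix Q :: "(real \<times> real) set" assume "Q \<in> {a \<times> b |a b. a \<in> sets (borel::real measure) \<and> b \<in> sets (borel::real measure)}"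
    then obtain A B where Q: "Q = A \<times> B" and [measurable]: "A \<in> sets borel" "B \<in> sets borel" by blast
    have "emeasure ?J Q = emeasure P {\<omega> \<in> space P. \<theta> \<omega> \<in> A \<and> Y \<omega> \<in> B}"
      unfolding Q by (subst emeasure_distr) (auto intro!: arg_cong[where f="emeasure P"])
    also have "\<dots> = (\<integral>\<^sup>+t. emeasure (K t) B * indicator A t \<partial>\<pi>)"
      using K by (simp add: is_cond_law_def \<pi>_def)
    also have "\<dots> = (\<integral>\<^sup>+t. emeasure (D t) Q \<partial>\<pi>)"
    proof (rule nn_integral_cong)
      fix t
      note sK[of t, measurable_cong]
      have "emeasure (D t) Q = emeasure (K t) ((\<lambda>x. (t, x)) -` Q)"
        unfolding D_def Q by (subst emeasure_distr) (auto simp: sets_eq_imp_space_eq[OF sK])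
      also have "(\<lambda>x. (t, x)) -` Q = (if t \<in> A then B else {})" by (auto simp: Q)
      finally show "emeasure (K t) B * indicator A t = emeasure (D t) Q" by (simp add: indicator_def)
    qed
    also have "\<dots> = emeasure (\<pi> \<bind> D) Q"
      by (rule emeasure_bind[symmetric, OF _ D']) (auto simp: sp Q)
    finally show "emeasure ?J Q = emeasure (\<pi> \<bind> D) Q" .
  next
    show "sets ?J = sigma_sets UNIV {a \<times> b |a b. a \<in> sets (borel::real measure) \<and> b \<in> sets (borel::real measure)}"
      using sets_pair_measure[of "borel::real measure" "borel::real measure"] by simp
    show "sets (\<pi> \<bind> D) = sigma_sets UNIV {a \<times> b |a b. a \<in> sets (borel::real measure) \<and> b \<in> sets (borel::real measure)}"
      using sets_bind_measurable[OF D'] sets_pair_measure[of "borel::real measure" "borel::real measure"] by (simp add: sp)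
    show "range (\<lambda>_::nat. UNIV) \<subseteq> {a \<times> b |a b. a \<in> sets (borel::real measure) \<and> b \<in> sets (borel::real measure)}"
      by (auto intro!: exI[of _ UNIV])
    interpret J: prob_space ?J by (rule prob_space_distr) simp
    show "emeasure ?J UNIV \<noteq> \<infinity>" using J.emeasure_finite by simp
  qed auto
  then show ?thesis unfolding disintegrates_def \<pi>_def[symmetric]
  proof (intro ballI)
    fix f :: "real \<times> real \<Rightarrow> ennreal" assume J: "?J = \<pi> \<bind> D" and f[measurable]: "f \<in> borel_measurable (borel \<Otimes>\<^sub>M borel)"
    have "(\<integral>\<^sup>+\<omega>. f (\<theta> \<omega>, Y \<omega>) \<partial>P) = (\<integral>\<^sup>+z. f z \<partial>?J)" by (subst nn_integral_distr) auto
    also have "\<dots> = (\<integral>\<^sup>+t. (\<integral>\<^sup>+z. f z \<partial>D t) \<partial>\<pi>)" unfolding J by (rule nn_integral_bind[OF f D'])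
    finally show "(\<integral>\<^sup>+\<omega>. f (\<theta> \<omega>, Y \<omega>) \<partial>P) = (\<integral>\<^sup>+t. (\<integral>\<^sup>+x. f (t, x) \<partial>K t) \<partial>\<pi>)" by (simp add: nnD f)
  qed
qed

lemma additive_noise_disintegrates:
  assumes P: "prob_space P" and [measurable]: "\<theta> \<in> borel_measurable P" "\<epsilon> \<in> borel_measurable P"
    and ind: "prob_space.indep_var P borel \<epsilon> borel \<theta>" and law: "distr P borel \<epsilon> = normal_measure 0 s" and s: "0 < s"
    and Z: "\<And>\<omega>. \<omega> \<in> space P \<Longrightarrow> Z \<omega> = \<theta> \<omega> + \<epsilon> \<omega>"
  shows "disintegrates P Z \<theta> (\<lambda>t. normal_measure t s)"
  unfolding disintegrates_def
proof (intro ballI)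
  fix f :: "real \<times> real \<Rightarrow> ennreal" assume f[measurable]: "f \<in> borel_measurable (borel \<Otimes>\<^sub>M borel)"
  interpret prob_space P by fact
  define \<pi> where "\<pi> = distr P borel \<theta>"
  interpret \<pi>: prob_space \<pi> unfolding \<pi>_def by (rule prob_space_distr) simp
  interpret N: prob_space "normal_measure 0 s" by (rule prob_space_normal_measure[OF s])
  interpret pair_sigma_finite "normal_measure 0 s" \<pi> ..
  have [measurable_cong]: "sets \<pi> = sets borel" by (simp add: \<pi>_def)
  have J: "normal_measure 0 s \<Otimes>\<^sub>M \<pi> = distr P (borel \<Otimes>\<^sub>M borel) (\<lambda>\<omega>. (\<epsilon> \<omega>, \<theta> \<omega>))"
    using ind unfolding indep_var_distribution_eq law \<pi>_def by simp
  have "(\<integral>\<^sup>+\<omega>. f (\<theta> \<omega>, Z \<omega>) \<partial>P) = (\<integral>\<^sup>+\<omega>. f (\<theta> \<omega>, \<theta> \<omega> + \<epsilon> \<omega>) \<partial>P)"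
    by (rule nn_integral_cong) (simp add: Z)
  also have "\<dots> = (\<integral>\<^sup>+z. f (snd z, snd z + fst z) \<partial>(normal_measure 0 s \<Otimes>\<^sub>M \<pi>))"
    unfolding J by (subst nn_integral_distr) auto
  also have "\<dots> = (\<integral>\<^sup>+t. (\<integral>\<^sup>+e. f (t, t + e) \<partial>normal_measure 0 s) \<partial>\<pi>)"
    by (subst nn_integral_snd[symmetric]) auto
  also have "\<dots> = (\<integral>\<^sup>+t. (\<integral>\<^sup>+x. f (t, x) \<partial>normal_measure t s) \<partial>\<pi>)"
  proof (rule nn_integral_cong)
    fix t
    show "(\<integral>\<^sup>+e. f (t, t + e) \<partial>normal_measure 0 s) = (\<integral>\<^sup>+x. f (t, x) \<partial>normal_measure t s)"
      by (subst normal_measure_translate[of t], subst nn_integral_distr) auto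
  qed
  finally show "(\<integral>\<^sup>+\<omega>. f (\<theta> \<omega>, Z \<omega>) \<partial>P) = (\<integral>\<^sup>+t. (\<integral>\<^sup>+x. f (t, x) \<partial>normal_measure t s) \<partial>distr P borel \<theta>)"
    by (simp add: \<pi>_def)
qed

lemma expectation_disintegrates:
  fixes G :: "real \<times> real \<Rightarrow> real"
  assumes P: "prob_space P" and [measurable]: "\<theta> \<in> borel_measurable P" "Y \<in> borel_measurable P"
    and d: "disintegrates P Y \<theta> K" and K: "K \<in> borel \<rightarrow>\<^sub>M prob_algebra borel"
    and G[measurable]: "G \<in> borel_measurable (borel \<Otimes>\<^sub>M borel)" and bnd: "\<And>z. 0 \<le> G z" "\<And>z. G z \<le> B"
  shows "(\<lambda>t. \<integral>x. G (t, x) \<partial>K t) \<in> borel_measurable borel"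
    and "(\<integral>\<omega>. G (\<theta> \<omega>, Y \<omega>) \<partial>P) = (\<integral>t. (\<integral>x. G (t, x) \<partial>K t) \<partial>distr P borel \<theta>)"
proof -
  interpret prob_space P by fact
  interpret \<pi>: prob_space "distr P borel \<theta>" by (rule prob_space_distr) simp
  have Kp: "prob_space (K t)" "sets (K t) = sets borel" for t
    using measurable_space[OF K, of t] by (auto simp: space_prob_algebra)
  let ?a = "\<lambda>t. \<integral>x. G (t, x) \<partial>K t"
  show am[measurable]: "?a \<in> borel_measurable borel"
    by (rule integral_kernel_measurable[where N=borel, OF _ measurable_prob_algebraD[OF K]]) simp
  have intK: "integrable (K t) (\<lambda>x. G (t, x))" for t
  proof -
    interpret Kt: prob_space "K t" by (rule Kp)
    note Kp(2)[of t, measurable_cong]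
    show ?thesis by (rule Kt.integrable_const_bound[of _ B]) (use bnd in auto)
  qed
  have a: "0 \<le> ?a t" "?a t \<le> B" for t
  proof -
    interpret Kt: prob_space "K t" by (rule Kp)
    show "0 \<le> ?a t" using bnd by (intro integral_nonneg_AE) auto
    have "?a t \<le> (\<integral>x. B \<partial>K t)" by (rule integral_mono[OF intK]) (use bnd in auto)
    then show "?a t \<le> B" by (simp add: Kt.prob_space)
  qed
  have "ennreal (\<integral>\<omega>. G (\<theta> \<omega>, Y \<omega>) \<partial>P) = (\<integral>\<^sup>+\<omega>. ennreal (G (\<theta> \<omega>, Y \<omega>)) \<partial>P)"
  proof (rule nn_integral_eq_integral[symmetric])
    show "integrable P (\<lambda>\<omega>. G (\<theta> \<omega>, Y \<omega>))"
      by (rule integrable_const_bound[of _ B]) (use bnd in auto)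
  qed (use bnd in auto)
  also have "\<dots> = (\<integral>\<^sup>+t. (\<integral>\<^sup>+x. ennreal (G (t, x)) \<partial>K t) \<partial>distr P borel \<theta>)"
    using d[unfolded disintegrates_def, rule_format, of "\<lambda>z. ennreal (G z)"] by simp
  also have "\<dots> = (\<integral>\<^sup>+t. ennreal (?a t) \<partial>distr P borel \<theta>)"
    using bnd intK by (intro nn_integral_cong nn_integral_eq_integral) auto
  also have "\<dots> = ennreal (\<integral>t. ?a t \<partial>distr P borel \<theta>)"
  proof (rule nn_integral_eq_integral)
    show "integrable (distr P borel \<theta>) ?a"
      by (rule \<pi>.integrable_const_bound[of _ B]) (use a in auto)
  qed (use a in auto)
  finally show "(\<integral>\<omega>. G (\<theta> \<omega>, Y \<omega>) \<partial>P) = (\<integral>t. ?a t \<partial>distr P borel \<theta>)"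
    using bnd a by (subst (asm) ennreal_inj) (auto intro!: integral_nonneg_AE)
qed

section \<open>Convergence of the regret\<close>

context gaussian_location_model
begin

lemma posterior_mean_measurable:
  assumes "p \<in> priors" "c \<le> s"
  shows "posterior_mean p s \<in> borel_measurable borel"
proof (rule borel_measurable_continuous_onI, rule continuous_at_imp_continuous_on, rule ballI)
  fix x
  let ?L = "4 * M * (M / c\<^sup>2)"
  show "isCont (posterior_mean p s) x" unfolding isCont_def
  proof (rule LIM_zero_cancel, rule Lim_null_comparison)
    show "\<forall>\<^sub>F y in at x. norm (posterior_mean p s y - posterior_mean p s x) \<le> ?L * \<bar>y - x\<bar>"
      using posterior_mean_lipschitz[OF assms] by (auto intro!: always_eventually simp: mult.assoc)
    show "((\<lambda>y. ?L * \<bar>y - x\<bar>) \<longlongrightarrow> 0) (at x)"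
      by (rule tendsto_mult_right_zero, rule tendsto_rabs_zero, rule LIM_zero, rule tendsto_ident_at)
  qed
qed

definition loss_lipschitz :: real where
  "loss_lipschitz = 4 * M * (4 * M * (M / c\<^sup>2))"

lemma loss_lipschitz_pos: "0 < loss_lipschitz"
  unfolding loss_lipschitz_def using M_pos c_pos by simp

text \<open>Clipping the location makes the loss bounded everywhere. Under a prior on \<open>[-M, M]\<close> it changes
  nothing almost surely.\<close>

definition loss :: "real measure \<Rightarrow> real \<Rightarrow> real \<times> real \<Rightarrow> real" where
  "loss p s z = (clip M (fst z) - posterior_mean p s (snd z))\<^sup>2"

lemma loss_props:
  assumes p: "p \<in> priors" and s: "c \<le> s"
  shows "loss p s \<in> borel_measurable (borel \<Otimes>\<^sub>M borel)" "0 \<le> loss p s z" "loss p s z \<le> 4 * M\<^sup>2"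
    and "\<bar>loss p s (t, x) - loss p s (t, y)\<bar> \<le> loss_lipschitz * \<bar>x - y\<bar>"
proof -
  have cb: "\<bar>clip M u\<bar> \<le> M" for u using M_pos by (intro clip_bounds) simp
  have hb: "\<bar>posterior_mean p s u\<bar> \<le> M" for u by (rule posterior_mean_bounded[OF p s])
  have [measurable]: "clip M \<in> borel_measurable borel" by (intro borel_measurable_continuous_onI clip_continuous)
  note posterior_mean_measurable[OF p s, measurable]
  show "loss p s \<in> borel_measurable (borel \<Otimes>\<^sub>M borel)" unfolding loss_def[abs_def] by measurable
  show "0 \<le> loss p s z" by (simp add: loss_def)
  have "\<bar>clip M (fst z) - posterior_mean p s (snd z)\<bar> \<le> 2 * M" using cb[of "fst z"] hb[of "snd z"] by linarith
  from power_mono[OF this, of 2] show "loss p s z \<le> 4 * M\<^sup>2" by (simp add: loss_def power_mult_distrib)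
  let ?u = "clip M t" and ?h = "posterior_mean p s x" and ?k = "posterior_mean p s y"
  have "loss p s (t, x) - loss p s (t, y) = (?k - ?h) * (2 * ?u - ?h - ?k)"
    by (simp add: loss_def power2_eq_square algebra_simps)
  then have "\<bar>loss p s (t, x) - loss p s (t, y)\<bar> = \<bar>?h - ?k\<bar> * \<bar>2 * ?u - ?h - ?k\<bar>" by (simp add: abs_mult abs_minus_commute)
  also have "\<dots> \<le> (4 * M * (M / c\<^sup>2 * \<bar>x - y\<bar>)) * (4 * M)"
  proof (rule mult_mono[OF posterior_mean_lipschitz[OF p s]])
    show "\<bar>2 * ?u - ?h - ?k\<bar> \<le> 4 * M" using cb[of t] hb[of x] hb[of y] by linarith
  qed (use M_pos in auto)
  finally show "\<bar>loss p s (t, x) - loss p s (t, y)\<bar> \<le> loss_lipschitz * \<bar>x - y\<bar>"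
    by (simp add: loss_lipschitz_def mult_ac)
qed

end

context gaussian_array
begin

abbreviation denoiser :: "nat \<Rightarrow> nat \<Rightarrow> 'a \<Rightarrow> real" where
  "denoiser n i \<omega> \<equiv> posterior_mean (\<pi>hat n \<omega>) (\<sigma>hat n i \<omega>) (X n i \<omega>)"

abbreviation bayes :: "nat \<Rightarrow> nat \<Rightarrow> real \<Rightarrow> real" where
  "bayes n i \<equiv> posterior_mean \<pi>star (\<sigma> n i)"

abbreviation plug_in_error :: "nat \<Rightarrow> nat \<Rightarrow> 'a \<Rightarrow> real" where
  "plug_in_error n i \<omega> \<equiv> \<bar>denoiser n i \<omega> - bayes n i (X n i \<omega>)\<bar>"

text \<open>The prior is replaced first, at the estimated scale: closeness of posterior means on \<open>[-T, T]\<close>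
  follows from consistency, and outside the crude bound \<open>2 M\<close> suffices. Then the scale is replaced.\<close>

lemma plug_in_error_except_prob:
  assumes e: "0 < e" and d: "0 < d"
  shows "except_prob P d (\<lambda>n \<omega>. avg n (\<lambda>i.
    plug_in_error n i \<omega>) \<le> e)"
proof -
  note sc = scale_const_pos
  have d3: "0 < d / 3" using d by simp
  have "0 < e / (8 * M)" using e M_pos by simp
  from X_tail_except_prob[OF this d3, of 1] obtain T where T: "1 \<le> T"
    and 1: "except_prob P (d / 3) (\<lambda>n \<omega>. mean_tail T n \<omega> \<le> e / (8 * M))" .
  have e4: "0 < e / 4" using e by simp
  obtain \<delta> where \<delta>: "0 < \<delta>" "\<forall>p\<in>priors. \<forall>s\<in>{c..C}.
      hellinger_sq (mixture_density p s) (mixture_density \<pi>star s) \<le> \<delta> \<longrightarrow>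
      (\<forall>x\<in>{-T..T}. \<forall>s'\<in>{c..C}. \<bar>posterior_mean p s' x - posterior_mean \<pi>star s' x\<bar> \<le> e / 4)"
    using hellinger_determines_posterior_mean[OF \<pi>star e4, of T] by blast
  note 2 = hellinger_entry_except_prob[OF \<delta>(1) d3]
  have e8: "0 < e / (8 * M * scale_const)" using e M_pos sc by simp
  note 3 = \<sigma>hat_weighted_except_prob[OF e8 d3]
  have 4: "except_prob P 0 (\<lambda>n \<omega>. good_scales n \<omega>)"
    using \<sigma>hat_bounds by (rule except_prob_AE) simp
  have "except_prob P (d / 3 + d / 3 + d / 3 + 0) (\<lambda>n \<omega>. avg n (\<lambda>i.
    plug_in_error n i \<omega>) \<le> e)"
    using except_prob_conj[OF P except_prob_conj[OF P except_prob_conj[OF P 1 2] 3] 4]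
  proof (rule except_prob_mono, intro always_eventually allI impI, elim conjE bexE)
    fix n \<omega> s
    assume tail: "mean_tail T n \<omega> \<le> e / (8 * M)" and ph: "\<pi>hat n \<omega> \<in> priors"
      and s: "s \<in> {c..C}" "hellinger_sq (mixture_density (\<pi>hat n \<omega>) s) (mixture_density \<pi>star s) \<le> \<delta>"
      and w: "scale_error n \<omega> \<le> e / (8 * M * scale_const)"
      and b: "good_scales n \<omega>"
    have close: "\<bar>posterior_mean (\<pi>hat n \<omega>) s' x - posterior_mean \<pi>star s' x\<bar> \<le> e / 4" if "\<bar>x\<bar> \<le> T" "c \<le> s'" "s' \<le> C" for x s'
      using \<delta>(2)[rule_format, OF ph s(1) s(2), of x s'] that by (auto simp: abs_le_iff)
    let ?D = "\<lambda>i. plug_in_error n i \<omega>"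
    have "avg n ?D \<le> avg n (\<lambda>i. (e / 4 + 2 * M * sq_tail T (X n i \<omega>))
        + 4 * M * scale_const * ((1 + (X n i \<omega>)\<^sup>2) * \<bar>\<sigma>hat n i \<omega> - \<sigma> n i\<bar>))"
    proof (rule avg_mono)
      fix i assume i: "i \<in> {1..n}"
      then have sh: "c \<le> \<sigma>hat n i \<omega>" "\<sigma>hat n i \<omega> \<le> C" using b by blast+
      let ?x = "X n i \<omega>"
      have "\<bar>posterior_mean (\<pi>hat n \<omega>) (\<sigma>hat n i \<omega>) ?x - posterior_mean \<pi>star (\<sigma>hat n i \<omega>) ?x\<bar> \<le> e / 4 + 2 * M * sq_tail T ?x"
      proof (cases "T \<le> \<bar>?x\<bar>")
        case True
        then have "1 \<le> ?x\<^sup>2" using T power_mono[of 1 "\<bar>?x\<bar>" 2] by simp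
        then have "2 * M * 1 \<le> 2 * M * sq_tail T ?x" using True M_pos by (intro mult_left_mono) (auto simp: sq_tail_def)
        moreover have "\<bar>posterior_mean (\<pi>hat n \<omega>) (\<sigma>hat n i \<omega>) ?x - posterior_mean \<pi>star (\<sigma>hat n i \<omega>) ?x\<bar> \<le> 2 * M"
          using posterior_mean_bounded[OF ph sh(1), of ?x] posterior_mean_bounded[OF \<pi>star sh(1), of ?x] by linarith
        ultimately show ?thesis using e by linarith
      next
        case False
        then show ?thesis using close[of ?x "\<sigma>hat n i \<omega>"] sh by (simp add: sq_tail_def)
      qed
      moreover have "\<bar>posterior_mean \<pi>star (\<sigma>hat n i \<omega>) ?x - bayes n i ?x\<bar>
          \<le> 4 * M * scale_const * ((1 + ?x\<^sup>2) * \<bar>\<sigma>hat n i \<omega> - \<sigma> n i\<bar>)"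
        using posterior_mean_scale[OF \<pi>star sh(1) \<sigma>(1)[OF i], of ?x] by (simp only: mult.assoc)
      ultimately show "?D i \<le> (e / 4 + 2 * M * sq_tail T ?x) + 4 * M * scale_const * ((1 + ?x\<^sup>2) * \<bar>\<sigma>hat n i \<omega> - \<sigma> n i\<bar>)"
        by linarith
    qed
    also have "\<dots> \<le> (e / 4 + 2 * M * (e / (8 * M))) + 4 * M * scale_const * (e / (8 * M * scale_const))"
      unfolding avg_add avg_cmult using tail w M_pos sc avg_const_le[of "e / 4" n] e
      by (intro add_mono mult_left_mono) auto
    also have "\<dots> = e" using M_pos sc by simp
    finally show "avg n ?D \<le> e" .
  qed
  then show ?thesis by simp
qed

lemma denoiser_measurable:
  assumes i: "i \<in> {1..n}"
  shows "(\<lambda>\<omega>. denoiser n i \<omega>) \<in> borel_measurable (P n)"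
proof -
  note [measurable] = X[OF i] \<sigma>hat[OF i]
  have L: "\<pi>hat n \<in> P n \<rightarrow>\<^sub>M subprob_algebra borel" by (rule measurable_prob_algebraD[OF \<pi>hat_measurable])
  show ?thesis unfolding posterior_mean_def mixture_density_def
  proof (rule borel_measurable_divide)
    show "(\<lambda>\<omega>. \<integral>t. t * \<phi> (\<sigma>hat n i \<omega>) (X n i \<omega> - t) \<partial>\<pi>hat n \<omega>) \<in> borel_measurable (P n)"
      by (rule integral_kernel_measurable[OF _ L]) (unfold normal_density_def, measurable)
    show "(\<lambda>\<omega>. \<integral>t. \<phi> (\<sigma>hat n i \<omega>) (X n i \<omega> - t) \<partial>\<pi>hat n \<omega>) \<in> borel_measurable (P n)"
      by (rule integral_kernel_measurable[OF _ L]) (unfold normal_density_def, measurable)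
  qed
qed

lemma denoiser_bounded:
  "AE \<omega> in P n. \<forall>i\<in>{1..n}. \<bar>denoiser n i \<omega>\<bar> \<le> M"
  using \<pi>hat[of n] \<sigma>hat_bounds[of n] by eventually_elim (auto intro!: posterior_mean_bounded)

lemma bayes_measurable:
  assumes i: "i \<in> {1..n}" and [measurable]: "Y \<in> borel_measurable (P n)"
  shows "(\<lambda>\<omega>. bayes n i (Y \<omega>)) \<in> borel_measurable (P n)"
  using posterior_mean_measurable[OF \<pi>star \<sigma>(1)[OF i]] by measurable

text \<open>A bounded variable that is small off an event of small probability has a small mean.\<close>

lemma plug_in_error_mean:
  assumes e: "0 < e"
  shows "\<forall>\<^sub>F n in sequentially. (\<integral>\<omega>. avg n (\<lambda>i.
    plug_in_error n i \<omega>) \<partial>P n) \<le> e"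
proof -
  have "0 < e / 2" "0 < e / (4 * M)" using e M_pos by auto
  from plug_in_error_except_prob[OF this] show ?thesis unfolding except_prob_def
  proof eventually_elim
    case (elim n)
    let ?Y = "\<lambda>\<omega>. avg n (\<lambda>i. plug_in_error n i \<omega>)"
    from elim obtain B where B: "B \<in> sets (P n)" "measure (P n) B \<le> e / (4 * M)" "AE \<omega> in P n. \<omega> \<notin> B \<longrightarrow> ?Y \<omega> \<le> e / 2" by blast
    interpret prob_space "P n" by (rule P)
    have Ym: "?Y \<in> borel_measurable (P n)"
      by (intro avg_measurable borel_measurable_abs borel_measurable_diff denoiser_measurable bayes_measurable X)
    have Yb: "AE \<omega> in P n. ?Y \<omega> \<le> 2 * M"
      using denoiser_bounded[of n]
    proof eventually_elim
      case (elim \<omega>)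
      have "?Y \<omega> \<le> avg n (\<lambda>_. 2 * M)"
      proof (rule avg_mono)
        fix i assume i: "i \<in> {1..n}"
        show "plug_in_error n i \<omega> \<le> 2 * M"
          using elim[rule_format, OF i] posterior_mean_bounded[OF \<pi>star \<sigma>(1)[OF i], of "X n i \<omega>"] by linarith
      qed
      also have "\<dots> \<le> 2 * M" using M_pos by (intro avg_const_le) simp
      finally show ?case .
    qed
    have Y0: "0 \<le> ?Y \<omega>" for \<omega> by (rule avg_nonneg) simp
    have Yi: "integrable (P n) ?Y"
      by (rule integrable_const_bound[of _ "2 * M"]) (use Yb Ym Y0 in auto)
    have "(\<integral>\<omega>. ?Y \<omega> \<partial>P n) \<le> (\<integral>\<omega>. e / 2 + 2 * M * indicator B \<omega> \<partial>P n)"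
    proof (rule integral_mono_AE[OF Yi])
      show "integrable (P n) (\<lambda>\<omega>. e / 2 + 2 * M * indicator B \<omega>)" using B(1) by (auto simp: emeasure_eq_measure)
      show "AE \<omega> in P n. ?Y \<omega> \<le> e / 2 + 2 * M * indicator B \<omega>"
        using Yb B(3) by eventually_elim (use e M_pos in \<open>auto simp: indicator_def\<close>)
    qed
    also have "\<dots> = e / 2 + 2 * M * prob B" using B(1) by (simp add: prob_space emeasure_eq_measure)
    also have "\<dots> \<le> e / 2 + 2 * M * (e / (4 * M))" using B(2) M_pos by (intro add_left_mono mult_left_mono) auto
    also have "\<dots> = e" using M_pos by simp
    finally show ?case .
  qed
qed

context
  fixes \<theta> Z :: "nat \<Rightarrow> nat \<Rightarrow> 'a \<Rightarrow> real" and K :: "nat \<Rightarrow> nat \<Rightarrow> real \<Rightarrow> real measure"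
  assumes \<theta>: "\<And>n i. i \<in> {1..n} \<Longrightarrow> \<theta> n i \<in> borel_measurable (P n)"
    and law_\<theta>: "\<And>n i. i \<in> {1..n} \<Longrightarrow> distr (P n) borel (\<theta> n i) = \<pi>star"
    and Z: "\<And>n i. i \<in> {1..n} \<Longrightarrow> Z n i \<in> borel_measurable (P n)"
    and Z_law: "\<And>n i. i \<in> {1..n} \<Longrightarrow> disintegrates (P n) (Z n i) (\<theta> n i) (\<lambda>t. normal_measure t (\<sigma> n i))"
    and X_law: "\<And>n i. i \<in> {1..n} \<Longrightarrow> disintegrates (P n) (X n i) (\<theta> n i) (K n i)"
    and K: "\<And>n i. i \<in> {1..n} \<Longrightarrow> K n i \<in> borel \<rightarrow>\<^sub>M prob_algebra borel"
    and W: "W_dist K \<pi>star \<sigma> \<longlonglongrightarrow> 0"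
begin

abbreviation bayes_risk :: "nat \<Rightarrow> nat \<Rightarrow> ('a \<Rightarrow> real) \<Rightarrow> real" where
  "bayes_risk n i Y \<equiv> (\<integral>\<omega>. \<bar>\<theta> n i \<omega> - bayes n i (Y \<omega>)\<bar>\<^sup>2 \<partial>P n)"

abbreviation W2_sq :: "nat \<Rightarrow> nat \<Rightarrow> ennreal" where
  "W2_sq n i \<equiv> (\<integral>\<^sup>+t. (wasserstein 2 (K n i t) (normal_measure t (\<sigma> n i)))\<^sup>2 \<partial>\<pi>star)"

lemma \<theta>_bounded:
  assumes i: "i \<in> {1..n}"
  shows "AE \<omega> in P n. \<bar>\<theta> n i \<omega>\<bar> \<le> M"
proof -
  have "AE t in distr (P n) borel (\<theta> n i). \<bar>t\<bar> \<le> M" unfolding law_\<theta>[OF i] by (rule priorD(4)[OF \<pi>star])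
  then show ?thesis using \<theta>[OF i] by (subst (asm) AE_distr_iff) auto
qed

lemma risk_eq_loss:
  assumes i: "i \<in> {1..n}" and Y: "Y \<in> borel_measurable (P n)"
  shows "bayes_risk n i Y = (\<integral>\<omega>. loss \<pi>star (\<sigma> n i) (\<theta> n i \<omega>, Y \<omega>) \<partial>P n)"
proof (rule integral_cong_AE)
  note [measurable] = \<theta>[OF i] Y bayes_measurable[OF i Y] loss_props(1)[OF \<pi>star \<sigma>(1)[OF i]]
  show "(\<lambda>\<omega>. \<bar>\<theta> n i \<omega> - bayes n i (Y \<omega>)\<bar>\<^sup>2) \<in> borel_measurable (P n)" by measurable
  show "(\<lambda>\<omega>. loss \<pi>star (\<sigma> n i) (\<theta> n i \<omega>, Y \<omega>)) \<in> borel_measurable (P n)" by measurable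
  show "AE \<omega> in P n. \<bar>\<theta> n i \<omega> - bayes n i (Y \<omega>)\<bar>\<^sup>2 = loss \<pi>star (\<sigma> n i) (\<theta> n i \<omega>, Y \<omega>)"
    using \<theta>_bounded[OF i] by eventually_elim (simp add: loss_def clip_id)
qed

text \<open>Given \<open>\<theta>\<close>, the means of the loss under the two conditional laws differ by at most a multiple of
  their Wasserstein distance. The number \<open>D\<close> is the integral of a measurable minorant of the squared
  distance; the squared distance itself may fail to be measurable in \<open>\<theta>\<close>, and its nonnegative integral
  is then only a lower integral. The bound \<open>e + D / e\<close> with a free \<open>e\<close> stands in for \<open>sqrt D\<close>, and is linear
  in \<open>D\<close>, so that it can be averaged.\<close>

lemma bayes_risk_diff:
  assumes i: "i \<in> {1..n}" and e: "0 < e"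
  obtains D where "0 \<le> D" "ennreal D \<le> (W2_sq n i)"
    and "\<bar>bayes_risk n i (X n i)
      - bayes_risk n i (Z n i)\<bar> \<le> loss_lipschitz * (e + D / e)"
proof -
  interpret \<pi>: prob_space \<pi>star by (rule priorD(1)[OF \<pi>star])
  have [measurable_cong]: "sets \<pi>star = sets borel" by (rule priorD(2)[OF \<pi>star])
  let ?G = "loss \<pi>star (\<sigma> n i)" and ?L = loss_lipschitz
  note G = loss_props[OF \<pi>star \<sigma>(1)[OF i]]
  have s0: "0 < \<sigma> n i" using \<sigma>(1)[OF i] c_pos by simp
  define a where "a t = (\<integral>x. ?G (t, x) \<partial>K n i t)" for t
  define b where "b t = (\<integral>x. ?G (t, x) \<partial>normal_measure t (\<sigma> n i))" for t
  have a: "a \<in> borel_measurable borel" "(\<integral>\<omega>. ?G (\<theta> n i \<omega>, X n i \<omega>) \<partial>P n) = (\<integral>t. a t \<partial>\<pi>star)"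
    using expectation_disintegrates[OF P \<theta>[OF i] X[OF i] X_law[OF i] K[OF i] G(1) G(2) G(3)]
    unfolding a_def[abs_def] law_\<theta>[OF i] by auto
  have b: "b \<in> borel_measurable borel" "(\<integral>\<omega>. ?G (\<theta> n i \<omega>, Z n i \<omega>) \<partial>P n) = (\<integral>t. b t \<partial>\<pi>star)"
    using expectation_disintegrates[OF P \<theta>[OF i] Z[OF i] Z_law[OF i] normal_kernel_measurable[OF s0] G(1) G(2) G(3)]
    unfolding b_def[abs_def] law_\<theta>[OF i] by auto
  note [measurable] = a(1) b(1)
  have Kp: "prob_space (K n i t)" "sets (K n i t) = sets borel" for t
    using measurable_space[OF K[OF i], of t] by (auto simp: space_prob_algebra)
  have mean_bound: "0 \<le> (\<integral>x. ?G (t, x) \<partial>\<rho>)" "(\<integral>x. ?G (t, x) \<partial>\<rho>) \<le> 4 * M\<^sup>2"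
    if \<rho>: "prob_space \<rho>" "sets \<rho> = sets borel" for \<rho> t
  proof -
    interpret prob_space \<rho> by (rule \<rho>)
    note [measurable_cong] = \<rho>(2)
    note [measurable] = G(1)
    show "0 \<le> (\<integral>x. ?G (t, x) \<partial>\<rho>)" using G(2) by (intro integral_nonneg_AE) auto
    have "(\<integral>x. ?G (t, x) \<partial>\<rho>) \<le> (\<integral>x. 4 * M\<^sup>2 \<partial>\<rho>)"
    proof (rule integral_mono)
      show "integrable \<rho> (\<lambda>x. ?G (t, x))" by (rule integrable_const_bound[of _ "4 * M\<^sup>2"]) (use G(2,3) in auto)
    qed (use G(3) in auto)
    then show "(\<integral>x. ?G (t, x) \<partial>\<rho>) \<le> 4 * M\<^sup>2" by (simp add: prob_space)
  qed
  have ab: "0 \<le> a t" "a t \<le> 4 * M\<^sup>2" "0 \<le> b t" "b t \<le> 4 * M\<^sup>2" for t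
    unfolding a_def b_def using mean_bound[OF Kp, of t t] mean_bound[OF prob_space_normal_measure[OF s0] sets_normal_measure, of t t] by auto
  have int: "integrable \<pi>star a" "integrable \<pi>star b"
    by (rule \<pi>.integrable_const_bound[of _ "4 * M\<^sup>2"]; use ab in simp)+
  let ?q = "\<lambda>t. (\<bar>a t - b t\<bar> / ?L)\<^sup>2"
  have qb: "?q t \<le> (4 * M\<^sup>2 / ?L)\<^sup>2" for t
  proof (rule power_mono)
    have "\<bar>a t - b t\<bar> \<le> 4 * M\<^sup>2" using ab[of t] by linarith
    then show "\<bar>a t - b t\<bar> / ?L \<le> 4 * M\<^sup>2 / ?L" using loss_lipschitz_pos by (simp add: divide_right_mono)
  qed (use loss_lipschitz_pos in simp)
  have q: "integrable \<pi>star ?q"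
    by (rule \<pi>.integrable_const_bound[of _ "(4 * M\<^sup>2 / ?L)\<^sup>2"]) (use qb in auto)
  show thesis
  proof (rule that[of "\<integral>t. ?q t \<partial>\<pi>star"])
    show "0 \<le> (\<integral>t. ?q t \<partial>\<pi>star)" by (intro integral_nonneg_AE) auto
    have "ennreal (\<integral>t. ?q t \<partial>\<pi>star) = (\<integral>\<^sup>+t. ennreal (?q t) \<partial>\<pi>star)"
      by (rule nn_integral_eq_integral[symmetric, OF q]) auto
    also have "\<dots> \<le> (W2_sq n i)"
    proof (rule nn_integral_mono)
      fix t
      show "ennreal (?q t) \<le> (wasserstein 2 (K n i t) (normal_measure t (\<sigma> n i)))\<^sup>2"
        unfolding a_def b_def
      proof (rule lipschitz_le_wasserstein[OF _ Kp(1) Kp(2) _ _ loss_lipschitz_pos])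
        show "\<bar>?G (t, x) - ?G (t, y)\<bar> \<le> ?L * \<bar>x - y\<bar>" for x y by (rule G(4))
        show "\<bar>?G (t, x)\<bar> \<le> 4 * M\<^sup>2" for x using G(2,3)[of "(t, x)"] by simp
        show "(\<lambda>x. ?G (t, x)) \<in> borel_measurable borel" using G(1) by measurable
      qed auto
    qed
    finally show "ennreal (\<integral>t. ?q t \<partial>\<pi>star) \<le> (W2_sq n i)" .
    have "(\<integral>t. a t \<partial>\<pi>star) - (\<integral>t. b t \<partial>\<pi>star) = (\<integral>t. a t - b t \<partial>\<pi>star)" using int by simp
    also have "\<bar>\<dots>\<bar> \<le> (\<integral>t. \<bar>a t - b t\<bar> \<partial>\<pi>star)" by (rule integral_abs_bound)
    also have "\<dots> \<le> (\<integral>t. ?L * (e + ?q t / e) \<partial>\<pi>star)"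
    proof (rule integral_mono)
      fix t
      let ?u = "\<bar>a t - b t\<bar> / ?L"
      \<comment> \<open>one of the two summands is already at least \<open>u\<close>\<close>
      have split: "u \<le> e + u\<^sup>2 / e" if "0 \<le> u" for u
      proof (cases "u \<le> e")
        case False
        then have "u * e \<le> u\<^sup>2" using that by (simp add: power2_eq_square mult_left_mono)
        then have "u \<le> u\<^sup>2 / e" using e by (simp add: pos_le_divide_eq)
        then show ?thesis using e by simp
      qed (use e in \<open>auto intro: add_increasing2\<close>)
      have "?u \<le> e + ?q t / e" using loss_lipschitz_pos by (intro split) simp
      then have "?L * ?u \<le> ?L * (e + ?q t / e)" using loss_lipschitz_pos by (intro mult_left_mono) auto
      then show "\<bar>a t - b t\<bar> \<le> ?L * (e + ?q t / e)" using loss_lipschitz_pos by simp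
    qed (use int q in auto)
    also have "\<dots> = ?L * (e + (\<integral>t. ?q t \<partial>\<pi>star) / e)"
      using q by (simp add: \<pi>.prob_space)
    finally show "\<bar>bayes_risk n i (X n i)
      - bayes_risk n i (Z n i)\<bar> \<le> ?L * (e + (\<integral>t. ?q t \<partial>\<pi>star) / e)"
      by (simp only: risk_eq_loss[OF i X[OF i]] risk_eq_loss[OF i Z[OF i]] a(2) b(2))
  qed
qed

lemma bayes_risk_eventually:
  assumes e: "0 < e"
  shows "\<forall>\<^sub>F n in sequentially. avg n (\<lambda>i. \<bar>bayes_risk n i (X n i)
      - bayes_risk n i (Z n i)\<bar>) \<le> e"
proof -
  define \<delta> where "\<delta> = e / (2 * loss_lipschitz)"
  have \<delta>: "0 < \<delta>" using e loss_lipschitz_pos by (simp add: \<delta>_def)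
  have "\<forall>\<^sub>F n in sequentially. W_dist K \<pi>star \<sigma> n < ennreal \<delta>" using W \<delta> by (intro order_tendstoD(2)) auto
  then show ?thesis
  proof eventually_elim
    case (elim n)
    let ?W = "\<lambda>i. W2_sq n i"
    let ?R = "\<lambda>i. \<bar>bayes_risk n i (X n i)
      - bayes_risk n i (Z n i)\<bar>"
    have "\<forall>i\<in>{1..n}. \<exists>D. 0 \<le> D \<and> ennreal D \<le> ?W i \<and> ?R i \<le> loss_lipschitz * (\<delta> + D / \<delta>)"
      by (rule ballI) (erule bayes_risk_diff[OF _ \<delta>], blast)
    from bchoice[OF this]
    obtain D where "\<forall>i\<in>{1..n}. 0 \<le> D i \<and> ennreal (D i) \<le> ?W i \<and> ?R i \<le> loss_lipschitz * (\<delta> + D i / \<delta>)" ..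
    note D = this[rule_format]
    let ?Y = "ennreal (1 / real n) * (\<Sum>i=1..n. ?W i)"
    have Y: "?Y < ennreal (\<delta>\<^sup>2)"
    proof -
      have root: "ennreal_root 2 ?Y < ennreal \<delta>" using elim by (simp add: W_dist_def)
      have "?Y < \<infinity>" using root by (cases "?Y = \<infinity>") (auto simp: ennreal_root_def less_top)
      then obtain y where y: "?Y = ennreal y" "0 \<le> y" by (cases ?Y) auto
      have "ennreal (root 2 y) < ennreal \<delta>" using root y by (simp add: ennreal_root_def)
      then have "root 2 y < \<delta>" using y by (subst (asm) ennreal_less_iff) auto
      then have "(root 2 y)\<^sup>2 < \<delta>\<^sup>2" using y by (intro power_strict_mono) auto
      then show ?thesis using y by (simp add: ennreal_less_iff)
    qed
    have "ennreal (avg n D) = ennreal (1 / real n) * (\<Sum>i=1..n. ennreal (D i))"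
      by (rule ennreal_avg) (use D in blast)
    also have "\<dots> \<le> ?Y" by (intro mult_left_mono sum_mono) (use D in auto)
    finally have "ennreal (avg n D) < ennreal (\<delta>\<^sup>2)" using Y by (rule le_less_trans)
    then have aD: "avg n D \<le> \<delta>\<^sup>2" by (subst (asm) ennreal_less_iff) (auto intro!: avg_nonneg dest: D)
    have "avg n ?R \<le> avg n (\<lambda>i. loss_lipschitz * (\<delta> + 1 / \<delta> * D i))"
      using D by (intro avg_mono) auto
    also have "\<dots> = loss_lipschitz * (avg n (\<lambda>_. \<delta>) + 1 / \<delta> * avg n D)" unfolding avg_cmult avg_add ..
    also have "\<dots> \<le> loss_lipschitz * (\<delta> + 1 / \<delta> * \<delta>\<^sup>2)"
      using aD \<delta> loss_lipschitz_pos avg_const_le[of \<delta> n] by (intro mult_left_mono add_mono) auto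
    also have "\<dots> = e" using \<delta> loss_lipschitz_pos by (simp add: power2_eq_square \<delta>_def)
    finally show ?case .
  qed
qed

text \<open>On \<open>[-M, M]\<close> the squared error is Lipschitz in the estimate with constant \<open>4 M\<close>, which bounds the effect
  of the plug-in error on the risk. As \<open>sqrt\<close> is subadditive, risks that differ by at most \<open>(\<eta> / 2)\<^sup>2\<close>
  have roots that differ by at most \<open>\<eta> / 2\<close>.\<close>

lemma regret_tendsto_zero:
  assumes \<theta>hat: "\<And>n i \<omega>. i \<in> {1..n} \<Longrightarrow> \<omega> \<in> space (P n) \<Longrightarrow> \<theta>hat n i \<omega> = denoiser n i \<omega>"
  shows "regret P \<theta> \<theta>hat Z \<pi>star \<sigma> \<longlonglongrightarrow> 0"
proof (rule LIMSEQ_I)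
  fix \<eta> :: real assume \<eta>: "0 < \<eta>"
  define e where "e = (\<eta> / 2)\<^sup>2 / (2 * (1 + 4 * M))"
  have e: "0 < e" using \<eta> M_pos by (simp add: e_def)
  have "\<forall>\<^sub>F n in sequentially. norm (regret P \<theta> \<theta>hat Z \<pi>star \<sigma> n - 0) < \<eta>"
    using plug_in_error_mean[OF e] bayes_risk_eventually[OF e]
  proof eventually_elim
    case (elim n)
    interpret prob_space "P n" by (rule P)
    let ?h = "\<lambda>i \<omega>. denoiser n i \<omega>"
    let ?g = "\<lambda>i \<omega>. bayes n i (X n i \<omega>)"
    let ?A = "\<lambda>i. \<integral>\<omega>. \<bar>\<theta> n i \<omega> - \<theta>hat n i \<omega>\<bar>\<^sup>2 \<partial>P n"
    let ?A' = "\<lambda>i. \<integral>\<omega>. \<bar>\<theta> n i \<omega> - ?g i \<omega>\<bar>\<^sup>2 \<partial>P n"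
    let ?B = "\<lambda>i. \<integral>\<omega>. \<bar>\<theta> n i \<omega> - bayes n i (Z n i \<omega>)\<bar>\<^sup>2 \<partial>P n"
    have diff: "integrable (P n) (\<lambda>\<omega>. \<bar>?h i \<omega> - ?g i \<omega>\<bar>)" "\<bar>?A i - ?A' i\<bar> \<le> 4 * M * (\<integral>\<omega>. \<bar>?h i \<omega> - ?g i \<omega>\<bar> \<partial>P n)" if i: "i \<in> {1..n}" for i
    proof -
      note [measurable] = \<theta>[OF i] denoiser_measurable[OF i] bayes_measurable[OF i X[OF i]]
      have gb: "\<bar>?g i \<omega>\<bar> \<le> M" for \<omega> by (rule posterior_mean_bounded[OF \<pi>star \<sigma>(1)[OF i]])
      have bd: "AE \<omega> in P n. \<bar>\<theta> n i \<omega>\<bar> \<le> M \<and> \<bar>?h i \<omega>\<bar> \<le> M"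
        using \<theta>_bounded[OF i] denoiser_bounded[of n] by eventually_elim (use i in blast)
      have sq: "\<bar>u - v\<bar>\<^sup>2 \<le> 4 * M\<^sup>2" if "\<bar>u\<bar> \<le> M" "\<bar>v\<bar> \<le> M" for u v :: real
        using power_mono[of "\<bar>u - v\<bar>" "2 * M" 2] that by (simp add: power_mult_distrib)
      have i1: "integrable (P n) (\<lambda>\<omega>. \<bar>\<theta> n i \<omega> - ?h i \<omega>\<bar>\<^sup>2)"
      proof (rule integrable_const_bound[of _ "4 * M\<^sup>2"])
        show "AE \<omega> in P n. norm (\<bar>\<theta> n i \<omega> - ?h i \<omega>\<bar>\<^sup>2) \<le> 4 * M\<^sup>2" using bd by eventually_elim (use sq in auto)
      qed measurable
      have i2: "integrable (P n) (\<lambda>\<omega>. \<bar>\<theta> n i \<omega> - ?g i \<omega>\<bar>\<^sup>2)"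
      proof (rule integrable_const_bound[of _ "4 * M\<^sup>2"])
        show "AE \<omega> in P n. norm (\<bar>\<theta> n i \<omega> - ?g i \<omega>\<bar>\<^sup>2) \<le> 4 * M\<^sup>2" using bd by eventually_elim (use sq gb in auto)
      qed measurable
      show i3: "integrable (P n) (\<lambda>\<omega>. \<bar>?h i \<omega> - ?g i \<omega>\<bar>)"
      proof (rule integrable_const_bound[of _ "2 * M"])
        show "AE \<omega> in P n. norm \<bar>?h i \<omega> - ?g i \<omega>\<bar> \<le> 2 * M" using bd
        proof eventually_elim
          case (elim \<omega>)
          then show ?case using gb[of \<omega>] by (simp only: real_norm_def abs_abs) linarith
        qed
      qed measurable
      have "?A i = (\<integral>\<omega>. \<bar>\<theta> n i \<omega> - ?h i \<omega>\<bar>\<^sup>2 \<partial>P n)"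
        using \<theta>hat[OF i] by (intro Bochner_Integration.integral_cong) auto
      then have "\<bar>?A i - ?A' i\<bar> = \<bar>\<integral>\<omega>. \<bar>\<theta> n i \<omega> - ?h i \<omega>\<bar>\<^sup>2 - \<bar>\<theta> n i \<omega> - ?g i \<omega>\<bar>\<^sup>2 \<partial>P n\<bar>"
        using i1 i2 by simp
      also have "\<dots> \<le> (\<integral>\<omega>. \<bar>\<bar>\<theta> n i \<omega> - ?h i \<omega>\<bar>\<^sup>2 - \<bar>\<theta> n i \<omega> - ?g i \<omega>\<bar>\<^sup>2\<bar> \<partial>P n)" by (rule integral_abs_bound)
      also have "\<dots> \<le> (\<integral>\<omega>. 4 * M * \<bar>?h i \<omega> - ?g i \<omega>\<bar> \<partial>P n)"
      proof (rule integral_mono_AE)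
        show "AE \<omega> in P n. \<bar>\<bar>\<theta> n i \<omega> - ?h i \<omega>\<bar>\<^sup>2 - \<bar>\<theta> n i \<omega> - ?g i \<omega>\<bar>\<^sup>2\<bar> \<le> 4 * M * \<bar>?h i \<omega> - ?g i \<omega>\<bar>"
          using bd
        proof eventually_elim
          case (elim \<omega>)
          let ?t = "\<theta> n i \<omega>" and ?u = "?h i \<omega>" and ?v = "?g i \<omega>"
          have "\<bar>?t - ?u\<bar>\<^sup>2 - \<bar>?t - ?v\<bar>\<^sup>2 = (?v - ?u) * (2 * ?t - ?u - ?v)"
            by (simp add: power2_eq_square algebra_simps)
          then have "\<bar>\<bar>?t - ?u\<bar>\<^sup>2 - \<bar>?t - ?v\<bar>\<^sup>2\<bar> = \<bar>2 * ?t - ?u - ?v\<bar> * \<bar>?u - ?v\<bar>" by (simp add: abs_mult abs_minus_commute mult.commute)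
          also have "\<dots> \<le> 4 * M * \<bar>?u - ?v\<bar>"
          proof (rule mult_right_mono)
            show "\<bar>2 * ?t - ?u - ?v\<bar> \<le> 4 * M" using elim gb[of \<omega>] by linarith
          qed simp
          finally show ?case .
        qed
      qed (use i1 i2 i3 in auto)
      also have "\<dots> = 4 * M * (\<integral>\<omega>. \<bar>?h i \<omega> - ?g i \<omega>\<bar> \<partial>P n)" by simp
      finally show "\<bar>?A i - ?A' i\<bar> \<le> 4 * M * (\<integral>\<omega>. \<bar>?h i \<omega> - ?g i \<omega>\<bar> \<partial>P n)" .
    qed
    have "\<bar>avg n ?A - avg n ?A'\<bar> \<le> avg n (\<lambda>i. \<bar>?A i - ?A' i\<bar>)" unfolding avg_diff[symmetric] by (rule avg_abs)
    also have "\<dots> \<le> avg n (\<lambda>i. 4 * M * (\<integral>\<omega>. \<bar>?h i \<omega> - ?g i \<omega>\<bar> \<partial>P n))" by (intro avg_mono diff(2))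
    also have "\<dots> = 4 * M * (\<integral>\<omega>. avg n (\<lambda>i. \<bar>?h i \<omega> - ?g i \<omega>\<bar>) \<partial>P n)"
      unfolding avg_cmult using integral_avg[of n "P n" "\<lambda>i \<omega>. \<bar>?h i \<omega> - ?g i \<omega>\<bar>"] diff(1) by simp
    also have "\<dots> \<le> 4 * M * e" using elim(1) M_pos by (intro mult_left_mono) auto
    finally have 1: "\<bar>avg n ?A - avg n ?A'\<bar> \<le> 4 * M * e" .
    have "\<bar>avg n ?A' - avg n ?B\<bar> \<le> avg n (\<lambda>i. \<bar>?A' i - ?B i\<bar>)" unfolding avg_diff[symmetric] by (rule avg_abs)
    also have "\<dots> \<le> e" by (rule elim(2))
    finally have "\<bar>avg n ?A - avg n ?B\<bar> \<le> (1 + 4 * M) * e" using 1 by (simp add: distrib_right)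
    also have "\<dots> < (\<eta> / 2)\<^sup>2"
    proof -
      have "1 + 4 * M > 0" using M_pos by simp
      moreover have "k * (q / (2 * k)) = q / 2" if "0 < k" for k q :: real using that by simp
      ultimately have "(1 + 4 * M) * e = (\<eta> / 2)\<^sup>2 / 2" unfolding e_def by blast
      moreover have "0 < (\<eta> / 2)\<^sup>2" using \<eta> by simp
      ultimately show ?thesis by linarith
    qed
    finally have ab: "\<bar>avg n ?A - avg n ?B\<bar> < (\<eta> / 2)\<^sup>2" .
    have sqrt_diff: "sqrt x - sqrt y \<le> \<eta> / 2" if "0 \<le> x" "0 \<le> y" "x - y \<le> (\<eta> / 2)\<^sup>2" for x y
    proof -
      have "sqrt x \<le> sqrt (y + (\<eta> / 2)\<^sup>2)" using that by (intro real_sqrt_le_mono) simp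
      also have "\<dots> \<le> sqrt y + sqrt ((\<eta> / 2)\<^sup>2)" using that by (intro sqrt_add_le_add_sqrt) auto
      finally show ?thesis using \<eta> by (simp add: real_sqrt_abs)
    qed
    have nn: "0 \<le> avg n ?A" "0 \<le> avg n ?B" by (intro avg_nonneg integral_nonneg_AE; simp)+
    have "\<bar>sqrt (avg n ?A) - sqrt (avg n ?B)\<bar> \<le> \<eta> / 2"
    proof (rule abs_leI)
      show "sqrt (avg n ?A) - sqrt (avg n ?B) \<le> \<eta> / 2" by (rule sqrt_diff[OF nn]) (use ab in linarith)
      have "sqrt (avg n ?B) - sqrt (avg n ?A) \<le> \<eta> / 2" by (rule sqrt_diff[OF nn(2,1)]) (use ab in linarith)
      then show "- (sqrt (avg n ?A) - sqrt (avg n ?B)) \<le> \<eta> / 2" by linarith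
    qed
    moreover have "regret P \<theta> \<theta>hat Z \<pi>star \<sigma> n = sqrt (avg n ?A) - sqrt (avg n ?B)"
      by (simp add: regret_def avg_def)
    ultimately show ?case using \<eta> by simp
  qed
  then show "\<exists>no. \<forall>n\<ge>no. norm (regret P \<theta> \<theta>hat Z \<pi>star \<sigma> n - 0) < \<eta>" by (simp add: eventually_sequentially)
qed

end

end

section \<open>Consistency and vanishing regret\<close>
theorem theorem3p1:
  fixes P :: "nat \<Rightarrow> 'a measure"
    and M c C :: real
    and \<pi>star :: "real measure"
    and \<theta> X :: "nat \<Rightarrow> nat \<Rightarrow> 'a \<Rightarrow> real"
    and \<mu> :: "nat \<Rightarrow> nat \<Rightarrow> real measure"
    and \<sigma> :: "nat \<Rightarrow> nat \<Rightarrow> real"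
    and \<sigma>hat :: "nat \<Rightarrow> nat \<Rightarrow> 'a \<Rightarrow> real"
    and \<pi>hat :: "nat \<Rightarrow> 'a \<Rightarrow> real measure"
  assumes M: "M > 0"
    and \<pi>star: "\<pi>star \<in> prob_measures_on {-M..M}"
    and P: "\<And>n. prob_space (P n)"
    and \<theta>: "\<And>n i. i \<in> {1..n} \<Longrightarrow> \<theta> n i \<in> borel_measurable (P n)"
           "\<And>n i. i \<in> {1..n} \<Longrightarrow> distr (P n) borel (\<theta> n i) = \<pi>star"
    and X: "\<And>n i. i \<in> {1..n} \<Longrightarrow> X n i \<in> borel_measurable (P n)"
           "\<And>n i. i \<in> {1..n} \<Longrightarrow> distr (P n) borel (X n i) = \<mu> n i"
    and indep: "approx_independent P X"
    and \<sigma>hat: "\<And>n i. i \<in> {1..n} \<Longrightarrow>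
          \<exists>s \<in> borel_measurable (\<Pi>\<^sub>M j\<in>{1..n}. borel).
            \<forall>\<omega>\<in>space (P n). \<sigma>hat n i \<omega> = s (\<lambda>j\<in>{1..n}. X n j \<omega>)"
    and c_C: "c > 0" "C > 0"
    and bounds: "\<And>n. AE \<omega> in P n. \<forall>i\<in>{1..n}.
          c \<le> min (\<sigma>hat n i \<omega>) (\<sigma> n i) \<and> max (\<sigma>hat n i \<omega>) (\<sigma> n i) \<le> C"
    and \<pi>hat: "\<And>n. \<pi>hat n \<in> P n \<rightarrow>\<^sub>M prob_algebra borel"
          "\<And>n. AE \<omega> in P n. \<pi>hat n \<omega> \<in> prob_measures_on {-M..M}"
    and optimal: "\<exists>r::nat \<Rightarrow> real. r \<longlonglongrightarrow> 0 \<and> (\<forall>n. AE \<omega> in P n.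
          1 / real n * (\<Sum>i=1..n. ln (\<integral>t. normal_density 0 (\<sigma>hat n i \<omega>) (X n i \<omega> - t) \<partial>\<pi>hat n \<omega>))
          \<ge> 1 / real n * (\<Sum>i=1..n. ln (\<integral>t. normal_density 0 (\<sigma>hat n i \<omega>) (X n i \<omega> - t) \<partial>\<pi>star)) - r n)"
    and \<sigma>hat_consistent:
          "converges_in_prob P (\<lambda>n \<omega>. 1 / real n * (\<Sum>i=1..n. \<bar>\<sigma>hat n i \<omega> - \<sigma> n i\<bar>)) 0"
    and V: "V_dist \<mu> \<pi>star \<sigma> \<longlonglongrightarrow> 0"
  shows "converges_weakly_in_prob P \<pi>hat \<pi>star \<and>
    converges_in_prob P (\<lambda>n \<omega>. 1 / real n * (\<Sum>i=1..n.
      hellinger_sq (mixture_density (\<pi>hat n \<omega>) (\<sigma> n i)) (mixture_density \<pi>star (\<sigma> n i)))) 0 \<and>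
    (\<forall>(\<epsilon> :: nat \<Rightarrow> nat \<Rightarrow> 'a \<Rightarrow> real) (Z :: nat \<Rightarrow> nat \<Rightarrow> 'a \<Rightarrow> real)
      (K :: nat \<Rightarrow> nat \<Rightarrow> real \<Rightarrow> real measure) (\<theta>hat :: nat \<Rightarrow> nat \<Rightarrow> 'a \<Rightarrow> real).
      (\<forall>n. \<forall>i\<in>{1..n}. \<epsilon> n i \<in> borel_measurable (P n) \<and>
          distr (P n) borel (\<epsilon> n i) = normal_measure 0 (\<sigma> n i)) \<longrightarrow>
      (\<forall>n. prob_space.indep_vars (P n) (\<lambda>_. borel) (\<epsilon> n) {1..n}) \<longrightarrow>
      (\<forall>n. prob_space.indep_var (P n)
          (\<Pi>\<^sub>M i\<in>{1..n}. borel) (\<lambda>\<omega>. \<lambda>i\<in>{1..n}. \<epsilon> n i \<omega>)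
          (\<Pi>\<^sub>M i\<in>{1..n}. borel) (\<lambda>\<omega>. \<lambda>i\<in>{1..n}. \<theta> n i \<omega>)) \<longrightarrow>
      (\<forall>n. \<forall>i\<in>{1..n}. \<forall>\<omega>\<in>space (P n). Z n i \<omega> = \<theta> n i \<omega> + \<epsilon> n i \<omega>) \<longrightarrow>
      (\<forall>n. \<forall>i\<in>{1..n}. is_cond_law (P n) (X n i) (\<theta> n i) (K n i)) \<longrightarrow>
      W_dist K \<pi>star \<sigma> \<longlonglongrightarrow> 0 \<longrightarrow>
      (\<forall>n. \<forall>i\<in>{1..n}. \<forall>\<omega>\<in>space (P n).
          \<theta>hat n i \<omega> = posterior_mean (\<pi>hat n \<omega>) (\<sigma>hat n i \<omega>) (X n i \<omega>)) \<longrightarrow>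
      regret P \<theta> \<theta>hat Z \<pi>star \<sigma> \<longlonglongrightarrow> 0)"
proof -
  \<comment> \<open>for \<open>n = 0\<close> the bounds on the scales are void, so the first row of the array is used\<close>
  have "AE \<omega> in P 1. c \<le> C" using bounds[of 1] by eventually_elim auto
  then have c_le_C: "c \<le> C" by (simp only: prob_space.AE_const[OF P])
  interpret gaussian_location_model M c C
    by unfold_locales (use M c_C c_le_C in auto)
  have \<sigma>: "c \<le> \<sigma> n i \<and> \<sigma> n i \<le> C" if i: "i \<in> {1..n}" for n i
  proof -
    have "AE \<omega> in P n. c \<le> \<sigma> n i \<and> \<sigma> n i \<le> C" using bounds[of n]
      by eventually_elim (use i in auto)
    then show ?thesis by (simp only: prob_space.AE_const[OF P])
  qed
  have \<sigma>hat_measurable: "\<sigma>hat n i \<in> borel_measurable (P n)" if i: "i \<in> {1..n}" for n i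
  proof -
    from \<sigma>hat[OF i] obtain s where s: "s \<in> borel_measurable (\<Pi>\<^sub>M j\<in>{1..n}. borel)"
      "\<forall>\<omega>\<in>space (P n). \<sigma>hat n i \<omega> = s (\<lambda>j\<in>{1..n}. X n j \<omega>)" by blast
    have "(\<lambda>\<omega>. \<lambda>j\<in>{1..n}. X n j \<omega>) \<in> P n \<rightarrow>\<^sub>M (\<Pi>\<^sub>M j\<in>{1..n}. borel)"
      by (rule measurable_restrict) (rule X(1))
    from measurable_compose[OF this s(1)] show ?thesis
      by (rule measurable_cong[THEN iffD1, rotated]) (use s(2) in simp)
  qed
  obtain r where r: "r \<longlonglongrightarrow> 0" and opt: "\<And>n. AE \<omega> in P n.
          1 / real n * (\<Sum>i=1..n. ln (\<integral>t. normal_density 0 (\<sigma>hat n i \<omega>) (X n i \<omega> - t) \<partial>\<pi>hat n \<omega>))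
          \<ge> 1 / real n * (\<Sum>i=1..n. ln (\<integral>t. normal_density 0 (\<sigma>hat n i \<omega>) (X n i \<omega> - t) \<partial>\<pi>star)) - r n"
    using optimal by blast
  interpret gaussian_array M c C P \<pi>star X \<mu> \<sigma> \<sigma>hat \<pi>hat r
  proof (intro gaussian_array.intro gaussian_array_axioms.intro)
    show "AE \<omega> in P n. \<forall>i\<in>{1..n}. c \<le> \<sigma>hat n i \<omega> \<and> \<sigma>hat n i \<omega> \<le> C" for n
      using bounds[of n] by eventually_elim auto
    show "AE \<omega> in P n. avg n (\<lambda>i. ln (mixture_density \<pi>star (\<sigma>hat n i \<omega>) (X n i \<omega>))) - r n
       \<le> avg n (\<lambda>i. ln (mixture_density (\<pi>hat n \<omega>) (\<sigma>hat n i \<omega>) (X n i \<omega>)))" for n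
      unfolding avg_def mixture_density_def by (rule opt)
    show "converges_in_prob P (\<lambda>n \<omega>. avg n (\<lambda>i. \<bar>\<sigma>hat n i \<omega> - \<sigma> n i\<bar>)) 0"
      unfolding avg_def by (rule \<sigma>hat_consistent)
  qed (fact gaussian_location_model_axioms \<pi>star P X indep \<sigma>hat_measurable \<pi>hat r V \<sigma>[THEN conjunct1] \<sigma>[THEN conjunct2])+
  show ?thesis
  proof (intro conjI allI impI)
    show "converges_weakly_in_prob P \<pi>hat \<pi>star" by (rule prior_converges)
    show "converges_in_prob P (\<lambda>n \<omega>. 1 / real n * (\<Sum>i=1..n.
      hellinger_sq (mixture_density (\<pi>hat n \<omega>) (\<sigma> n i)) (mixture_density \<pi>star (\<sigma> n i)))) 0"
      using hellinger_converges unfolding avg_def .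
  next
    fix \<epsilon> Z K \<theta>hat
    assume \<epsilon>: "\<forall>n. \<forall>i\<in>{1..n}. \<epsilon> n i \<in> borel_measurable (P n) \<and> distr (P n) borel (\<epsilon> n i) = normal_measure 0 (\<sigma> n i)"
      and ind: "\<forall>n. prob_space.indep_var (P n)
          (\<Pi>\<^sub>M i\<in>{1..n}. borel) (\<lambda>\<omega>. \<lambda>i\<in>{1..n}. \<epsilon> n i \<omega>)
          (\<Pi>\<^sub>M i\<in>{1..n}. borel) (\<lambda>\<omega>. \<lambda>i\<in>{1..n}. \<theta> n i \<omega>)"
      and Z: "\<forall>n. \<forall>i\<in>{1..n}. \<forall>\<omega>\<in>space (P n). Z n i \<omega> = \<theta> n i \<omega> + \<epsilon> n i \<omega>"
      and K: "\<forall>n. \<forall>i\<in>{1..n}. is_cond_law (P n) (X n i) (\<theta> n i) (K n i)"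
      and W: "W_dist K \<pi>star \<sigma> \<longlonglongrightarrow> 0"
      and \<theta>hat: "\<forall>n. \<forall>i\<in>{1..n}. \<forall>\<omega>\<in>space (P n). \<theta>hat n i \<omega> = posterior_mean (\<pi>hat n \<omega>) (\<sigma>hat n i \<omega>) (X n i \<omega>)"
    show "regret P \<theta> \<theta>hat Z \<pi>star \<sigma> \<longlonglongrightarrow> 0"
    proof (rule regret_tendsto_zero[OF \<theta> _ _ _ _ W])
      fix n i :: nat assume i: "i \<in> {1..n}"
      have \<epsilon>i: "\<epsilon> n i \<in> borel_measurable (P n)" "distr (P n) borel (\<epsilon> n i) = normal_measure 0 (\<sigma> n i)"
        using \<epsilon> i by blast+
      have Zi: "Z n i \<omega> = \<theta> n i \<omega> + \<epsilon> n i \<omega>" if "\<omega> \<in> space (P n)" for \<omega> using Z i that by blast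
      have "(\<lambda>\<omega>. \<theta> n i \<omega> + \<epsilon> n i \<omega>) \<in> borel_measurable (P n)"
        using \<theta>(1)[OF i] \<epsilon>i(1) by (rule borel_measurable_add)
      then show "Z n i \<in> borel_measurable (P n)"
        by (rule measurable_cong[THEN iffD1, rotated]) (simp add: Zi)
      have proj: "(\<lambda>x. x i) \<in> borel_measurable (\<Pi>\<^sub>M j\<in>{1..n}. (borel :: real measure))"
        using i by (rule measurable_component_singleton)
      have "prob_space.indep_var (P n) borel ((\<lambda>x. x i) \<circ> (\<lambda>\<omega>. \<lambda>j\<in>{1..n}. \<epsilon> n j \<omega>))
          borel ((\<lambda>x. x i) \<circ> (\<lambda>\<omega>. \<lambda>j\<in>{1..n}. \<theta> n j \<omega>))"
        by (rule prob_space.indep_var_compose[OF P ind[rule_format] proj proj])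
      then have "prob_space.indep_var (P n) borel (\<epsilon> n i) borel (\<theta> n i)"
        using i by (simp add: o_def)
      then show "disintegrates (P n) (Z n i) (\<theta> n i) (\<lambda>t. normal_measure t (\<sigma> n i))"
        using \<sigma>[OF i] c_C by (intro additive_noise_disintegrates[OF P \<theta>(1)[OF i] \<epsilon>i(1) _ \<epsilon>i(2) _ Zi]) auto
      show "disintegrates (P n) (X n i) (\<theta> n i) (K n i)"
        by (rule is_cond_law_disintegrates[OF P \<theta>(1)[OF i] X(1)[OF i]]) (use K i in blast)
      show "K n i \<in> borel \<rightarrow>\<^sub>M prob_algebra borel"
        using K i by (auto simp: is_cond_law_def)
    next
      fix n i \<omega> assume "i \<in> {1..n}" "\<omega> \<in> space (P n)"
      then show "\<theta>hat n i \<omega> = posterior_mean (\<pi>hat n \<omega>) (\<sigma>hat n i \<omega>) (X n i \<omega>)" using \<theta>hat by blast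
    qed
  qed
qed

end
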